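(* Let $K$ be a field, let $E$ be an arbitrary directed graph, and let $L=L_K(E)$ be the Leavitt path algebra of $E$ over $K$. For any two (two-sided) ideals $A,B$ of $L$, $$(A+B)(A\cap B)=AB.$$
   Context: Directed graph: $E=(E^0,E^1,r,s)$ consists of two countable sets $E^0$ (vertices) and $E^1$ (edges) and functions $r,s:E^1\to E^0$ (range and source). A vertex $v$ is regular if $s^{-1}(v)$ is non-empty and finite. Leavitt path algebra: $L_K(E)$ is the (associative, not necessarily unital) $K$-algebra generated by $E^0\cup E^1\cup\{e^*: e\in E^1\}$ subject to the relations - $vw=\delta_{v,w}v$ for $v,w\in E^0$; - $s(e)e=e=e\,r(e)$ and $r(e)e^*=e^*=e^*s(e)$ for $e\in E^1$; - (CK1) $e^*f=\delta_{e,f}\,r(f)$ for $e,f\in E^1$; - (CK2) $v=\sum_{e\in s^{-1}(v)}ee^*$ for every regular vertex $v$. Ideals are two-sided, and the product $AB$ of ideals is the set of finite sums of elements $ab$ with $a\in A$, $b\in B$. *)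

theory Defs
  imports
    "HOL-Library.Countable_Set"
    "HOL-Library.Poly_Mapping"
    "HOL-Algebra.Ideal_Product"
    "HOL-Algebra.QuotRing"
    "HOL-Algebra.Module"
    "Graph_Theory.Digraph"
begin

text \<open>
  Leavitt path algebras need not be unital, so the locale \<open>ring\<close> of HOL-Algebra does not apply.
  Its record is reused nevertheless; the field \<open>one\<close> of the structures below is a dummy value and
  in general not an element of the carrier.
\<close>

subsection \<open>Two-sided ideals in rings without unit\<close>

definition two_sided_ideal :: "('a, 'm) ring_scheme \<Rightarrow> 'a set \<Rightarrow> bool" where
  "two_sided_ideal R I \<longleftrightarrow>
     additive_subgroup I R \<and>
     (\<forall>a\<in>I. \<forall>x\<in>carrier R. x \<otimes>\<^bsub>R\<^esub> a \<in> I \<and> a \<otimes>\<^bsub>R\<^esub> x \<in> I)"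

lemma (in ring) two_sided_ideal_iff_ideal: "two_sided_ideal R I \<longleftrightarrow> ideal I R"
proof
  assume "two_sided_ideal R I"
  then show "ideal I R"
    unfolding two_sided_ideal_def
    by (intro idealI ring_axioms) (auto simp: additive_subgroup_def)
next
  assume "ideal I R"
  then show "two_sided_ideal R I"
    by (auto simp: two_sided_ideal_def ideal.axioms ideal.I_l_closed ideal.I_r_closed)
qed

definition algebra_ideal :: "('k, 'a, 'm) module_scheme \<Rightarrow> 'a set \<Rightarrow> bool" where
  "algebra_ideal M I \<longleftrightarrow> two_sided_ideal M I \<and> (\<forall>c. \<forall>a\<in>I. c \<odot>\<^bsub>M\<^esub> a \<in> I)"

definition gen_algebra_ideal :: "('k, 'a, 'm) module_scheme \<Rightarrow> 'a set \<Rightarrow> 'a set" where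
  "gen_algebra_ideal M S = \<Inter>{I. algebra_ideal M I \<and> S \<subseteq> I}"

definition quot_algebra :: "('k, 'a, 'm) module_scheme \<Rightarrow> 'a set \<Rightarrow> ('k, 'a set) module" where
  "quot_algebra M I =
     ring.extend (M Quot I)
       (module.fields (\<lambda>c X. \<Union>x\<in>X. I +>\<^bsub>M\<^esub> (c \<odot>\<^bsub>M\<^esub> x)))"

subsection \<open>Free associative algebras\<close>

text \<open>
  Words are a copy of lists, made an additive monoid under concatenation so that the product of
  finitely supported functions on words is convolution. All of
  \<open>'g word \<Rightarrow>\<^sub>0 'k\<close> is the unital free algebra on \<open>'g\<close>; the
  non-unital one excludes the empty word.
\<close>

datatype 'g word = Word (letters: "'g list")

instantiation word :: (type) monoid_add
begin

definition zero_word :: "'a word" where "0 = Word []"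

definition plus_word :: "'a word \<Rightarrow> 'a word \<Rightarrow> 'a word" where
  "u + w = Word (letters u @ letters w)"

instance
  by standard (simp_all add: zero_word_def plus_word_def)

end

definition free_algebra :: "'g set \<Rightarrow> ('k::field, 'g word \<Rightarrow>\<^sub>0 'k) module" where
  "free_algebra X =
     \<lparr>carrier = {p. \<forall>w\<in>Poly_Mapping.keys p. letters w \<noteq> [] \<and> set (letters w) \<subseteq> X},
      mult = (*), one = 1, zero = 0, add = (+),
      smult = (\<lambda>c p. Poly_Mapping.single 0 c * p)\<rparr>"

definition letter :: "'g \<Rightarrow> 'g word \<Rightarrow>\<^sub>0 'k::field" where
  "letter g = Poly_Mapping.single (Word [g]) 1"

subsection \<open>Leavitt path algebras\<close>

text \<open>The source of an edge is its \<open>tail\<close>, the range its \<open>head\<close>.\<close>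

definition countable_digraph :: "('v, 'e) pre_digraph \<Rightarrow> bool" where
  "countable_digraph E \<longleftrightarrow> wf_digraph E \<and> countable (verts E) \<and> countable (arcs E)"

definition regular_vertex :: "('v, 'e) pre_digraph \<Rightarrow> 'v \<Rightarrow> bool" where
  "regular_vertex E v \<longleftrightarrow> v \<in> verts E \<and> out_arcs E v \<noteq> {} \<and> finite (out_arcs E v)"

datatype ('v, 'e) generator = Vertex 'v | Edge 'e | Ghost 'e

definition leavitt_generators :: "('v, 'e) pre_digraph \<Rightarrow> ('v, 'e) generator set" where
  "leavitt_generators E = Vertex ` verts E \<union> Edge ` arcs E \<union> Ghost ` arcs E"

abbreviation vtx :: "'v \<Rightarrow> ('v, 'e) generator word \<Rightarrow>\<^sub>0 'k::field" where
  "vtx v \<equiv> letter (Vertex v)"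

abbreviation edg :: "'e \<Rightarrow> ('v, 'e) generator word \<Rightarrow>\<^sub>0 'k::field" where
  "edg e \<equiv> letter (Edge e)"

abbreviation gst :: "'e \<Rightarrow> ('v, 'e) generator word \<Rightarrow>\<^sub>0 'k::field" where
  "gst e \<equiv> letter (Ghost e)"

text \<open>An element \<open>p\<close> of this set stands for the relation \<open>p = 0\<close>.\<close>

definition leavitt_relations ::
    "('v, 'e) pre_digraph \<Rightarrow> (('v, 'e) generator word \<Rightarrow>\<^sub>0 'k::field) set" where
  "leavitt_relations E =
     {vtx v * vtx w - (if v = w then vtx v else 0) | v w. v \<in> verts E \<and> w \<in> verts E} \<union>
     {vtx (tail E e) * edg e - edg e | e. e \<in> arcs E} \<union>
     {edg e * vtx (head E e) - edg e | e. e \<in> arcs E} \<union>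
     {vtx (head E e) * gst e - gst e | e. e \<in> arcs E} \<union>
     {gst e * vtx (tail E e) - gst e | e. e \<in> arcs E} \<union>
     {gst e * edg f - (if e = f then vtx (head E e) else 0) | e f. e \<in> arcs E \<and> f \<in> arcs E} \<union>
     {vtx v - (\<Sum>e\<in>out_arcs E v. edg e * gst e) | v. regular_vertex E v}"

definition leavitt_path_algebra ::
    "('v, 'e) pre_digraph \<Rightarrow> ('k::field, (('v, 'e) generator word \<Rightarrow>\<^sub>0 'k) set) module" where
  "leavitt_path_algebra E =
     (let F = free_algebra (leavitt_generators E)
      in quot_algebra F (gen_algebra_ideal F (leavitt_relations E)))"

end

theory Submission
  imports Defs "HOL-Computational_Algebra.Polynomial" "HOL-Library.Sublist"
begin

text \<open>
  Any finitely many elements of the Leavitt path algebra lie in a subring generated by finitely many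
  vertices, edges and ghosts. Splitting each of these vertices \<open>v\<close> into the sum of the \<open>e e*\<close> over the
  chosen edges \<open>e\<close> leaving \<open>v\<close> and its complement, one sees that the subring is an image \<open>R\<close> of the
  Leavitt path algebra of a finite graph. As the identity passes to quotients and to directed
  unions, it suffices to prove it for \<open>R\<close>.

  Let \<open>A\<close> be an ideal of \<open>R\<close>, let \<open>H\<close> be the set of vertices in \<open>A\<close>, and let \<open>w\<close> be a vertex outside
  \<open>H\<close>. If an element \<open>k w + (closed paths and ghosts at w)\<close> of \<open>A\<close> has \<open>k \<noteq> 0\<close>, then \<open>w\<close> lies on a cycle
  without exit modulo \<open>H\<close>: otherwise some path \<open>\<tau>\<close> from \<open>w\<close> avoids \<open>H\<close> and is no initial segment of a
  power of those closed paths, and conjugating with \<open>\<tau>\<close> yields \<open>k\<close> times a vertex outside \<open>H\<close>. Hence \<open>A\<close>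
  is the sum of the ideal spanned by \<open>H\<close> and of the \<open>R (w A w) R\<close> for such \<open>w\<close>, and \<open>w R w\<close> is,
  modulo \<open>H\<close>, a quotient of the ring of Laurent polynomials.

  For two ideals \<open>A\<close> and \<open>B\<close> let \<open>J\<close> be the ideal spanned by the vertices in \<open>A\<close> or \<open>B\<close>. Local units
  show that \<open>J \<inter> A \<inter> B\<close> is contained in all products in question. Modulo \<open>J\<close> everything happens in
  corners \<open>w R w\<close>, which are commutative principal ideal rings. This gives \<open>A B \<subseteq> B A\<close> and
  \<open>A B \<subseteq> (A + B) (A \<inter> B)\<close>, while \<open>(A + B) (A \<inter> B) \<subseteq> A B + B A\<close> is clear.
\<close>

text \<open>The identity is the rule gcd times lcm = product of principal ideal rings; the work lies
  in reaching commutative corners where it applies. Outside their vertices, \<open>A\<close> and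
  \<open>B\<close> live in corners at cycles without exit, but with respect to two different sets
  \<open>vs A\<close> and \<open>vs B\<close>, so they can be compared only modulo \<open>J\<close>.
  Working modulo \<open>J\<close> costs nothing: two elements of \<open>A \<inter> B\<close> that
  agree modulo \<open>J\<close> differ by an element of \<open>J \<inter> A \<inter> B\<close>. A
  second obstacle is that the subring \<open>R\<close> is known only as a homomorphic image, so its
  monomials may be linearly dependent and no normal form exists. The arguments therefore use spans,
  finite combinations with nonzero coefficients, and multiplications by paths and ghosts that
  isolate one coefficient. The splitting of vertices is forced by CK2, which fails in a finite part
  whenever only some of the edges leaving a vertex are chosen, as must happen at vertices emitting
  infinitely many edges.\<close>

definition add_closed :: "'a::ab_group_add set \<Rightarrow> bool" where
  "add_closed N \<longleftrightarrow> 0 \<in> N \<and> (\<forall>a\<in>N. \<forall>b\<in>N. a - b \<in> N)"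

lemma add_closedD:
  assumes "add_closed N"
  shows "0 \<in> N" "a \<in> N \<Longrightarrow> b \<in> N \<Longrightarrow> a - b \<in> N" "a \<in> N \<Longrightarrow> - a \<in> N"
    "a \<in> N \<Longrightarrow> b \<in> N \<Longrightarrow> a + b \<in> N"
proof -
  have z: "0 \<in> N" and d: "\<And>a b. a \<in> N \<Longrightarrow> b \<in> N \<Longrightarrow> a - b \<in> N"
    using assms by (auto simp: add_closed_def)
  have m: "- a \<in> N" if "a \<in> N" for a using d[OF z that] by simp
  have "a + b \<in> N" if "a \<in> N" "b \<in> N" for a b using d[OF that(1) m[OF that(2)]] by simp
  with z d m show "0 \<in> N" "a \<in> N \<Longrightarrow> b \<in> N \<Longrightarrow> a - b \<in> N" "a \<in> N \<Longrightarrow> - a \<in> N"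
    "a \<in> N \<Longrightarrow> b \<in> N \<Longrightarrow> a + b \<in> N" by blast+
qed

definition idealizer :: "'a::ring set \<Rightarrow> 'a set" where
  "idealizer N = {a. \<forall>n\<in>N. a * n \<in> N \<and> n * a \<in> N}"

lemma idealizerI: "(\<And>n. n \<in> N \<Longrightarrow> a * n \<in> N \<and> n * a \<in> N) \<Longrightarrow> a \<in> idealizer N"
  by (simp add: idealizer_def)

lemma idealizerD: "a \<in> idealizer N \<Longrightarrow> n \<in> N \<Longrightarrow> a * n \<in> N"
  "a \<in> idealizer N \<Longrightarrow> n \<in> N \<Longrightarrow> n * a \<in> N"
  by (simp_all add: idealizer_def)

lemma idealizer_closed:
  assumes "add_closed N"
  shows "0 \<in> idealizer N"
    "a \<in> idealizer N \<Longrightarrow> - a \<in> idealizer N"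
    "a \<in> idealizer N \<Longrightarrow> b \<in> idealizer N \<Longrightarrow> a + b \<in> idealizer N"
    "a \<in> idealizer N \<Longrightarrow> b \<in> idealizer N \<Longrightarrow> a - b \<in> idealizer N"
  using add_closedD[OF assms]
  by (auto simp: idealizer_def algebra_simps)

lemma idealizer_mult:
  "a \<in> idealizer N \<Longrightarrow> b \<in> idealizer N \<Longrightarrow> a * b \<in> idealizer N"
  by (simp add: idealizer_def mult.assoc) (metis mult.assoc)

lemma idealizer_one: "(1 :: 'a::ring_1) \<in> idealizer N"
  by (simp add: idealizer_def)

subsection \<open>A ring type containing all quotients\<close>

text \<open>
  The elements of \<open>'a uq\<close> are families indexed by all additive subgroups \<open>N\<close> of \<open>'a\<close>, with an entry
  in the quotient of the idealizer of \<open>N\<close> by \<open>N\<close>. Thus every quotient of a subring of \<open>'a\<close> embeds, via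
  \<open>qmap N\<close>, into the single type-class ring \<open>'a uq\<close>, and congruences modulo \<open>N\<close> become equations.
\<close>

definition uq_rel :: "('a::ring_1 set \<Rightarrow> 'a) \<Rightarrow> ('a set \<Rightarrow> 'a) \<Rightarrow> bool" where
  "uq_rel f g \<longleftrightarrow> (\<forall>N. add_closed N \<longrightarrow> f N \<in> idealizer N \<and> g N \<in> idealizer N \<and> f N - g N \<in> N)"

lemma part_equivp_uq_rel: "part_equivp (uq_rel :: ('a::ring_1 set \<Rightarrow> 'a) \<Rightarrow> _)"
proof (rule part_equivpI)
  show "\<exists>f :: 'a set \<Rightarrow> 'a. uq_rel f f"
    by (rule exI[of _ "\<lambda>_. 0"]) (auto simp: uq_rel_def idealizer_closed add_closedD)
  show "symp (uq_rel :: ('a set \<Rightarrow> 'a) \<Rightarrow> _)"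
  proof (rule sympI)
    fix f g :: "'a set \<Rightarrow> 'a" assume "uq_rel f g"
    then show "uq_rel g f"
      unfolding uq_rel_def by (metis add_closedD(3) minus_diff_eq)
  qed
  show "transp (uq_rel :: ('a set \<Rightarrow> 'a) \<Rightarrow> _)"
  proof (rule transpI)
    fix f g h :: "'a set \<Rightarrow> 'a" assume a: "uq_rel f g" "uq_rel g h"
    show "uq_rel f h"
      unfolding uq_rel_def
    proof (intro allI impI)
      fix N :: "'a set" assume N: "add_closed N"
      have "f N - h N = (f N - g N) + (g N - h N)" by simp
      then show "f N \<in> idealizer N \<and> h N \<in> idealizer N \<and> f N - h N \<in> N"
        using a N add_closedD(4)[OF N] unfolding uq_rel_def by metis
    qed
  qed
qed

quotient_type (overloaded) 'a uq = "'a::ring_1 set \<Rightarrow> 'a" / partial: uq_rel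
  by (rule part_equivp_uq_rel)

instantiation uq :: (ring_1) ring_1
begin

lift_definition zero_uq :: "'a uq" is "\<lambda>_. 0"
  by (auto simp: uq_rel_def idealizer_closed add_closedD)

lift_definition one_uq :: "'a uq" is "\<lambda>_. 1"
  by (auto simp: uq_rel_def idealizer_one add_closedD)

lift_definition plus_uq :: "'a uq \<Rightarrow> 'a uq \<Rightarrow> 'a uq" is "\<lambda>f g N. f N + g N"
  by (auto simp: uq_rel_def idealizer_closed add_diff_add intro: add_closedD(4))

lift_definition uminus_uq :: "'a uq \<Rightarrow> 'a uq" is "\<lambda>f N. - f N"
  by (auto simp: uq_rel_def idealizer_closed) (metis add_closedD(3) minus_diff_eq)

lift_definition minus_uq :: "'a uq \<Rightarrow> 'a uq \<Rightarrow> 'a uq" is "\<lambda>f g N. f N - g N"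
proof -
  fix f f' g g' :: "'a set \<Rightarrow> 'a" assume a: "uq_rel f f'" "uq_rel g g'"
  have "(f N - g N) - (f' N - g' N) = (f N - f' N) - (g N - g' N)" for N by simp
  then show "uq_rel (\<lambda>N. f N - g N) (\<lambda>N. f' N - g' N)"
    using a by (auto simp only: uq_rel_def idealizer_closed intro: add_closedD(2))
qed

lift_definition times_uq :: "'a uq \<Rightarrow> 'a uq \<Rightarrow> 'a uq" is "\<lambda>f g N. f N * g N"
proof -
  fix f f' g g' :: "'a set \<Rightarrow> 'a" assume a: "uq_rel f f'" "uq_rel g g'"
  have "f N * g N - f' N * g' N = (f N - f' N) * g N + f' N * (g N - g' N)" for N
    by (simp add: algebra_simps)
  then show "uq_rel (\<lambda>N. f N * g N) (\<lambda>N. f' N * g' N)"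
    using a by (auto simp only: uq_rel_def idealizer_mult intro!: add_closedD(4) intro: idealizerD)
qed

instance
proof
  fix a b c :: "'a uq"
  have *: "uq_rel f f \<Longrightarrow> add_closed N \<Longrightarrow> f N \<in> idealizer N" for f :: "'a set \<Rightarrow> 'a" and N
    by (simp add: uq_rel_def)
  show "a + b + c = a + (b + c)" by transfer (auto simp: uq_rel_def algebra_simps idealizer_closed add_closedD)
  show "a + b = b + a" by transfer (auto simp: uq_rel_def algebra_simps idealizer_closed add_closedD)
  show "0 + a = a" by transfer (auto simp: uq_rel_def)
  show "- a + a = 0" by transfer (auto simp: uq_rel_def add_closedD idealizer_closed)
  show "a - b = a + - b" by transfer (auto simp: uq_rel_def add_closedD idealizer_closed)
  show "a * b * c = a * (b * c)" by transfer (auto simp: uq_rel_def mult.assoc idealizer_mult add_closedD)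
  show "1 * a = a" "a * 1 = a" by (transfer; auto simp: uq_rel_def)+
  show "(a + b) * c = a * c + b * c"
    by transfer (auto simp: uq_rel_def distrib_right idealizer_mult idealizer_closed add_closedD)
  show "a * (b + c) = a * b + a * c"
    by transfer (auto simp: uq_rel_def distrib_left idealizer_mult idealizer_closed add_closedD)
  show "(0 :: 'a uq) \<noteq> 1"
  proof (transfer, unfold uq_rel_def, rule notI)
    assume a: "\<forall>N. add_closed N \<longrightarrow>
      (0::'a) \<in> idealizer N \<and> (1::'a) \<in> idealizer N \<and> (0::'a) - 1 \<in> N"
    \<comment> \<open>The idealizer of \<open>{0}\<close> is everything, so the entry there is a
      copy of \<open>'a\<close>, which separates 0 from 1.\<close>
    have "add_closed {0 :: 'a}" by (simp add: add_closed_def)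
    with a have "(0::'a) - 1 \<in> {0}" by blast
    then show False by simp
  qed
qed

end

text \<open>All entries but the one at \<open>N\<close> are zero, so \<open>qmap N 1\<close> is
  idempotent but in general not the unit of \<open>'a uq\<close>. This is why the families below
  require of the scalars only that \<open>sc 1\<close> fixes the vertices.\<close>

lift_definition qmap :: "'a::ring_1 set \<Rightarrow> 'a \<Rightarrow> 'a uq" is
  "\<lambda>N a M. if M = N \<and> a \<in> idealizer N then a else 0"
  by (auto simp: uq_rel_def idealizer_closed add_closedD)

lemma qmap_hom:
  assumes N: "add_closed N" and a: "a \<in> idealizer N" and b: "b \<in> idealizer N"
  shows "qmap N (a + b) = qmap N a + qmap N b" "qmap N (a - b) = qmap N a - qmap N b"
    "qmap N (- a) = - qmap N a" "qmap N (a * b) = qmap N a * qmap N b"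
    "qmap N a = 0 \<longleftrightarrow> a \<in> N"
proof -
  note c = a b idealizer_closed(2)[OF N a] idealizer_closed(3,4)[OF N a b] idealizer_mult[OF a b]
  show "qmap N (a + b) = qmap N a + qmap N b"
    using c by transfer (auto simp: uq_rel_def idealizer_closed add_closedD)
  show "qmap N (a - b) = qmap N a - qmap N b"
    using c by transfer (auto simp: uq_rel_def idealizer_closed add_closedD)
  show "qmap N (- a) = - qmap N a"
    using c by transfer (auto simp: uq_rel_def idealizer_closed add_closedD)
  show "qmap N (a * b) = qmap N a * qmap N b"
    using c by transfer (auto simp: uq_rel_def idealizer_closed idealizer_mult add_closedD)
  show "qmap N a = 0 \<longleftrightarrow> a \<in> N"
    using a N by transfer (auto simp: uq_rel_def idealizer_closed add_closedD)
qed

lemma qmap_0: "qmap N 0 = 0"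
  by transfer (auto simp: uq_rel_def idealizer_closed add_closedD)

lemma qmap_eq_iff:
  assumes "add_closed N" "a \<in> idealizer N" "b \<in> idealizer N"
  shows "qmap N a = qmap N b \<longleftrightarrow> a - b \<in> N"
  using qmap_hom(2)[OF assms] qmap_hom(5)[OF assms(1) idealizer_closed(4)[OF assms] assms(3)] by simp

subsection \<open>Additive spans and products\<close>

inductive_set aspan :: "'a::monoid_add set \<Rightarrow> 'a set" for S where
  zero: "0 \<in> aspan S"
| base: "a \<in> S \<Longrightarrow> a \<in> aspan S"
| add: "a \<in> aspan S \<Longrightarrow> b \<in> aspan S \<Longrightarrow> a + b \<in> aspan S"

lemma aspan_least:
  assumes "a \<in> aspan S" "S \<subseteq> T" "0 \<in> T" "\<And>a b. a \<in> T \<Longrightarrow> b \<in> T \<Longrightarrow> a + b \<in> T"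
  shows "a \<in> T"
  using assms(1) by induction (use assms in auto)

lemma aspan_mono: "S \<subseteq> T \<Longrightarrow> aspan S \<subseteq> aspan T"
proof
  fix a assume "a \<in> aspan S" "S \<subseteq> T"
  then show "a \<in> aspan T" by (induction, auto intro: aspan.intros)
qed

lemma aspan_image:
  assumes "a \<in> aspan S" "\<And>s. s \<in> S \<Longrightarrow> f s \<in> aspan T" "f 0 = 0" "\<And>a b. f (a + b) = f a + f b"
  shows "f a \<in> aspan T"
  using assms(1) by induction (use assms in \<open>auto intro: aspan.intros\<close>)

lemma aspan_sum: "(\<And>i. i \<in> I \<Longrightarrow> f i \<in> aspan S) \<Longrightarrow> sum f I \<in> aspan S"
  by (induction I rule: infinite_finite_induct) (auto intro: aspan.intros)

lemma add_closed_aspan: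
  fixes S :: "'a::ab_group_add set"
  assumes "\<And>s. s \<in> S \<Longrightarrow> - s \<in> S"
  shows "add_closed (aspan S)"
proof -
  have "- a \<in> aspan S" if "a \<in> aspan S" for a
    by (rule aspan_image[OF that]) (auto intro: aspan.base assms)
  then show ?thesis
    unfolding add_closed_def by (metis aspan.zero aspan.add diff_conv_add_uminus)
qed

lemma aspan_Un:
  fixes S :: "'a::ab_group_add set"
  assumes "a \<in> aspan (S \<union> T)"
  obtains b c where "b \<in> aspan S" "c \<in> aspan T" "a = b + c"
proof -
  have "\<exists>b\<in>aspan S. \<exists>c\<in>aspan T. a = b + c"
    using assms
  proof induction
    case zero
    show ?case using aspan.zero by force
  next
    case (base a)
    then consider "a \<in> S" | "a \<in> T" by blast
    then show ?case
      by cases (metis add.right_neutral aspan.base aspan.zero, metis add.left_neutral aspan.base aspan.zero)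
  next
    case (add a b)
    then obtain a1 a2 b1 b2 where "a1 \<in> aspan S" "a2 \<in> aspan T" "a = a1 + a2"
      "b1 \<in> aspan S" "b2 \<in> aspan T" "b = b1 + b2" by blast
    then show ?case
      by (intro bexI[of _ "a1 + b1"] bexI[of _ "a2 + b2"]) (auto intro: aspan.intros simp: algebra_simps)
  qed
  then show ?thesis using that by blast
qed

lemma add_closed_sum:
  "add_closed N \<Longrightarrow> (\<And>i. i \<in> I \<Longrightarrow> f i \<in> N) \<Longrightarrow> sum f I \<in> N"
  by (induction I rule: infinite_finite_induct) (simp_all add: add_closedD(1,4))

lemma aspan_least_closed: "a \<in> aspan S \<Longrightarrow> add_closed T \<Longrightarrow> S \<subseteq> T \<Longrightarrow> a \<in> T"
  by (erule aspan_least) (simp_all add: add_closedD(1,4))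

lemma aspan_mult:
  fixes S :: "'a::ring set"
  assumes "a \<in> aspan S" "b \<in> aspan T" "\<And>s t. s \<in> S \<Longrightarrow> t \<in> T \<Longrightarrow> s * t \<in> aspan U"
  shows "a * b \<in> aspan U"
proof (rule aspan_image[OF assms(1), of "\<lambda>a. a * b"])
  fix s assume "s \<in> S"
  then show "s * b \<in> aspan U"
    by (intro aspan_image[OF assms(2), of "\<lambda>b. s * b"] assms(3)) (auto simp: distrib_left)
qed (auto simp: distrib_right)

definition aprod :: "'a::ring set \<Rightarrow> 'a set \<Rightarrow> 'a set" where
  "aprod A B = aspan {a * b | a b. a \<in> A \<and> b \<in> B}"

lemma aprodI: "a \<in> A \<Longrightarrow> b \<in> B \<Longrightarrow> a * b \<in> aprod A B"
  unfolding aprod_def by (rule aspan.base) blast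

subsection \<open>Corners that are quotients of Laurent polynomial rings\<close>

text \<open>A nonzero combination of least degree divides every combination: the remainder is again
  one, of smaller degree.\<close>

lemma poly_bezout:
  fixes f g :: "'k::field poly"
  obtains h f1 g1 s t where "f = h * f1" "g = h * g1" "h = s * f + t * g"
proof (cases "f = 0 \<and> g = 0")
  case True
  then show ?thesis by (intro that[of 0 0 0 0 0]) auto
next
  case False
  define I where "I = {h. h \<noteq> 0 \<and> (\<exists>s t. h = s * f + t * g)}"
  have "f = 1 * f + 0 * g" "g = 0 * f + 1 * g" by simp_all
  then have "f \<noteq> 0 \<Longrightarrow> f \<in> I" "g \<noteq> 0 \<Longrightarrow> g \<in> I" unfolding I_def by blast+
  then have "\<exists>h. h \<in> I" using False by blast
  then obtain h where h: "h \<in> I" and min: "\<And>h'. h' \<in> I \<Longrightarrow> degree h \<le> degree h'"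
    using ex_has_least_nat[of "\<lambda>h. h \<in> I" _ degree] by blast
  from h obtain s t where st: "h = s * f + t * g" "h \<noteq> 0" unfolding I_def by blast
  have *: "h dvd c" if c: "c = s' * f + t' * g" for c s' t'
  proof (rule ccontr)
    assume "\<not> h dvd c"
    then have nz: "c mod h \<noteq> 0" by (simp add: dvd_eq_mod_eq_0)
    have "c - q * h = (s' - q * s) * f + (t' - q * t) * g" for q
      by (simp add: c st(1) algebra_simps)
    moreover have "c mod h = c - (c div h) * h" by (simp add: minus_div_mult_eq_mod)
    ultimately have "c mod h \<in> I" using nz unfolding I_def by fastforce
    with min have "degree h \<le> degree (c mod h)" by blast
    with degree_mod_less[OF st(2), of c] nz show False by linarith
  qed
  have "h dvd f" by (rule *[of _ 1 0]) simp
  moreover have "h dvd g" by (rule *[of _ 0 1]) simp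
  ultimately obtain f1 g1 where "f = h * f1" "g = h * g1" unfolding dvd_def by blast
  with st(1) show ?thesis using that by blast
qed

text \<open>\<open>w\<close> is the unit of its corner, in which \<open>C\<close> and
  \<open>C'\<close> are inverse to each other. Powers such as \<open>C ^ 0\<close> refer to the unit
  of the ambient ring, hence the extra factors \<open>w\<close> in statements about powers.\<close>

locale laurent_corner =
  fixes sc :: "'k::field \<Rightarrow> 'q::ring_1" and w C C' :: 'q
  assumes sc_add: "sc (a + b) = sc a + sc b"
    and sc_mult: "sc (a * b) = sc a * sc b"
    and sc_1: "sc 1 * w = w"
    and sc_w: "sc a * w = w * sc a"
    and sc_C: "sc a * C = C * sc a"
    and sc_C': "sc a * C' = C' * sc a"
    and ww: "w * w = w"
    and corner: "C * w = C" "w * C = C" "C' * w = C'" "w * C' = C'"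
    and inv: "C * C' = w" "C' * C = w"
begin

lemma sc_0: "sc 0 = 0"
  using sc_add[of 0 0] by simp

text \<open>Evaluation at \<open>C\<close> by Horner's scheme, with \<open>w\<close> as the
  unit.\<close>

definition ev :: "'k poly \<Rightarrow> 'q" where
  "ev f = fold_coeffs (\<lambda>a b. sc a * w + C * b) f 0"

lemma ev_0: "ev 0 = 0"
  by (simp add: ev_def)

lemma ev_pCons: "ev (pCons a f) = sc a * w + C * ev f"
  by (cases "f = 0 \<and> a = 0") (auto simp: ev_def sc_0)

lemma ev_add: "ev (f + g) = ev f + ev g"
  by (induction f g rule: poly_induct2) (simp_all add: ev_0 ev_pCons sc_add algebra_simps)

lemma ev_w: "ev f * w = ev f" "w * ev f = ev f"
proof (induction f)
  case (pCons b f)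
  {
    case 1
    show ?case by (simp add: ev_pCons pCons distrib_right mult.assoc ww)
  next
    case 2
    have "w * (sc b * w) = sc b * w" by (metis sc_w ww mult.assoc)
    moreover have "w * (C * ev f) = C * ev f" by (metis corner(2) mult.assoc)
    ultimately show ?case by (simp add: ev_pCons distrib_left)
  }
qed (simp_all add: ev_0)

lemma ev_smult: "ev (smult a f) = sc a * ev f"
proof (induction f)
  case (pCons b f)
  have "C * (sc a * ev f) = sc a * (C * ev f)"
    by (simp only: mult.assoc[symmetric] sc_C)
  with pCons show ?case
    by (simp only: smult_pCons ev_pCons sc_mult distrib_left mult.assoc)
qed (simp add: ev_0)

lemma C_ev: "C * ev f = ev f * C"
proof (induction f)
  case (pCons b f)
  have "C * (sc b * w) = sc b * w * C"
  proof -
    have "C * (sc b * w) = sc b * (C * w)" by (simp only: mult.assoc[symmetric] sc_C)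
    also have "\<dots> = sc b * (w * C)" by (simp only: corner)
    finally show ?thesis by (simp only: mult.assoc)
  qed
  moreover have "C * (C * ev f) = C * ev f * C" by (metis mult.assoc pCons.IH)
  ultimately show ?case by (simp add: ev_pCons distrib_left distrib_right)
qed (simp add: ev_0)

lemma C'_ev: "C' * ev f = ev f * C'"
proof -
  have "C' * ev f = C' * (ev f * (C * C'))" by (simp only: inv ev_w)
  also have "\<dots> = C' * (ev f * C) * C'" by (simp only: mult.assoc)
  also have "\<dots> = C' * (C * ev f) * C'" by (simp only: C_ev)
  also have "\<dots> = C' * C * ev f * C'" by (simp only: mult.assoc)
  also have "\<dots> = ev f * C'" by (simp only: inv ev_w)
  finally show ?thesis .
qed

lemma ev_mult: "ev (f * g) = ev f * ev g"
proof (induction f)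
  case (pCons b f)
  have "sc b * ev g = sc b * w * ev g" by (simp add: mult.assoc ev_w)
  with pCons show ?case
    by (simp add: ev_pCons ev_add ev_smult algebra_simps sc_0)
qed (simp add: ev_0)

lemma ev_comm: "ev f * ev g = ev g * ev f"
  by (metis ev_mult mult.commute)

lemma C'_pow_ev: "C' ^ n * ev f = ev f * C' ^ n"
proof (induction n)
  case (Suc n)
  have "ev f * C' ^ Suc n = C' * (ev f * C' ^ n)" by (simp only: power_Suc mult.assoc[symmetric] C'_ev)
  with Suc show ?case by (simp add: mult.assoc)
qed simp

text \<open>Laurent polynomials in \<open>C\<close>, described by clearing denominators; this
  reduces everything to ordinary polynomials.\<close>

definition laurent :: "'q set" where
  "laurent = {a. a * w = a \<and> w * a = a \<and> (\<exists>m f. C ^ m * a = ev f)}"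

lemma cancel_pow:
  assumes "w * a = a" shows "C' ^ m * (C ^ m * a) = a"
  using assms
proof (induction m)
  case (Suc m)
  have "C' ^ Suc m * (C ^ Suc m * a) = C' ^ m * (C' * C * (C ^ m * a))"
    by (simp add: power_Suc2 [of C'] mult.assoc del: power_Suc) (simp add: mult.assoc)
  also have "w * (C ^ m * a) = C ^ m * a"
    using Suc.prems corner(2) by (cases m) (simp_all flip: mult.assoc)
  then have "C' ^ m * (C' * C * (C ^ m * a)) = C' ^ m * (C ^ m * a)" by (simp add: inv)
  finally show ?case using Suc by simp
qed simp

lemma laurentE:
  assumes "a \<in> laurent"
  obtains m f where "C ^ m * a = ev f" "a = C' ^ m * ev f"
proof -
  from assms obtain m f where "C ^ m * a = ev f" "w * a = a" unfolding laurent_def by blast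
  moreover from this have "a = C' ^ m * ev f" using cancel_pow[of a m] by metis
  ultimately show ?thesis using that by blast
qed

lemma C'_ev_comm:
  "(C' ^ m * ev f) * (C' ^ n * ev g) = (C' ^ n * ev g) * (C' ^ m * ev f)"
proof -
  have "(C' ^ m * ev f) * (C' ^ n * ev g) = C' ^ (m + n) * (ev f * ev g)" for m n f g
  proof -
    have "(C' ^ m * ev f) * (C' ^ n * ev g) = C' ^ m * (ev f * C' ^ n) * ev g"
      by (simp add: mult.assoc)
    also have "\<dots> = C' ^ m * (C' ^ n * ev f) * ev g" by (simp add: C'_pow_ev)
    finally show ?thesis by (simp add: mult.assoc power_add)
  qed
  then show ?thesis by (simp only: ev_comm[of f g] add.commute[of m n])
qed

lemma laurent_comm: "a \<in> laurent \<Longrightarrow> b \<in> laurent \<Longrightarrow> a * b = b * a"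
  by (elim laurentE) (simp only: C'_ev_comm)

text \<open>\<open>s * a + t * b\<close> is a greatest common divisor and \<open>a * b1\<close> a least common multiple of \<open>a\<close> and \<open>b\<close>.\<close>

lemma laurent_bezout:
  assumes a: "a \<in> laurent" and b: "b \<in> laurent"
    and Q: "0 \<in> Q" "\<And>c. sc c * w \<in> Q" "C \<in> Q" "C' \<in> Q"
      "\<And>c d. c \<in> Q \<Longrightarrow> d \<in> Q \<Longrightarrow> c + d \<in> Q" "\<And>c d. c \<in> Q \<Longrightarrow> d \<in> Q \<Longrightarrow> c * d \<in> Q"
  obtains s t a1 b1 where "s \<in> Q" "t \<in> Q" "a1 \<in> Q" "b1 \<in> Q"
    "a * b1 = b * a1" "a * b = (s * a + t * b) * (a * b1)"
proof -
  obtain m f where f: "C ^ m * a = ev f" "a = C' ^ m * ev f" by (rule laurentE[OF a])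
  obtain n g where g: "C ^ n * b = ev g" "b = C' ^ n * ev g" by (rule laurentE[OF b])
  obtain h f1 g1 s t where h: "f = h * f1" "g = h * g1" "h = s * f + t * g"
    by (rule poly_bezout)
  \<comment> \<open>In the application \<open>Q\<close> is the image of \<open>R\<close>, so that
    coefficients in \<open>Q\<close> can be lifted from the quotient.\<close>
  have evQ: "ev f \<in> Q" for f by (induction f) (simp_all add: ev_0 ev_pCons Q)
  have evC': "C' ^ m * ev f \<in> Q" for m f
    by (induction m) (simp_all add: evQ mult.assoc Q)
  have evC: "C ^ m * ev f \<in> Q" for m f
    by (induction m) (simp_all add: evQ mult.assoc Q)
  have C_pow_ev: "ev f * C ^ n = C ^ n * ev f" for n f
  proof (induction n)
    case (Suc n)
    have "ev f * C ^ Suc n = C * (ev f * C ^ n)" by (simp only: power_Suc mult.assoc[symmetric] C_ev)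
    with Suc show ?case by (simp add: mult.assoc)
  qed simp
  let ?a1 = "C' ^ m * ev f1" and ?b1 = "C' ^ n * ev g1"
  \<comment> \<open>The powers of \<open>C\<close> clear the denominators, so Bezout's identity for
    \<open>f\<close> and \<open>g\<close> expresses the gcd \<open>ev h\<close> through
    \<open>a\<close> and \<open>b\<close>.\<close>
  have d: "ev s * C ^ m * a + ev t * C ^ n * b = ev h"
    using f(1) g(1) by (simp add: mult.assoc h(3) ev_add ev_mult)
  have pull: "C' ^ m * ev (h * f1) = ev h * (C' ^ m * ev f1)" for m f1
    unfolding ev_mult by (simp only: mult.assoc[symmetric] C'_pow_ev[of m h])
  have a1: "a = ev h * ?a1" unfolding f(2) h(1) by (rule pull)
  have b1: "b = ev h * ?b1" unfolding g(2) h(2) by (rule pull)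
  have c: "?a1 * ?b1 = ?b1 * ?a1" by (rule C'_ev_comm)
  have 1: "a * ?b1 = b * ?a1"
  proof -
    have "a * ?b1 = ev h * (?a1 * ?b1)" by (subst a1) (simp only: mult.assoc)
    also have "\<dots> = ev h * (?b1 * ?a1)" by (simp only: c)
    also have "\<dots> = b * ?a1" by (subst b1) (simp only: mult.assoc)
    finally show ?thesis .
  qed
  have 2: "a * ev h = ev h * a"
  proof -
    have "a * ev h = C' ^ m * (ev h * ev f)" by (simp only: f(2) mult.assoc ev_comm)
    also have "\<dots> = ev h * a" by (simp only: f(2) C'_pow_ev[of m h] mult.assoc[symmetric])
    finally show ?thesis .
  qed
  have 3: "a * b = (ev s * C ^ m * a + ev t * C ^ n * b) * (a * ?b1)"

  proof -
    have "a * b = a * ev h * ?b1" by (subst b1) (simp only: mult.assoc)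
    also have "\<dots> = ev h * a * ?b1" by (simp only: 2)
    finally show ?thesis by (simp only: d mult.assoc[of "ev h"])
  qed
  show ?thesis
  proof (rule that)
    show "ev s * C ^ m \<in> Q" "ev t * C ^ n \<in> Q" unfolding C_pow_ev by (rule evC)+
    show "?a1 \<in> Q" "?b1 \<in> Q" by (rule evC')+
  qed (fact 1, fact 3)
qed

lemma ev_monom: "ev (monom d n) = sc d * (C ^ n * w)"
proof (induction n)
  case 0
  then show ?case by (simp add: monom_0 ev_pCons ev_0)
next
  case (Suc n)
  have "C * (sc d * (C ^ n * w)) = sc d * (C * (C ^ n * w))"
    by (simp only: mult.assoc[symmetric] sc_C)
  with Suc show ?case by (simp add: monom_Suc ev_pCons sc_0 mult.assoc)
qed

lemma C_pow_C'_pow: "C ^ (m + j) * w * C' ^ j = C ^ m * w"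
proof (induction j)
  case (Suc j)
  have "C ^ (m + Suc j) * w * C' ^ Suc j = C ^ (m + j) * (C * w) * (C' * C' ^ j)"
    by (simp only: add_Suc_right power_Suc2[of C] power_Suc[of C'] mult.assoc)
  also have "\<dots> = C ^ (m + j) * (C * C') * C' ^ j" by (simp only: corner mult.assoc)
  also have "\<dots> = C ^ (m + j) * w * C' ^ j" by (simp only: inv)
  finally show ?case using Suc by simp
qed simp

text \<open>The condition \<open>j \<le> m\<close> excludes truncated subtraction. Since every
  larger \<open>m\<close> works as well, finitely many monomials have a common denominator.\<close>

lemma C_pow_ev_monom:
  assumes "j \<le> m"
  shows "C ^ m * (sc d * (C ^ i * w * C' ^ j)) = ev (monom d (m + i - j))"
proof -
  have pow: "C ^ n * sc d = sc d * C ^ n" for n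
  proof (induction n)
    case (Suc n)
    have "C ^ Suc n * sc d = C * (C ^ n * sc d)" by (simp only: power_Suc mult.assoc)
    also have "\<dots> = sc d * C ^ Suc n" by (simp only: Suc power_Suc mult.assoc[symmetric] sc_C)
    finally show ?case .
  qed simp
  have "C ^ m * (sc d * (C ^ i * w * C' ^ j)) = sc d * (C ^ (m + i) * w * C' ^ j)"
    by (simp only: mult.assoc[symmetric] pow power_add)
  also have "m + i = (m + i - j) + j" using assms by simp
  then have "C ^ (m + i) * w * C' ^ j = C ^ (m + i - j) * w" by (metis C_pow_C'_pow)
  finally show ?thesis by (simp only: ev_monom)
qed

end

subsection \<open>Leavitt families of finite graphs\<close>

abbreviation rep :: "nat \<Rightarrow> 'a list \<Rightarrow> 'a list" where
  "rep j \<delta> \<equiv> concat (replicate j \<delta>)"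

text \<open>
  Images of the vertices \<open>p\<close>, edges \<open>x\<close> and ghosts \<open>y\<close> of a finite graph under a homomorphism from its
  Leavitt path algebra, not necessarily injective; even \<open>p v = 0\<close> is possible.
\<close>

locale leavitt_family =
  fixes V :: "'v set" and D :: "'e set" and s r :: "'e \<Rightarrow> 'v"
    and sc :: "'k::field \<Rightarrow> 'r::ring_1" and p :: "'v \<Rightarrow> 'r" and x y :: "'e \<Rightarrow> 'r"
  assumes finite_V: "finite V" and finite_D: "finite D"
    and s_V: "e \<in> D \<Longrightarrow> s e \<in> V" and r_V: "e \<in> D \<Longrightarrow> r e \<in> V"
    and sc_add: "sc (a + b) = sc a + sc b"
    and sc_mult: "sc (a * b) = sc a * sc b"
    and sc_1: "v \<in> V \<Longrightarrow> sc 1 * p v = p v"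
    and sc_p: "v \<in> V \<Longrightarrow> sc a * p v = p v * sc a"
    and sc_x: "e \<in> D \<Longrightarrow> sc a * x e = x e * sc a"
    and sc_y: "e \<in> D \<Longrightarrow> sc a * y e = y e * sc a"
    and pp: "v \<in> V \<Longrightarrow> w \<in> V \<Longrightarrow> p v * p w = (if v = w then p v else 0)"
    and p_x: "e \<in> D \<Longrightarrow> p (s e) * x e = x e" and x_p: "e \<in> D \<Longrightarrow> x e * p (r e) = x e"
    and p_y: "e \<in> D \<Longrightarrow> p (r e) * y e = y e" and y_p: "e \<in> D \<Longrightarrow> y e * p (s e) = y e"
    and ck1: "e \<in> D \<Longrightarrow> f \<in> D \<Longrightarrow> y e * x f = (if e = f then p (r e) else 0)"
    and ck2: "e \<in> D \<Longrightarrow> p (s e) = (\<Sum>f | f \<in> D \<and> s f = s e. x f * y f)"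
begin

section \<open>Paths, ghosts and the monomials formed from them\<close>

primrec path :: "'v \<Rightarrow> 'e list \<Rightarrow> 'v \<Rightarrow> bool" where
  "path v [] u \<longleftrightarrow> v = u \<and> v \<in> V"
| "path v (e # \<pi>) u \<longleftrightarrow> e \<in> D \<and> s e = v \<and> path (r e) \<pi> u"

primrec xp :: "'v \<Rightarrow> 'e list \<Rightarrow> 'r" where
  "xp v [] = p v"
| "xp v (e # \<pi>) = x e * xp (r e) \<pi>"

primrec yp :: "'v \<Rightarrow> 'e list \<Rightarrow> 'r" where
  "yp v [] = p v"
| "yp v (e # \<pi>) = yp (r e) \<pi> * y e"

lemma path_V: "path v \<pi> u \<Longrightarrow> v \<in> V" "path v \<pi> u \<Longrightarrow> u \<in> V"
  by (induction \<pi> arbitrary: v) (auto simp: s_V)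

lemma path_unique: "path v \<pi> u \<Longrightarrow> path v \<pi> u' \<Longrightarrow> u = u'"
  by (induction \<pi> arbitrary: v) auto

lemma path_append: "path v (\<pi> @ \<beta>) u \<longleftrightarrow> (\<exists>w. path v \<pi> w \<and> path w \<beta> u)"
  by (induction \<pi> arbitrary: v) (auto dest: path_V)

lemma path_appendI: "path v \<pi> w \<Longrightarrow> path w \<beta> u \<Longrightarrow> path v (\<pi> @ \<beta>) u"
  by (auto simp: path_append)

lemma p_xp: "path v \<pi> u \<Longrightarrow> p v * xp v \<pi> = xp v \<pi>"
  by (cases \<pi>) (auto simp: pp p_x simp flip: mult.assoc)

lemma xp_p: "path v \<pi> u \<Longrightarrow> xp v \<pi> * p u = xp v \<pi>"
  by (induction \<pi> arbitrary: v) (auto simp: pp mult.assoc)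

lemma yp_p: "path v \<pi> u \<Longrightarrow> yp v \<pi> * p v = yp v \<pi>"
  by (cases \<pi>) (auto simp: pp y_p mult.assoc)

lemma p_yp: "path v \<pi> u \<Longrightarrow> p u * yp v \<pi> = yp v \<pi>"
  by (induction \<pi> arbitrary: v) (auto simp: pp simp flip: mult.assoc)

lemma xp_append: "path v \<pi> u \<Longrightarrow> path u \<beta> t \<Longrightarrow> xp v (\<pi> @ \<beta>) = xp v \<pi> * xp u \<beta>"
  by (induction \<pi> arbitrary: v) (auto simp: p_xp mult.assoc)

lemma yp_append: "path v \<pi> u \<Longrightarrow> path u \<beta> t \<Longrightarrow> yp v (\<pi> @ \<beta>) = yp u \<beta> * yp v \<pi>"
  by (induction \<pi> arbitrary: v) (auto simp: yp_p mult.assoc)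

lemma p_xp_neq: "path v \<pi> u \<Longrightarrow> w \<in> V \<Longrightarrow> w \<noteq> v \<Longrightarrow> p w * xp v \<pi> = 0"
  by (subst p_xp[symmetric], assumption) (simp add: pp path_V flip: mult.assoc)

lemma yp_p_neq: "path v \<pi> u \<Longrightarrow> w \<in> V \<Longrightarrow> w \<noteq> v \<Longrightarrow> yp v \<pi> * p w = 0"
  by (subst yp_p[symmetric], assumption) (simp add: pp path_V mult.assoc)

text \<open>CK1 annihilates the product at the first mismatch. Hence only comparable paths survive,
  and what the longer one has in excess remains, as a path or as a ghost.\<close>

lemma yp_xp:
  "path v \<pi> u \<Longrightarrow> path w \<beta> t \<Longrightarrow> yp v \<pi> * xp w \<beta> =
    (if v = w \<and> prefix \<pi> \<beta> then xp u (drop (length \<pi>) \<beta>)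
     else if v = w \<and> prefix \<beta> \<pi> then yp t (drop (length \<beta>) \<pi>) else 0)"
proof (induction \<pi> arbitrary: v w \<beta>)
  case Nil
  then show ?case by (auto simp: p_xp p_xp_neq)
next
  case (Cons e \<pi>)
  show ?case
  proof (cases \<beta>)
    case Nil
    with Cons.prems show ?thesis
      using yp_p[OF Cons.prems(1)] yp_p_neq[OF Cons.prems(1)] by auto
  next
    case b: (Cons f \<beta>')
    have "yp v (e # \<pi>) * xp w \<beta> = yp (r e) \<pi> * ((y e * x f) * xp (r f) \<beta>')"
      by (simp add: b mult.assoc)
    then show ?thesis
      using Cons.prems b Cons.IH[of "r e" "r f" \<beta>'] by (auto simp: ck1 p_xp)
  qed
qed

lemma yp_xp_same: "path v \<pi> u \<Longrightarrow> yp v \<pi> * xp v \<pi> = p u"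
  by (simp add: yp_xp)

lemma sc_xp: "path v \<pi> u \<Longrightarrow> sc c * xp v \<pi> = xp v \<pi> * sc c"
proof (induction \<pi> arbitrary: v)
  case (Cons e \<pi>)
  then have e: "e \<in> D" "sc c * xp (r e) \<pi> = xp (r e) \<pi> * sc c" by auto
  have "sc c * xp v (e # \<pi>) = x e * (sc c * xp (r e) \<pi>)"
    by (simp only: xp.simps mult.assoc[symmetric] sc_x[OF e(1)])
  then show ?case by (simp only: xp.simps e(2) mult.assoc)
qed (simp add: sc_p)

lemma sc_yp: "path v \<pi> u \<Longrightarrow> sc c * yp v \<pi> = yp v \<pi> * sc c"
proof (induction \<pi> arbitrary: v)
  case (Cons e \<pi>)
  then have e: "e \<in> D" "sc c * yp (r e) \<pi> = yp (r e) \<pi> * sc c" by auto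
  have "sc c * yp v (e # \<pi>) = yp (r e) \<pi> * (sc c * y e)"
    by (simp only: yp.simps mult.assoc[symmetric] e(2))
  then show ?case by (simp only: yp.simps sc_y[OF e(1)] mult.assoc)
qed (simp add: sc_p)

lemma sc_1_xp: "path v \<pi> u \<Longrightarrow> sc 1 * xp v \<pi> = xp v \<pi>"
proof -
  assume pth: "path v \<pi> u"
  have "sc 1 * (p v * xp v \<pi>) = p v * xp v \<pi>"
    by (simp only: mult.assoc[symmetric] sc_1[OF path_V(1)[OF pth]])
  then show ?thesis by (simp only: p_xp[OF pth])
qed

lemma sc_0: "sc 0 = 0"
  using sc_add[of 0 0] by simp

lemma sc_minus: "sc (- a) = - sc a"
  using sc_add[of "- a" a] by (simp add: sc_0 eq_neg_iff_add_eq_0)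

text \<open>For hereditary \<open>U\<close> the span of these monomials is the ideal of
  \<open>R\<close> generated by the vertices of \<open>U\<close>.\<close>

definition mon :: "'v set \<Rightarrow> 'r set" where
  "mon U = {sc c * (xp v \<pi> * yp w \<beta>) | c v \<pi> w \<beta> u. u \<in> U \<and> path v \<pi> u \<and> path w \<beta> u}"

abbreviation Sp :: "'v set \<Rightarrow> 'r set" where "Sp U \<equiv> aspan (mon U)"
abbreviation R :: "'r set" where "R \<equiv> Sp V"

lemma monI: "u \<in> U \<Longrightarrow> path v \<pi> u \<Longrightarrow> path w \<beta> u \<Longrightarrow> sc c * (xp v \<pi> * yp w \<beta>) \<in> mon U"
  unfolding mon_def by blast

lemma mon1I: "u \<in> U \<Longrightarrow> path v \<pi> u \<Longrightarrow> path w \<beta> u \<Longrightarrow> xp v \<pi> * yp w \<beta> \<in> mon U"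
  using monI[of u U v \<pi> w \<beta> 1] by (simp add: sc_1_xp flip: mult.assoc)

lemma monE:
  assumes "a \<in> mon U"
  obtains c v \<pi> w \<beta> u where "u \<in> U" "path v \<pi> u" "path w \<beta> u" "a = sc c * (xp v \<pi> * yp w \<beta>)"
  using assms unfolding mon_def by blast

lemma mon_mono: "U \<subseteq> U' \<Longrightarrow> mon U \<subseteq> mon U'"
  unfolding mon_def by blast

lemma Sp_mono: "U \<subseteq> U' \<Longrightarrow> Sp U \<subseteq> Sp U'"
  by (rule aspan_mono) (rule mon_mono)

definition hered :: "'v set \<Rightarrow> bool" where
  "hered H \<longleftrightarrow> H \<subseteq> V \<and> (\<forall>u \<pi> q. u \<in> H \<longrightarrow> path u \<pi> q \<longrightarrow> q \<in> H)"

lemma hered_V: "hered V"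
  by (auto simp: hered_def path_V)

lemma hered_Un: "hered H \<Longrightarrow> hered H' \<Longrightarrow> hered (H \<union> H')"
  unfolding hered_def by blast

text \<open>After cancellation the two paths of the product meet in one of the old meeting vertices,
  and that vertex is reachable from the other. A hereditary set containing either of them contains
  it, which settles left and right multiples at once.\<close>

lemma mon_mult:
  assumes "a \<in> mon U" "b \<in> mon U'"
  shows "a * b = 0 \<or> (\<exists>u\<in>U. \<exists>u'\<in>U'. \<exists>\<zeta> \<zeta>' q. path u \<zeta> q \<and> path u' \<zeta>' q \<and> a * b \<in> mon {q})"
proof -
  from assms obtain c v \<pi> w \<beta> u c' v' \<gamma> w' \<delta> u' where
    a: "u \<in> U" "path v \<pi> u" "path w \<beta> u" "a = sc c * (xp v \<pi> * yp w \<beta>)" and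
    b: "u' \<in> U'" "path v' \<gamma> u'" "path w' \<delta> u'" "b = sc c' * (xp v' \<gamma> * yp w' \<delta>)"
    unfolding mon_def by blast
  have ab: "a * b = sc (c * c') * (xp v \<pi> * (yp w \<beta> * xp v' \<gamma>) * yp w' \<delta>)"
  proof -
    have "a * b = sc c * (xp v \<pi> * (yp w \<beta> * sc c') * (xp v' \<gamma> * yp w' \<delta>))"
      by (simp only: a b mult.assoc)
    also have "\<dots> = sc c * ((xp v \<pi> * sc c') * (yp w \<beta> * (xp v' \<gamma> * yp w' \<delta>)))"
      by (simp only: sc_yp[OF a(3), symmetric] mult.assoc)
    also have "\<dots> = sc c * sc c' * (xp v \<pi> * (yp w \<beta> * (xp v' \<gamma> * yp w' \<delta>)))"
      by (simp only: sc_xp[OF a(2), symmetric] mult.assoc)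
    finally show ?thesis by (simp only: sc_mult mult.assoc)
  qed
  consider \<zeta> where "w = v'" "\<gamma> = \<beta> @ \<zeta>" | \<zeta> where "w = v'" "\<beta> = \<gamma> @ \<zeta>"
    | "w \<noteq> v' \<or> \<not> prefix \<beta> \<gamma> \<and> \<not> prefix \<gamma> \<beta>"
    by (auto simp: prefix_def)
  then show ?thesis
  proof cases
    case 1
    then have z: "path u \<zeta> u'" using a(3) b(2) path_unique by (auto simp: path_append)
    have "yp w \<beta> * xp v' \<gamma> = xp u \<zeta>" using yp_xp[OF a(3) b(2)] 1 by simp
    then have "a * b = sc (c * c') * (xp v (\<pi> @ \<zeta>) * yp w' \<delta>)"
      using ab xp_append[OF a(2) z] by simp
    then have "a * b \<in> mon {u'}" using path_appendI[OF a(2) z] b(3) by (auto intro: monI)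
    moreover have "path u' [] u'" using path_V(2)[OF b(2)] by simp
    ultimately show ?thesis using z a(1) b(1) by blast
  next
    case 2
    then have z: "path u' \<zeta> u" using a(3) b(2) path_unique by (auto simp: path_append)
    have "yp w \<beta> * xp v' \<gamma> = yp u' \<zeta>" using yp_xp[OF a(3) b(2)] 2 z
      by (auto simp: prefix_def)
    then have "a * b = sc (c * c') * (xp v \<pi> * yp w' (\<delta> @ \<zeta>))"
      using ab yp_append[OF b(3) z] by (simp add: mult.assoc)
    then have "a * b \<in> mon {u}" using path_appendI[OF b(3) z] a(2) by (auto intro: monI)
    moreover have "path u [] u" using path_V(2)[OF a(2)] by simp
    ultimately show ?thesis using z a(1) b(1) by blast
  next
    case 3
    then have "yp w \<beta> * xp v' \<gamma> = 0" using yp_xp[OF a(3) b(2)] by auto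
    with ab show ?thesis by simp
  qed
qed

lemma Sp_mult:
  assumes "hered H" "a \<in> Sp H" "b \<in> R"
  shows "a * b \<in> Sp H" "b * a \<in> Sp H"
proof -
  have q: "g \<in> Sp H" if "g \<in> mon {q}" "u \<in> H" "path u \<zeta> q" for g q u \<zeta>
  proof -
    have "{q} \<subseteq> H" using that(2,3) assms(1) unfolding hered_def by blast
    then show ?thesis using mon_mono[of "{q}" H] that(1) by (auto intro: aspan.base)
  qed
  have "g * h \<in> Sp H" "h * g \<in> Sp H" if "g \<in> mon H" "h \<in> mon V" for g h
  proof -
    show "g * h \<in> Sp H"
      using mon_mult[OF that] by (elim disjE bexE exE conjE) (auto simp: aspan.zero dest: q)
    show "h * g \<in> Sp H"
      using mon_mult[OF that(2,1)] by (elim disjE bexE exE conjE) (auto simp: aspan.zero dest: q)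
  qed
  then show "a * b \<in> Sp H" "b * a \<in> Sp H"
    using aspan_mult[OF assms(2,3)] aspan_mult[OF assms(3,2)] by blast+
qed

lemmas R_mult = Sp_mult(1)[OF hered_V]

lemma add_closed_Sp: "add_closed (Sp U)"
proof (rule add_closed_aspan)
  fix a assume "a \<in> mon U"
  then show "- a \<in> mon U"
    by (elim monE) (simp add: monI flip: sc_minus mult_minus_left)
qed

lemma sc_Sp: "a \<in> Sp U \<Longrightarrow> sc c * a \<in> Sp U"
proof (rule aspan_image[of a "mon U" "\<lambda>a. sc c * a"])
  fix b assume "b \<in> mon U"
  then obtain d v \<pi> w \<beta> u where "u \<in> U" "path v \<pi> u" "path w \<beta> u" "b = sc d * (xp v \<pi> * yp w \<beta>)"
    by (rule monE)
  then have "sc c * b = sc (c * d) * (xp v \<pi> * yp w \<beta>)" "path v \<pi> u" "path w \<beta> u" "u \<in> U"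
    by (simp_all only: sc_mult mult.assoc)
  then show "sc c * b \<in> Sp U" using monI[of u U v \<pi> w \<beta> "c * d"] by (simp add: aspan.base)
qed (auto simp: distrib_left)

lemma xp_R: "path v \<pi> u \<Longrightarrow> u \<in> U \<Longrightarrow> xp v \<pi> \<in> Sp U"
  using mon1I[of u U v \<pi> u "[]"] by (auto simp: xp_p path_V intro: aspan.base)

lemma yp_R: "path v \<pi> u \<Longrightarrow> u \<in> U \<Longrightarrow> yp v \<pi> \<in> Sp U"
  using mon1I[of u U u "[]" v \<pi>] by (auto simp: p_yp path_V intro: aspan.base)

lemma p_R: "v \<in> U \<Longrightarrow> v \<in> V \<Longrightarrow> p v \<in> Sp U"
  using xp_R[of v "[]" v] by simp

lemma x_R: "e \<in> D \<Longrightarrow> x e \<in> R"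
  using xp_R[of "s e" "[e]" "r e" V] by (simp add: x_p r_V)

lemma y_R: "e \<in> D \<Longrightarrow> y e \<in> R"
  using yp_R[of "s e" "[e]" "r e" V] by (simp add: p_y r_V)

lemma sum_p_p: "v \<in> V \<Longrightarrow> sum p V * p v = p v" "v \<in> V \<Longrightarrow> p v * sum p V = p v"
  by (simp_all add: sum_distrib_right sum_distrib_left pp finite_V)

lemma sum_p_R: "a \<in> R \<Longrightarrow> sum p V * a = a" "a \<in> R \<Longrightarrow> a * sum p V = a"
proof -
  have xp1: "sum p V * xp v \<pi> = xp v \<pi>" if "path v \<pi> u" for v \<pi> u
    by (metis that sum_p_p(1) p_xp path_V(1) mult.assoc)
  have yp1: "yp v \<pi> * sum p V = yp v \<pi>" if "path v \<pi> u" for v \<pi> u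
    by (metis that sum_p_p(2) yp_p path_V(1) mult.assoc)
  have k: "sum p V * sc c = sc c * sum p V" for c
    by (simp add: sum_distrib_right sum_distrib_left sc_p)
  have "sum p V * a = a \<and> a * sum p V = a" if "a \<in> R" for a
    using that
  proof induction
    case (base a)
    then obtain c v \<pi> w \<beta> u where a: "path v \<pi> u" "path w \<beta> u" "a = sc c * (xp v \<pi> * yp w \<beta>)"
      unfolding mon_def by blast
    have "sum p V * a = sc c * (sum p V * xp v \<pi> * yp w \<beta>)"
      by (simp only: a(3) mult.assoc[symmetric] k)
    then show ?case
      using xp1[OF a(1)] yp1[OF a(2)] by (simp add: a(3) mult.assoc)
  qed (simp_all add: distrib_left distrib_right)
  then show "a \<in> R \<Longrightarrow> sum p V * a = a" "a \<in> R \<Longrightarrow> a * sum p V = a" by blast+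
qed

lemma sc_R: "a \<in> R \<Longrightarrow> sc c * a = a * sc c"
proof (induction rule: aspan.induct)
  case (base a)
  then obtain d v \<pi> w \<beta> u where a: "path v \<pi> u" "path w \<beta> u" "a = sc d * (xp v \<pi> * yp w \<beta>)"
    unfolding mon_def by blast
  have "sc c * a = sc (c * d) * (xp v \<pi> * yp w \<beta>)" by (simp only: a(3) sc_mult mult.assoc)
  also have "\<dots> = sc d * (sc c * xp v \<pi> * yp w \<beta>)" by (simp only: mult.commute[of c] sc_mult mult.assoc)
  also have "\<dots> = sc d * (xp v \<pi> * (sc c * yp w \<beta>))" by (simp only: sc_xp[OF a(1)] mult.assoc)
  also have "\<dots> = a * sc c" by (simp only: sc_yp[OF a(2)] a(3) mult.assoc)
  finally show ?case .
qed (simp_all add: distrib_left distrib_right)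

section \<open>Expanding a vertex along a complete set of paths\<close>

primrec front :: "nat \<Rightarrow> 'v \<Rightarrow> 'e list set" where
  "front 0 v = {[]}"
| "front (Suc n) v = (if {e \<in> D. s e = v} = {} then {[]} else (\<Union>e\<in>{e \<in> D. s e = v}. Cons e ` front n (r e)))"

lemma front_path:
  "\<pi> \<in> front n v \<Longrightarrow> v \<in> V \<Longrightarrow>
    \<exists>u. path v \<pi> u \<and> (length \<pi> = n \<or> length \<pi> < n \<and> (\<forall>e\<in>D. s e \<noteq> u))"
proof (induction n arbitrary: v \<pi>)
  case (Suc n)
  show ?case
  proof (cases "{e \<in> D. s e = v} = {}")
    case True
    with Suc.prems show ?thesis by auto
  next
    case False
    with Suc.prems obtain e \<beta> where "e \<in> D" "s e = v" "\<pi> = e # \<beta>" "\<beta> \<in> front n (r e)"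
      by (auto split: if_splits)
    with Suc.IH[of \<beta> "r e"] r_V show ?thesis by auto
  qed
qed auto

text \<open>A path in the front has length \<open>n\<close> or stops at a sink; in neither case has
  it a proper extension of length at most \<open>n\<close>.\<close>

lemma front_maximal:
  assumes "\<pi> \<in> front n v" "path v \<beta> t" "length \<beta> \<le> n" "prefix \<pi> \<beta>"
  shows "\<pi> = \<beta>"
proof -
  from front_path[OF assms(1) path_V(1)[OF assms(2)]]
  obtain u where u: "path v \<pi> u" "length \<pi> = n \<or> length \<pi> < n \<and> (\<forall>e\<in>D. s e \<noteq> u)" by blast
  from assms(4) obtain \<zeta> where z: "\<beta> = \<pi> @ \<zeta>" by (auto simp: prefix_def)
  with assms(2) u(1) have "path u \<zeta> t" using path_unique by (auto simp: path_append)
  then show ?thesis using u(2) z assms(3) by (cases \<zeta>) auto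
qed

text \<open>CK2 iterated \<open>n\<close> times, stopping at sinks. Membership in a span spares the
  bookkeeping for an exact sum.\<close>

lemma front_span: "v \<in> V \<Longrightarrow> p v \<in> aspan {xp v \<pi> * yp v \<pi> | \<pi>. \<pi> \<in> front n v}"
proof (induction n arbitrary: v)
  case (Suc n)
  show ?case
  proof (cases "{e \<in> D. s e = v} = {}")
    case True
    have "xp v [] * yp v [] \<in> {xp v \<pi> * yp v \<pi> | \<pi>. \<pi> \<in> front (Suc n) v}"
      using True by (intro CollectI exI[of _ "[]"]) simp
    then show ?thesis using Suc.prems by (simp add: pp aspan.base)
  next
    case False
    have "p v = (\<Sum>e | e \<in> D \<and> s e = v. x e * y e)" using ck2 False by auto
    also have "\<dots> = (\<Sum>e | e \<in> D \<and> s e = v. x e * p (r e) * y e)"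
      by (rule sum.cong) (auto simp: x_p)
    also have "\<dots> \<in> aspan {xp v \<pi> * yp v \<pi> | \<pi>. \<pi> \<in> front (Suc n) v}"
    proof (rule aspan_sum)
      fix e assume e: "e \<in> {e. e \<in> D \<and> s e = v}"
      show "x e * p (r e) * y e \<in> aspan {xp v \<pi> * yp v \<pi> | \<pi>. \<pi> \<in> front (Suc n) v}"
      proof (rule aspan_image[OF Suc.IH[of "r e"], of "\<lambda>a. x e * a * y e"])
        fix b assume "b \<in> {xp (r e) \<pi> * yp (r e) \<pi> | \<pi>. \<pi> \<in> front n (r e)}"
        then obtain \<pi> where "\<pi> \<in> front n (r e)" "b = xp (r e) \<pi> * yp (r e) \<pi>" by blast
        then have "x e * b * y e = xp v (e # \<pi>) * yp v (e # \<pi>)" "e # \<pi> \<in> front (Suc n) v"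
          using e by (auto simp: mult.assoc)
        then show "x e * b * y e \<in> aspan {xp v \<pi> * yp v \<pi> | \<pi>. \<pi> \<in> front (Suc n) v}"
          by (intro aspan.base) blast
      qed (use e r_V in \<open>auto simp: distrib_left distrib_right\<close>)
    qed
    finally show ?thesis .
  qed
qed (auto simp: pp intro: aspan.base)

lemma decompose_left:
  assumes "a \<in> R"
  shows "a \<in> aspan {xp v \<pi> * (yp v \<pi> * a) | v \<pi>. v \<in> V \<and> \<pi> \<in> front n v}" (is "_ \<in> ?S")
proof -
  have "(\<Sum>v\<in>V. p v * a) \<in> ?S"
  proof (rule aspan_sum)
    fix v assume "v \<in> V"
    then show "p v * a \<in> ?S"
      by (intro aspan_image[OF front_span[of v n], of "\<lambda>b. b * a"])
        (auto simp: distrib_right mult.assoc intro!: aspan.base, blast)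
  qed
  then show ?thesis using sum_p_R(1)[OF assms] by (simp add: sum_distrib_right)
qed

lemma decompose_right:
  assumes "a \<in> R"
  shows "a \<in> aspan {(a * xp v \<pi>) * yp v \<pi> | v \<pi>. v \<in> V \<and> \<pi> \<in> front n v}" (is "_ \<in> ?S")
proof -
  have "(\<Sum>v\<in>V. a * p v) \<in> ?S"
  proof (rule aspan_sum)
    fix v assume "v \<in> V"
    then show "a * p v \<in> ?S"
      by (intro aspan_image[OF front_span[of v n], of "\<lambda>b. a * b"])
        (auto simp: distrib_left mult.assoc intro!: aspan.base)
  qed
  then show ?thesis using sum_p_R(2)[OF assms] by (simp add: sum_distrib_left)
qed

lemma R_least:
  assumes "0 \<in> T" "\<And>a b. a \<in> T \<Longrightarrow> b \<in> T \<Longrightarrow> a + b \<in> T" "\<And>a b. a \<in> T \<Longrightarrow> b \<in> T \<Longrightarrow> a * b \<in> T"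
    "\<And>c a. a \<in> T \<Longrightarrow> sc c * a \<in> T" "\<And>v. v \<in> V \<Longrightarrow> p v \<in> T"
    "\<And>e. e \<in> D \<Longrightarrow> x e \<in> T" "\<And>e. e \<in> D \<Longrightarrow> y e \<in> T"
  shows "R \<subseteq> T"
proof
  have xp: "path v \<pi> u \<Longrightarrow> xp v \<pi> \<in> T" for v \<pi> u by (induction \<pi> arbitrary: v) (auto simp: assms)
  have yp: "path v \<pi> u \<Longrightarrow> yp v \<pi> \<in> T" for v \<pi> u by (induction \<pi> arbitrary: v) (auto simp: assms)
  fix a assume "a \<in> R"
  then show "a \<in> T"
    by (rule aspan_least) (auto elim!: monE intro: assms xp yp)
qed

end

subsection \<open>Ideals and local units\<close>

context leavitt_family
begin

lemma path_append_iff: "path v \<pi> u \<Longrightarrow> path v (\<pi> @ \<beta>) t \<longleftrightarrow> path u \<beta> t"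
  using path_unique by (auto simp: path_append)

lemma path_replicate:
  assumes "path w \<delta> w" shows "path w (rep j \<delta>) w"
  using path_V(1)[OF assms] path_appendI[OF assms] by (induction j) simp_all

definition ghosts :: "'v \<Rightarrow> 'r set" where
  "ghosts u = {sc c * yp w \<epsilon> | c w \<epsilon>. path w \<epsilon> u}"

lemma ghostsI: "path w \<epsilon> u \<Longrightarrow> sc c * yp w \<epsilon> \<in> ghosts u"
  unfolding ghosts_def by blast

text \<open>Once \<open>n\<close> reaches the length of every real path in \<open>a\<close>, a path
  of the front either extends that path, leaving a ghost, or annihilates the monomial. An extension
  of a path ending in \<open>H\<close> ends in \<open>H\<close>, hence the vanishing. The claim for
  all larger \<open>n\<close> lets a sum take the maximum of two bounds.\<close>

lemma left_ghost:
  assumes "hered H" "a \<in> Sp H"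
  shows "\<exists>N. \<forall>n\<ge>N. \<forall>v \<pi> u. \<pi> \<in> front n v \<longrightarrow> path v \<pi> u \<longrightarrow>
    yp v \<pi> * a \<in> aspan (ghosts u) \<and> (u \<notin> H \<longrightarrow> yp v \<pi> * a = 0)"
  using assms(2)
proof induction
  case zero
  then show ?case by (auto intro: aspan.zero)
next
  case (base a)
  then obtain c v' \<gamma> w \<delta> u' where a: "u' \<in> H" "path v' \<gamma> u'" "path w \<delta> u'" "a = sc c * (xp v' \<gamma> * yp w \<delta>)"
    by (rule monE)
  show ?case
  proof (intro exI[of _ "length \<gamma>"] allI impI)
    fix n v \<pi> u assume n: "length \<gamma> \<le> n" and al: "\<pi> \<in> front n v" "path v \<pi> u"
    have eq: "yp v \<pi> * a = sc c * (yp v \<pi> * xp v' \<gamma> * yp w \<delta>)"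
      by (simp only: a(4) mult.assoc[symmetric] sc_yp[OF al(2)])
    consider "v = v'" "prefix \<gamma> \<pi>" | "v = v'" "prefix \<pi> \<gamma>" "\<pi> \<noteq> \<gamma>" | "v \<noteq> v' \<or> \<not> prefix \<pi> \<gamma> \<and> \<not> prefix \<gamma> \<pi>"
      by auto
    then show "yp v \<pi> * a \<in> aspan (ghosts u) \<and> (u \<notin> H \<longrightarrow> yp v \<pi> * a = 0)"
    proof cases
      case 1
      then obtain \<zeta> where z: "\<pi> = \<gamma> @ \<zeta>" by (auto simp: prefix_def)
      have pz: "path u' \<zeta> u" using z al(2) a(2) 1(1) path_unique by (auto simp: path_append)
      have "yp v \<pi> * xp v' \<gamma> = yp u' \<zeta>"
        using yp_xp[OF al(2) a(2)] 1 z pz by (auto simp: prefix_def)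
      then have "yp v \<pi> * a = sc c * yp w (\<delta> @ \<zeta>)" using eq yp_append[OF a(3) pz] by simp
      moreover have "u \<in> H" using assms(1) pz a(1) by (auto simp: hered_def)
      ultimately show ?thesis
        using ghostsI[OF path_appendI[OF a(3) pz]] by (simp add: aspan.base)
    next
      case 2
      with front_maximal[OF al(1) _ n] a(2) show ?thesis by blast
    next
      case 3
      then have "yp v \<pi> * xp v' \<gamma> = 0" using yp_xp[OF al(2) a(2)] by auto
      then show ?thesis by (simp add: eq aspan.zero)
    qed
  qed
next
  case (add a b)
  then obtain N N' where N: "\<forall>n\<ge>N. \<forall>v \<pi> u. \<pi> \<in> front n v \<longrightarrow> path v \<pi> u \<longrightarrow>
      yp v \<pi> * a \<in> aspan (ghosts u) \<and> (u \<notin> H \<longrightarrow> yp v \<pi> * a = 0)"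
    and N': "\<forall>n\<ge>N'. \<forall>v \<pi> u. \<pi> \<in> front n v \<longrightarrow> path v \<pi> u \<longrightarrow>
      yp v \<pi> * b \<in> aspan (ghosts u) \<and> (u \<notin> H \<longrightarrow> yp v \<pi> * b = 0)" by blast
  show ?case
  proof (intro exI[of _ "max N N'"] allI impI)
    fix n v \<pi> u assume n: "max N N' \<le> n" and al: "\<pi> \<in> front n v" "path v \<pi> u"
    have "yp v \<pi> * a \<in> aspan (ghosts u) \<and> (u \<notin> H \<longrightarrow> yp v \<pi> * a = 0)" using N n al by auto
    moreover have "yp v \<pi> * b \<in> aspan (ghosts u) \<and> (u \<notin> H \<longrightarrow> yp v \<pi> * b = 0)" using N' n al by auto
    ultimately show "yp v \<pi> * (a + b) \<in> aspan (ghosts u) \<and> (u \<notin> H \<longrightarrow> yp v \<pi> * (a + b) = 0)"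
      unfolding distrib_left by (simp add: aspan.add)
  qed
qed

text \<open>Mirror image of the vanishing part of \<open>left_ghost\<close>, now with respect to the
  ghosts in \<open>a\<close>.\<close>

lemma right_vanish:
  assumes "hered H" "a \<in> Sp H"
  shows "\<exists>N. \<forall>n\<ge>N. \<forall>v \<pi> u. \<pi> \<in> front n v \<longrightarrow> path v \<pi> u \<longrightarrow> u \<notin> H \<longrightarrow> a * xp v \<pi> = 0"
  using assms(2)
proof induction
  case (base a)
  then obtain c v' \<gamma> w \<delta> u' where a: "u' \<in> H" "path v' \<gamma> u'" "path w \<delta> u'" "a = sc c * (xp v' \<gamma> * yp w \<delta>)"
    by (rule monE)
  show ?case
  proof (intro exI[of _ "length \<delta>"] allI impI)
    fix n v \<pi> u assume n: "length \<delta> \<le> n" and al: "\<pi> \<in> front n v" "path v \<pi> u" "u \<notin> H"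
    have "\<not> (w = v \<and> prefix \<delta> \<pi>)"
    proof
      assume "w = v \<and> prefix \<delta> \<pi>"
      then obtain \<zeta> where "path u' \<zeta> u"
        using al(2) path_append_iff[OF a(3)] by (auto simp: prefix_def)
      with assms(1) a(1) al(3) show False by (auto simp: hered_def)
    qed
    moreover have "\<not> (w = v \<and> prefix \<pi> \<delta>)"
      using front_maximal[OF al(1) _ n] a(3) calculation by auto
    ultimately have "yp w \<delta> * xp v \<pi> = 0" using yp_xp[OF a(3) al(2)] by auto
    then show "a * xp v \<pi> = 0" by (simp add: a(4) mult.assoc)
  qed
next
  case (add a b)
  then obtain N N' where N: "\<forall>n\<ge>N. \<forall>v \<pi> u. \<pi> \<in> front n v \<longrightarrow> path v \<pi> u \<longrightarrow> u \<notin> H \<longrightarrow> a * xp v \<pi> = 0"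
    and N': "\<forall>n\<ge>N'. \<forall>v \<pi> u. \<pi> \<in> front n v \<longrightarrow> path v \<pi> u \<longrightarrow> u \<notin> H \<longrightarrow> b * xp v \<pi> = 0" by blast
  show ?case
  proof (intro exI[of _ "max N N'"] allI impI)
    fix n v \<pi> u assume n: "max N N' \<le> n" and al: "\<pi> \<in> front n v" "path v \<pi> u" "u \<notin> H"
    have "a * xp v \<pi> = 0" using N n al by auto
    moreover have "b * xp v \<pi> = 0" using N' n al by auto
    ultimately show "(a + b) * xp v \<pi> = 0" by (simp add: distrib_right)
  qed
qed simp

section \<open>Two-sided ideals of \<open>R\<close> and their local units\<close>

definition rideal :: "'r set \<Rightarrow> bool" where
  "rideal A \<longleftrightarrow> A \<subseteq> R \<and> add_closed A \<and> (\<forall>a\<in>A. \<forall>b\<in>R. a * b \<in> A \<and> b * a \<in> A)"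

lemma ridealD:
  assumes "rideal A"
  shows "a \<in> A \<Longrightarrow> a \<in> R" "add_closed A" "a \<in> A \<Longrightarrow> b \<in> R \<Longrightarrow> a * b \<in> A"
    "a \<in> A \<Longrightarrow> b \<in> R \<Longrightarrow> b * a \<in> A"
  using assms by (auto simp: rideal_def)

lemma rideal_Sp: "hered H \<Longrightarrow> rideal (Sp H)"
  unfolding rideal_def using Sp_mono[of H V] Sp_mult add_closed_Sp by (auto simp: hered_def)

lemma p_in_R: "v \<in> V \<Longrightarrow> p v \<in> R"
  by (rule p_R)

lemma xp_in_R: "path v \<pi> u \<Longrightarrow> xp v \<pi> \<in> R"
  by (rule xp_R) (auto dest: path_V)

lemma yp_in_R: "path v \<pi> u \<Longrightarrow> yp v \<pi> \<in> R"
  by (rule yp_R) (auto dest: path_V)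

text \<open>\<open>sum p V\<close> is a unit of \<open>R\<close>, and \<open>sc c * sum p V\<close>
  lies in \<open>R\<close>; so ideals in the ring sense absorb scalars.\<close>

lemma sc_ideal:
  assumes "rideal A" "a \<in> A" shows "sc c * a \<in> A"
proof -
  have "sc c * a = sc c * (sum p V * a)" by (simp only: sum_p_R(1)[OF ridealD(1)[OF assms]])
  also have "\<dots> = (sc c * sum p V) * a" by (simp only: mult.assoc)
  also have "\<dots> \<in> A"
    by (rule ridealD(4)[OF assms]) (auto intro: sc_Sp aspan_sum p_in_R)
  finally show ?thesis .
qed

lemma rideal_aprod:
  assumes "rideal A" "rideal B" shows "rideal (aprod A B)"
proof -
  have 1: "aprod A B \<subseteq> R"
    unfolding aprod_def
    by (auto elim!: aspan_least intro: aspan.zero aspan.add R_mult dest: ridealD(1)[OF assms(1)] ridealD(1)[OF assms(2)])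
  have 2: "add_closed (aprod A B)"
    unfolding aprod_def
  proof (rule add_closed_aspan)
    fix z assume "z \<in> {a * b | a b. a \<in> A \<and> b \<in> B}"
    then obtain a b where "z = a * b" "a \<in> A" "b \<in> B" by blast
    then have "- z = (- a) * b" "- a \<in> A" "b \<in> B" using add_closedD(3)[OF ridealD(2)[OF assms(1)]] by auto
    then show "- z \<in> {a * b | a b. a \<in> A \<and> b \<in> B}" by blast
  qed
  have 3: "z * c \<in> aprod A B" if "z \<in> aprod A B" "c \<in> R" for z c
    using that(1) unfolding aprod_def
    by (rule aspan_image[of _ _ "\<lambda>z. z * c"])
      (auto simp: distrib_right mult.assoc intro!: aspan.base dest: ridealD(3)[OF assms(2) _ that(2)], blast dest: ridealD(3)[OF assms(2) _ that(2)])
  have 4: "c * z \<in> aprod A B" if "z \<in> aprod A B" "c \<in> R" for z c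
    using that(1) unfolding aprod_def
    by (rule aspan_image[of _ _ "\<lambda>z. c * z"])
      (auto simp: distrib_left mult.assoc[symmetric] intro!: aspan.base dest: ridealD(4)[OF assms(1) _ that(2)], blast dest: ridealD(4)[OF assms(1) _ that(2)])
  from 1 2 3 4 show ?thesis by (auto simp: rideal_def)
qed

text \<open>Expand \<open>z\<close> along long paths \<open>\<pi>\<close>. Terms with
  \<open>\<pi>\<close> ending outside \<open>H\<close> vanish; in the others the ghost of
  \<open>\<pi>\<close> already carries its end vertex \<open>u\<close> as a left unit, so the
  hypothesis applies to it.\<close>

lemma left_units:
  assumes "rideal T" "hered H" "z \<in> Sp H" "\<And>u g. u \<in> H \<Longrightarrow> g \<in> R \<Longrightarrow> p u * (g * z) \<in> T"
  shows "z \<in> T"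
proof -
  from left_ghost[OF assms(2,3)] obtain n where n: "\<And>v \<pi> u. \<pi> \<in> front n v \<Longrightarrow> path v \<pi> u \<Longrightarrow> u \<notin> H \<Longrightarrow> yp v \<pi> * z = 0"
    by blast
  have "z \<in> R" using ridealD(1)[OF rideal_Sp[OF assms(2)] assms(3)] .
  from decompose_left[OF this, of n] ridealD(2)[OF assms(1)] show ?thesis
  proof (rule aspan_least_closed, safe)
    fix v \<pi> assume v: "v \<in> V" "\<pi> \<in> front n v"
    then obtain u where u: "path v \<pi> u" using front_path by blast
    show "xp v \<pi> * (yp v \<pi> * z) \<in> T"
    proof (cases "u \<in> H")
      case True
      have "yp v \<pi> * z = p u * (yp v \<pi> * z)" using p_yp[OF u] by (simp flip: mult.assoc)
      with assms(4)[OF True yp_in_R[OF u]] ridealD(4)[OF assms(1) _ xp_in_R[OF u]] show ?thesis by simp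
    next
      case False
      with n[OF v(2) u] show ?thesis by (simp add: add_closedD(1)[OF ridealD(2)[OF assms(1)]])
    qed
  qed
qed

lemma right_units:
  assumes "rideal T" "hered H" "z \<in> Sp H" "\<And>u g. u \<in> H \<Longrightarrow> g \<in> R \<Longrightarrow> (z * g) * p u \<in> T"
  shows "z \<in> T"
proof -
  from right_vanish[OF assms(2,3)] obtain n where n: "\<And>v \<pi> u. \<pi> \<in> front n v \<Longrightarrow> path v \<pi> u \<Longrightarrow> u \<notin> H \<Longrightarrow> z * xp v \<pi> = 0"
    by blast
  have "z \<in> R" using ridealD(1)[OF rideal_Sp[OF assms(2)] assms(3)] .
  from decompose_right[OF this, of n] ridealD(2)[OF assms(1)] show ?thesis
  proof (rule aspan_least_closed, safe)
    fix v \<pi> assume v: "v \<in> V" "\<pi> \<in> front n v"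
    then obtain u where u: "path v \<pi> u" using front_path by blast
    show "z * xp v \<pi> * yp v \<pi> \<in> T"
    proof (cases "u \<in> H")
      case True
      have "z * xp v \<pi> = (z * xp v \<pi>) * p u" using xp_p[OF u] by (simp add: mult.assoc)
      with assms(4)[OF True xp_in_R[OF u]] ridealD(3)[OF assms(1) _ yp_in_R[OF u]] show ?thesis by simp
    next
      case False
      with n[OF v(2) u] show ?thesis by (simp add: add_closedD(1)[OF ridealD(2)[OF assms(1)]])
    qed
  qed
qed

text \<open>A vertex with \<open>p v = 0\<close> belongs to \<open>vs A\<close> for every ideal
  \<open>A\<close>, so degenerate vertices never count as lying outside.\<close>

definition vs :: "'r set \<Rightarrow> 'v set" where
  "vs A = {v \<in> V. p v \<in> A}"

lemma vsD: "v \<in> vs A \<Longrightarrow> v \<in> V" "v \<in> vs A \<Longrightarrow> p v \<in> A"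
  by (auto simp: vs_def)

lemma hered_vs:
  assumes "rideal A" shows "hered (vs A)"
  unfolding hered_def
proof (intro conjI allI impI)
  fix u \<pi> q assume u: "u \<in> vs A" and pt: "path u \<pi> q"
  have "p q = yp u \<pi> * (p u * xp u \<pi>)" by (simp add: p_xp[OF pt] yp_xp_same[OF pt])
  also have "\<dots> \<in> A"
    using ridealD(3,4)[OF assms] vsD(2)[OF u] xp_in_R[OF pt] yp_in_R[OF pt] by blast
  finally show "q \<in> vs A" using path_V(2)[OF pt] by (simp add: vs_def)
qed (auto simp: vs_def)

lemma Sp_vs:
  assumes "rideal A" shows "Sp (vs A) \<subseteq> A"
proof
  fix a assume "a \<in> Sp (vs A)"
  then show "a \<in> A" using ridealD(2)[OF assms]
  proof (rule aspan_least_closed, safe)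
    fix b assume "b \<in> mon (vs A)"
    then obtain c v \<pi> w \<beta> u where b: "u \<in> vs A" "path v \<pi> u" "path w \<beta> u" "b = sc c * (xp v \<pi> * yp w \<beta>)"
      by (rule monE)
    have "b = sc c * (xp v \<pi> * (p u * yp w \<beta>))" using b(4) p_yp[OF b(3)] by simp
    also have "\<dots> \<in> A"
      using ridealD(3,4)[OF assms] vsD(2)[OF b(1)] xp_in_R[OF b(2)] yp_in_R[OF b(3)] sc_ideal[OF assms] by blast
    finally show "b \<in> A" .
  qed
qed

text \<open>A left unit \<open>p u\<close> in \<open>A\<close> gives the factorization at once,
  since \<open>g * z\<close> lies in \<open>B\<close>. If instead \<open>p u\<close> lies in
  \<open>B\<close>, then \<open>p u * (g * z)\<close> is spanned by vertices of \<open>B\<close>,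
  and right units from \<open>B\<close> split off the second factor while the rest stays in
  \<open>A\<close>.\<close>

lemma Sp_inter_aprod:
  assumes A: "rideal A" and B: "rideal B" and z: "z \<in> Sp (vs A \<union> vs B)" "z \<in> A" "z \<in> B"
  shows "z \<in> aprod A B"
proof (rule left_units[OF rideal_aprod[OF A B] hered_Un[OF hered_vs[OF A] hered_vs[OF B]] z(1)])
  fix u g assume u: "u \<in> vs A \<union> vs B" and g: "g \<in> R"
  have gz: "g * z \<in> A" "g * z \<in> B" using z(2,3) g ridealD(4)[OF A] ridealD(4)[OF B] by blast+
  show "p u * (g * z) \<in> aprod A B"
  proof (cases "u \<in> vs A")
    case True
    then show ?thesis using gz vsD(2) by (blast intro: aprodI)
  next
    case False
    with u have u: "u \<in> vs B" by blast
    note p = p_in_R[OF vsD(1)[OF u]]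
    have z'A: "p u * (g * z) \<in> A" using gz ridealD(4)[OF A] p by blast
    have "p u * (g * z) \<in> Sp (vs B)"
      using Sp_mult(1)[OF hered_vs[OF B] p_R[OF u vsD(1)[OF u]]] ridealD(1)[OF B] gz by blast
    with rideal_aprod[OF A B] hered_vs[OF B] show ?thesis
    proof (rule right_units)
      fix u' g' assume "u' \<in> vs B" "g' \<in> R"
      then show "p u * (g * z) * g' * p u' \<in> aprod A B"
        using ridealD(3)[OF A z'A] vsD(2) by (blast intro: aprodI)
    qed
  qed
qed

text \<open>Left units suffice here: \<open>p u\<close> lies in \<open>A \<union> B\<close> and
  \<open>g * z\<close> in both ideals.\<close>

lemma Sp_inter_aprod_sum:
  assumes A: "rideal A" and B: "rideal B" and z: "z \<in> Sp (vs A \<union> vs B)" "z \<in> A" "z \<in> B"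
    and T: "rideal T" "\<And>a b. a \<in> A \<union> B \<Longrightarrow> b \<in> A \<inter> B \<Longrightarrow> a * b \<in> T"
  shows "z \<in> T"
proof (rule left_units[OF T(1) hered_Un[OF hered_vs[OF A] hered_vs[OF B]] z(1)])
  fix u g assume "u \<in> vs A \<union> vs B" "g \<in> R"
  then show "p u * (g * z) \<in> T"
    using z(2,3) ridealD(4)[OF A] ridealD(4)[OF B] vsD(2) by (intro T(2)) auto
qed

end

subsection \<open>Vertices on cycles without exit\<close>

lemma prefix_rep:
  assumes "i \<le> j" shows "prefix (rep i \<delta>) (rep j \<delta>)"
proof -
  from assms obtain k where "j = i + k" by (auto simp: le_iff_add)
  then show ?thesis by (simp add: replicate_add)
qed

lemma length_rep:
  assumes "\<delta> \<noteq> []" shows "j \<le> length (rep j \<delta>)"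
proof -
  from assms have "1 \<le> length \<delta>" by (simp add: Suc_le_eq)
  then show ?thesis by (induction j) simp_all
qed

definition periodic_prefix :: "'e list \<Rightarrow> 'e list \<Rightarrow> bool" where
  "periodic_prefix \<delta> \<tau> \<longleftrightarrow> (\<exists>j. prefix \<tau> (rep j \<delta>))"

lemma periodic_prefix_le:
  assumes "periodic_prefix \<delta> \<tau>" obtains j where "j \<ge> n" "prefix \<tau> (rep j \<delta>)"
proof -
  from assms obtain i where "prefix \<tau> (rep i \<delta>)" unfolding periodic_prefix_def by blast
  also have "prefix (rep i \<delta>) (concat (replicate (max i n) \<delta>))"
    by (rule prefix_rep) simp
  finally show ?thesis by (rule that[rotated]) simp
qed

text \<open>Iteration shows that \<open>\<tau>\<close> is a prefix of
  \<open>rep j \<delta> @ \<tau>\<close> for all \<open>j\<close>, and \<open>length \<tau>\<close>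
  copies of \<open>\<delta>\<close> are long enough to cover it. The contrapositive makes a closed
  path vanish under conjugation by \<open>\<tau>\<close>.\<close>

lemma periodic_prefixI:
  assumes "prefix \<tau> (\<delta> @ \<tau>)" "\<delta> \<noteq> []"
  shows "periodic_prefix \<delta> \<tau>"
proof -
  have *: "prefix \<tau> (rep j \<delta> @ \<tau>)" for j
  proof (induction j)
    case (Suc j)
    have "prefix (\<delta> @ \<tau>) (\<delta> @ rep j \<delta> @ \<tau>)" using Suc by simp
    from prefix_order.trans[OF assms(1) this] show ?case by simp
  qed simp
  have "prefix \<tau> (rep (length \<tau>) \<delta>)"
    by (rule prefix_length_prefix[OF *[of "length \<tau>"]]) (simp, rule length_rep[OF assms(2)])
  then show ?thesis unfolding periodic_prefix_def by blast
qed

lemma periodic_prefix_antimono: "prefix \<tau> \<tau>' \<Longrightarrow> periodic_prefix \<delta> \<tau>' \<Longrightarrow> periodic_prefix \<delta> \<tau>"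
  unfolding periodic_prefix_def by (blast intro: prefix_order.trans)

section \<open>Elements of an ideal that force a cycle without exit\<close>

context leavitt_family
begin

text \<open>Equal indices are collected and zero coefficients dropped. A guaranteed nonzero
  coefficient is what \<open>W_criterion\<close> needs when it is applied to a shortest
  path.\<close>

lemma finite_combination:
  assumes "z \<in> aspan {sc c * f \<mu> | c \<mu>. \<mu> \<in> P}"
  shows "\<exists>M k. finite M \<and> M \<subseteq> P \<and> (\<forall>\<mu>\<in>M. k \<mu> \<noteq> 0) \<and> z = (\<Sum>\<mu>\<in>M. sc (k \<mu>) * f \<mu>)"
  using assms
proof induction
  case zero
  then show ?case by (intro exI[of _ "{}"]) simp
next
  case (base a)
  then obtain c \<mu> where a: "a = sc c * f \<mu>" "\<mu> \<in> P" by blast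
  show ?case
  proof (cases "c = 0")
    case True
    with a show ?thesis by (intro exI[of _ "{}"]) (simp add: sc_0)
  next
    case False
    with a show ?thesis by (intro exI[of _ "{\<mu>}"] exI[of _ "\<lambda>_. c"]) simp
  qed
next
  case (add a b)
  then obtain M k N l where M: "finite M" "M \<subseteq> P" "a = (\<Sum>\<mu>\<in>M. sc (k \<mu>) * f \<mu>)"
    and N: "finite N" "N \<subseteq> P" "b = (\<Sum>\<mu>\<in>N. sc (l \<mu>) * f \<mu>)" by blast
  define K where "K \<mu> = (if \<mu> \<in> M then k \<mu> else 0) + (if \<mu> \<in> N then l \<mu> else 0)" for \<mu>
  have "a = (\<Sum>\<mu>\<in>M \<union> N. sc (if \<mu> \<in> M then k \<mu> else 0) * f \<mu>)"
    unfolding M(3) by (rule sum.mono_neutral_cong_left) (auto simp: M N sc_0)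
  moreover have "b = (\<Sum>\<mu>\<in>M \<union> N. sc (if \<mu> \<in> N then l \<mu> else 0) * f \<mu>)"
    unfolding N(3) by (rule sum.mono_neutral_cong_left) (auto simp: M N sc_0)
  ultimately have "a + b = (\<Sum>\<mu>\<in>M \<union> N. sc (K \<mu>) * f \<mu>)"
    by (simp add: K_def sc_add distrib_right sum.distrib)
  also have "\<dots> = (\<Sum>\<mu>\<in>{\<mu> \<in> M \<union> N. K \<mu> \<noteq> 0}. sc (K \<mu>) * f \<mu>)"
    by (rule sum.mono_neutral_right) (auto simp: M N sc_0)
  finally show ?case
    using M N by (intro exI[of _ "{\<mu> \<in> M \<union> N. K \<mu> \<noteq> 0}"] exI[of _ K]) auto
qed

text \<open>The vertices on cycles without exit in the graph obtained by deleting \<open>vs A\<close>.\<close>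

definition W :: "'r set \<Rightarrow> 'v set" where
  "W A = {w \<in> V. w \<notin> vs A \<and> (\<exists>c. c \<noteq> [] \<and> path w c w) \<and>
    (\<forall>\<pi> u. path w \<pi> u \<longrightarrow> u \<notin> vs A \<longrightarrow> (\<exists>!e. e \<in> D \<and> s e = u \<and> r e \<notin> vs A))}"

lemma not_hered: "hered H \<Longrightarrow> path u \<pi> q \<Longrightarrow> q \<notin> H \<Longrightarrow> u \<notin> H"
  unfolding hered_def by blast

text \<open>
  If some vertex reachable from \<open>w\<close> had no or several exits outside \<open>vs A\<close>, one could leave each of
  the finitely many closed paths in \<open>\<Delta>\<close> in turn.
\<close>

lemma avoiding_path:
  assumes A: "rideal A" and w: "w \<in> V" "w \<notin> vs A"
    and \<Delta>: "finite \<Delta>" "\<And>\<delta>. \<delta> \<in> \<Delta> \<Longrightarrow> path w \<delta> w \<and> \<delta> \<noteq> []"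
    and \<sigma>: "path w \<sigma> u" "u \<notin> vs A" "\<not> (\<exists>!e. e \<in> D \<and> s e = u \<and> r e \<notin> vs A)"
  shows "\<exists>\<tau> t. path w \<tau> t \<and> t \<notin> vs A \<and> (\<forall>\<delta>\<in>\<Delta>. \<not> periodic_prefix \<delta> \<tau>)"
proof -
  \<comment> \<open>After any number of turns around \<open>\<delta>\<close> some detour
    \<open>\<rho>\<close> leaves the periodic continuation and ends outside
    \<open>vs A\<close>.\<close>
  have ext: "\<exists>\<rho> t. path w \<rho> t \<and> t \<notin> vs A \<and> \<not> periodic_prefix \<delta> (rep m \<delta> @ \<rho>)"
    if d: "\<delta> \<in> \<Delta>" for \<delta> m
  proof (cases "\<exists>e. e \<in> D \<and> s e = u \<and> r e \<notin> vs A")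
    case False
    \<comment> \<open>All edges at \<open>u\<close> lead into the hereditary set
      \<open>vs A\<close>, so no nonempty path from \<open>u\<close> returns to \<open>w\<close>, as
      a power of \<open>\<delta>\<close> passing through \<open>u\<close> would have to.\<close>
    have "\<not> periodic_prefix \<delta> (rep m \<delta> @ \<sigma>)"
    proof
      let ?\<tau> = "rep m \<delta> @ \<sigma>"
      assume "periodic_prefix \<delta> ?\<tau>"
      \<comment> \<open>The power is strictly longer than \<open>?\<tau>\<close>, so that it
        contains a next edge at \<open>u\<close>.\<close>
      then obtain j where j: "Suc (length ?\<tau>) \<le> j" "prefix ?\<tau> (rep j \<delta>)"
        by (rule periodic_prefix_le)
      from j(2) obtain \<zeta> where z: "rep j \<delta> = ?\<tau> @ \<zeta>" unfolding prefix_def by blast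
      have "Suc (length ?\<tau>) \<le> length (rep j \<delta>)"
        using j(1) length_rep[of \<delta> j] \<Delta>(2)[OF d] by linarith
      with z have "\<zeta> \<noteq> []" by auto
      then obtain e \<zeta>' where e: "\<zeta> = e # \<zeta>'" by (cases \<zeta>) auto
      have pd: "path w \<delta> w" using \<Delta>(2)[OF d] by blast
      have "path w ?\<tau> u" using path_appendI[OF path_replicate[OF pd] \<sigma>(1)] .
      with path_replicate[OF pd, of j] z have "path u \<zeta> w" by (simp only: path_append_iff)
      then have "e \<in> D" "s e = u" "path (r e) \<zeta>' w" by (simp_all add: e)
      with not_hered[OF hered_vs[OF A] this(3) w(2)] False show False by blast
    qed
    with \<sigma> show ?thesis by blast
  next
    case True
    then obtain e where e: "e \<in> D" "s e = u" "r e \<notin> vs A" by blast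
    with \<sigma>(3) obtain f where f: "f \<in> D" "s f = u" "r f \<notin> vs A" "f \<noteq> e" by blast
    have pe: "path w (\<sigma> @ [e]) (r e)" "path w (\<sigma> @ [f]) (r f)"
      using path_appendI[OF \<sigma>(1)] e f r_V by simp_all
    \<comment> \<open>Two different edges cannot both be the next letter of the same periodic
      word.\<close>
    have "\<not> (periodic_prefix \<delta> (rep m \<delta> @ \<sigma> @ [e]) \<and> periodic_prefix \<delta> (rep m \<delta> @ \<sigma> @ [f]))"
    proof safe
      let ?\<tau> = "\<lambda>e. rep m \<delta> @ \<sigma> @ [e]"
      assume a: "periodic_prefix \<delta> (?\<tau> e)" "periodic_prefix \<delta> (?\<tau> f)"
      obtain i where i: "prefix (?\<tau> e) (rep i \<delta>)" using a(1) unfolding periodic_prefix_def by blast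
      obtain j where j: "i \<le> j" "prefix (?\<tau> f) (rep j \<delta>)" using a(2) by (rule periodic_prefix_le)
      have "prefix (?\<tau> e) (rep j \<delta>)"
        using i prefix_rep[OF j(1)] by (rule prefix_order.trans)
      then have "prefix (?\<tau> e) (?\<tau> f)" using j(2) by (rule prefix_length_prefix) simp
      with f(4) show False by simp
    qed
    with pe e(3) f(3) show ?thesis by blast
  qed
  have "\<exists>\<tau>' t. path w \<tau>' t \<and> t \<notin> vs A \<and> (\<forall>\<delta>\<in>\<Delta>. \<not> periodic_prefix \<delta> \<tau>')"
    if "path w \<tau> t" "t \<notin> vs A" for \<tau> t
    using that
  \<comment> \<open>Each round extends \<open>\<tau>\<close>, which preserves what is already
    avoided, and avoids at least one more \<open>\<delta>\<close>.\<close>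
  proof (induction "card {\<delta> \<in> \<Delta>. periodic_prefix \<delta> \<tau>}" arbitrary: \<tau> t rule: less_induct)
    case less
    show ?case
    proof (cases "\<exists>\<delta>\<in>\<Delta>. periodic_prefix \<delta> \<tau>")
      case True
      then obtain \<delta> m where d: "\<delta> \<in> \<Delta>" "periodic_prefix \<delta> \<tau>" and m: "prefix \<tau> (rep m \<delta>)"
        unfolding periodic_prefix_def by blast
      from ext[OF d(1)] obtain \<rho> t' where \<rho>: "path w \<rho> t'" "t' \<notin> vs A"
        "\<not> periodic_prefix \<delta> (rep m \<delta> @ \<rho>)" by blast
      let ?\<tau> = "rep m \<delta> @ \<rho>"
      have "path w ?\<tau> t'" using path_appendI[OF path_replicate \<rho>(1)] \<Delta>(2)[OF d(1)] by blast
      moreover have "prefix \<tau> ?\<tau>" using m by simp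
      then have "{\<delta> \<in> \<Delta>. periodic_prefix \<delta> ?\<tau>} \<subset> {\<delta> \<in> \<Delta>. periodic_prefix \<delta> \<tau>}"
        using d \<rho>(3) periodic_prefix_antimono by blast
      then have "card {\<delta> \<in> \<Delta>. periodic_prefix \<delta> ?\<tau>} < card {\<delta> \<in> \<Delta>. periodic_prefix \<delta> \<tau>}"
        using \<Delta>(1) by (intro psubset_card_mono) auto
      ultimately show ?thesis using less.hyps \<rho>(2) by blast
    qed (use less.prems in blast)
  qed
  from this[OF \<sigma>(1,2)] show ?thesis .
qed

definition closed_mon :: "'v \<Rightarrow> 'r set" where
  "closed_mon w = {sc c * xp w \<delta> | c \<delta>. \<delta> \<in> {\<delta>. path w \<delta> w \<and> \<delta> \<noteq> []}} \<union>
    {sc c * yp w \<epsilon> | c \<epsilon>. \<epsilon> \<in> {\<epsilon>. path w \<epsilon> w \<and> \<epsilon> \<noteq> []}}"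

lemma closed_monI:
  "path w \<delta> w \<Longrightarrow> \<delta> \<noteq> [] \<Longrightarrow> sc c * xp w \<delta> \<in> closed_mon w"
  "path w \<delta> w \<Longrightarrow> \<delta> \<noteq> [] \<Longrightarrow> sc c * yp w \<delta> \<in> closed_mon w"
  unfolding closed_mon_def by blast+

lemma W_criterion:
  assumes A: "rideal A" and z: "z \<in> A" and k: "k \<noteq> 0" and w: "w \<in> V" "w \<notin> vs A"
    and closed_mon: "z - sc k * p w \<in> aspan (closed_mon w)"
  shows "w \<in> W A"
proof -
  let ?P = "{\<delta>. path w \<delta> w \<and> \<delta> \<noteq> []}"
  obtain b c where b: "b \<in> aspan {sc c * xp w \<delta> | c \<delta>. \<delta> \<in> ?P}"
    and c: "c \<in> aspan {sc c * yp w \<delta> | c \<delta>. \<delta> \<in> ?P}" and bc: "z - sc k * p w = b + c"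
    using closed_mon unfolding closed_mon_def by (rule aspan_Un)
  from finite_combination[OF b] obtain M k1 where M: "finite M" "M \<subseteq> ?P" "b = (\<Sum>\<delta>\<in>M. sc (k1 \<delta>) * xp w \<delta>)"
    by blast
  from finite_combination[OF c] obtain N k2 where N: "finite N" "N \<subseteq> ?P" "c = (\<Sum>\<delta>\<in>N. sc (k2 \<delta>) * yp w \<delta>)"
    by blast
  \<comment> \<open>Conjugation by \<open>\<tau>\<close> kills every closed path and ghost in the
    combination: it survives only if \<open>\<tau>\<close> is comparable with
    \<open>\<delta> @ \<tau>\<close>, and that would make \<open>\<tau>\<close> periodic. The scalar
    term alone remains.\<close>
  have avoid: "u \<in> vs A" if \<tau>: "path w \<tau> u" "\<forall>\<delta>\<in>M \<union> N. \<not> periodic_prefix \<delta> \<tau>" for \<tau> u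
  proof -
    have no: "\<not> prefix \<tau> (\<delta> @ \<tau>)" "\<not> prefix (\<delta> @ \<tau>) \<tau>" if "\<delta> \<in> M \<union> N" for \<delta>
    proof -
      have "\<delta> \<noteq> []" "\<not> periodic_prefix \<delta> \<tau>" using \<tau>(2) that M(2) N(2) by blast+
      then show "\<not> prefix \<tau> (\<delta> @ \<tau>)" "\<not> prefix (\<delta> @ \<tau>) \<tau>"
        using periodic_prefixI prefix_length_le[of "\<delta> @ \<tau>" \<tau>] by auto
    qed
    have 1: "yp w \<tau> * (sc a * xp w \<delta>) * xp w \<tau> = 0" if "\<delta> \<in> M" for \<delta> a
    proof -
      have d: "path w \<delta> w" using that M(2) by blast
      have "yp w \<tau> * (sc a * xp w \<delta>) * xp w \<tau> = sc a * (yp w \<tau> * xp w (\<delta> @ \<tau>))"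
        by (simp only: xp_append[OF d \<tau>(1)] mult.assoc[symmetric] sc_yp[OF \<tau>(1)])
      then show ?thesis using yp_xp[OF \<tau>(1) path_appendI[OF d \<tau>(1)]] no that by simp
    qed
    have 2: "yp w \<tau> * (sc a * yp w \<delta>) * xp w \<tau> = 0" if "\<delta> \<in> N" for \<delta> a
    proof -
      have d: "path w \<delta> w" using that N(2) by blast
      have "yp w \<tau> * (sc a * yp w \<delta>) * xp w \<tau> = sc a * (yp w (\<delta> @ \<tau>) * xp w \<tau>)"
        by (simp only: yp_append[OF d \<tau>(1)] mult.assoc[symmetric] sc_yp[OF \<tau>(1)])
      then show ?thesis using yp_xp[OF path_appendI[OF d \<tau>(1)] \<tau>(1)] no that by simp
    qed
    have 3: "yp w \<tau> * (sc k * p w) * xp w \<tau> = sc k * p u"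
    proof -
      have "yp w \<tau> * (sc k * p w) * xp w \<tau> = sc k * (yp w \<tau> * (p w * xp w \<tau>))"
        by (simp only: mult.assoc[symmetric] sc_yp[OF \<tau>(1)])
      then show ?thesis by (simp only: p_xp[OF \<tau>(1)] yp_xp_same[OF \<tau>(1)])
    qed
    have "z = sc k * p w + b + c" using bc by (simp add: algebra_simps)
    then have "yp w \<tau> * z * xp w \<tau> = sc k * p u"
      by (simp add: M(3) N(3) distrib_left distrib_right sum_distrib_left sum_distrib_right 1 2 3)
    then have "sc k * p u \<in> A"
      using ridealD(3,4)[OF A] z xp_in_R[OF \<tau>(1)] yp_in_R[OF \<tau>(1)] by metis
    then have "sc (1 / k) * (sc k * p u) \<in> A" by (rule sc_ideal[OF A])
    then have "p u \<in> A"
      using k sc_1[OF path_V(2)[OF \<tau>(1)]] by (simp flip: mult.assoc sc_mult)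
    with path_V(2)[OF \<tau>(1)] show ?thesis by (simp add: vs_def)
  qed
  \<comment> \<open>Without any closed path the empty \<open>\<tau>\<close> would avoid everything
    and put \<open>w\<close> into \<open>vs A\<close>.\<close>
  have "M \<union> N \<noteq> {}" using avoid[of "[]" w] w by auto
  then have 1: "\<exists>c. c \<noteq> [] \<and> path w c w" using M(2) N(2) by blast
  have 2: "\<exists>!e. e \<in> D \<and> s e = u \<and> r e \<notin> vs A" if "path w \<pi> u" "u \<notin> vs A" for \<pi> u
  proof (rule ccontr)
    assume "\<not> ?thesis"
    with avoiding_path[OF A w, of "M \<union> N"] M(1,2) N(1,2) that avoid show False by blast
  qed
  from w 1 2 show ?thesis unfolding W_def by blast
qed

section \<open>Decomposing an ideal into a vertex part and corners\<close>

definition cornered :: "'r set \<Rightarrow> 'r set" where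
  "cornered A = {a * b * c | a b c w. a \<in> R \<and> c \<in> R \<and> b \<in> A \<and> w \<in> W A \<and> p w * b = b \<and> b * p w = b}"

lemma corneredI:
  "a \<in> R \<Longrightarrow> c \<in> R \<Longrightarrow> b \<in> A \<Longrightarrow> w \<in> W A \<Longrightarrow> p w * b = b \<Longrightarrow> b * p w = b \<Longrightarrow> a * b * c \<in> cornered A"
  unfolding cornered_def by blast

lemma W_D: "w \<in> W A \<Longrightarrow> w \<in> V" "w \<in> W A \<Longrightarrow> w \<notin> vs A"
  by (auto simp: W_def)

lemma corneredI_left:
  assumes A: "rideal A" and "a \<in> R" "b \<in> A" "w \<in> W A" "p w * b = b" "b * p w = b"
  shows "a * b \<in> cornered A"
  using corneredI[OF assms(2) p_in_R[OF W_D(1)[OF assms(4)]] assms(3-6)] assms(6) by (simp add: mult.assoc)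

lemma corneredI_right:
  assumes A: "rideal A" and "c \<in> R" "b \<in> A" "w \<in> W A" "p w * b = b" "b * p w = b"
  shows "b * c \<in> cornered A"
  using corneredI[OF p_in_R[OF W_D(1)[OF assms(4)]] assms(2-6)] assms(5) by simp

text \<open>No path in \<open>M\<close> is a proper prefix of the shortest one, so the ghost of
  \<open>\<mu>0\<close> leaves no ghosts: it yields the coefficient of \<open>\<mu>0\<close> plus
  closed paths. The second equation removes precisely the paths that extend
  \<open>\<mu>0\<close>.\<close>

lemma xp_comb_mult:
  assumes "finite M" "\<And>\<mu>. \<mu> \<in> M \<Longrightarrow> path v \<mu> w" "\<mu>0 \<in> M" "\<And>\<mu>. \<mu> \<in> M \<Longrightarrow> length \<mu>0 \<le> length \<mu>"
  shows "yp v \<mu>0 * (\<Sum>\<mu>\<in>M. sc (k \<mu>) * xp v \<mu>) - sc (k \<mu>0) * p w \<in> aspan (closed_mon w)" (is ?A)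
    and "(\<Sum>\<mu>\<in>M. sc (k \<mu>) * xp v \<mu>) - xp v \<mu>0 * (yp v \<mu>0 * (\<Sum>\<mu>\<in>M. sc (k \<mu>) * xp v \<mu>))
      = (\<Sum>\<mu>\<in>{\<mu> \<in> M. \<not> prefix \<mu>0 \<mu>}. sc (k \<mu>) * xp v \<mu>)" (is ?B)
proof -
  note m0 = assms(2)[OF assms(3)]
  have eq: "yp v \<mu>0 * (sc c * xp v \<mu>) = sc c * (if prefix \<mu>0 \<mu> then xp w (drop (length \<mu>0) \<mu>) else 0)"
    if m: "\<mu> \<in> M" for c \<mu>
  proof -
    have "yp v \<mu>0 * (sc c * xp v \<mu>) = sc c * (yp v \<mu>0 * xp v \<mu>)"
      by (simp only: sc_yp[OF m0] mult.assoc[symmetric])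
    moreover have "prefix \<mu> \<mu>0 \<Longrightarrow> \<mu> = \<mu>0"
      using assms(4)[OF m] by (auto simp: prefix_def)
    ultimately show ?thesis using yp_xp[OF m0 assms(2)[OF m]] by auto
  qed
  have "yp v \<mu>0 * (\<Sum>\<mu>\<in>M. sc (k \<mu>) * xp v \<mu>) - sc (k \<mu>0) * p w
      = (\<Sum>\<mu>\<in>M - {\<mu>0}. yp v \<mu>0 * (sc (k \<mu>) * xp v \<mu>))"
    unfolding sum.remove[OF assms(1,3)] by (simp add: distrib_left sum_distrib_left eq[OF assms(3)])
  also have "\<dots> \<in> aspan (closed_mon w)"
  proof (rule aspan_sum)
    fix \<mu> assume m: "\<mu> \<in> M - {\<mu>0}"
    show "yp v \<mu>0 * (sc (k \<mu>) * xp v \<mu>) \<in> aspan (closed_mon w)"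
    proof (cases "prefix \<mu>0 \<mu>")
      case True
      then obtain \<zeta> where z: "\<mu> = \<mu>0 @ \<zeta>" unfolding prefix_def by blast
      with m assms(2)[of \<mu>] have "path w \<zeta> w" "\<zeta> \<noteq> []" by (auto simp: path_append_iff[OF m0])
      then show ?thesis using m z by (simp add: eq aspan.base closed_monI)
    qed (use m in \<open>simp add: eq aspan.zero\<close>)
  qed
  finally show ?A .
  have "xp v \<mu>0 * (yp v \<mu>0 * (sc c * xp v \<mu>)) = (if prefix \<mu>0 \<mu> then sc c * xp v \<mu> else 0)"
    if m: "\<mu> \<in> M" for \<mu> c
  proof (cases "prefix \<mu>0 \<mu>")
    case True
    then obtain \<zeta> where z: "\<mu> = \<mu>0 @ \<zeta>" unfolding prefix_def by blast
    with m assms(2)[of \<mu>] have "path w \<zeta> w" by (auto simp: path_append_iff[OF m0])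
    then have "xp v \<mu> = xp v \<mu>0 * xp w \<zeta>" using xp_append[OF m0] z by simp
    moreover have "xp v \<mu>0 * (sc c * xp w \<zeta>) = sc c * (xp v \<mu>0 * xp w \<zeta>)"
      by (simp only: sc_xp[OF m0] mult.assoc[symmetric])
    moreover have "drop (length \<mu>0) \<mu> = \<zeta>" using z by simp
    ultimately show ?thesis unfolding eq[OF m] using True by simp
  qed (use m in \<open>simp add: eq\<close>)
  then have "(\<Sum>\<mu>\<in>M. sc (k \<mu>) * xp v \<mu>) - xp v \<mu>0 * (yp v \<mu>0 * (\<Sum>\<mu>\<in>M. sc (k \<mu>) * xp v \<mu>))
      = (\<Sum>\<mu>\<in>M. sc (k \<mu>) * xp v \<mu> - (if prefix \<mu>0 \<mu> then sc (k \<mu>) * xp v \<mu> else 0))"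
    by (simp add: sum_distrib_left sum_subtractf)
  also have "\<dots> = (\<Sum>\<mu>\<in>{\<mu> \<in> M. \<not> prefix \<mu>0 \<mu>}. sc (k \<mu>) * xp v \<mu>)"
    by (rule sum.mono_neutral_cong_right) (auto simp: assms(1))
  finally show ?B .
qed

lemma yp_comb_mult:
  assumes "finite M" "\<And>\<mu>. \<mu> \<in> M \<Longrightarrow> path w \<mu> v" "\<mu>0 \<in> M" "\<And>\<mu>. \<mu> \<in> M \<Longrightarrow> length \<mu>0 \<le> length \<mu>"
  shows "(\<Sum>\<mu>\<in>M. sc (k \<mu>) * yp w \<mu>) * xp w \<mu>0 - sc (k \<mu>0) * p v \<in> aspan (closed_mon v)" (is ?A)
    and "(\<Sum>\<mu>\<in>M. sc (k \<mu>) * yp w \<mu>) - (\<Sum>\<mu>\<in>M. sc (k \<mu>) * yp w \<mu>) * xp w \<mu>0 * yp w \<mu>0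
      = (\<Sum>\<mu>\<in>{\<mu> \<in> M. \<not> prefix \<mu>0 \<mu>}. sc (k \<mu>) * yp w \<mu>)" (is ?B)
proof -
  note m0 = assms(2)[OF assms(3)]
  have eq: "sc c * yp w \<mu> * xp w \<mu>0 = sc c * (if prefix \<mu>0 \<mu> then yp v (drop (length \<mu>0) \<mu>) else 0)"
    if m: "\<mu> \<in> M" for c \<mu>
  proof -
    have "prefix \<mu> \<mu>0 \<Longrightarrow> \<mu> = \<mu>0"
      using assms(4)[OF m] by (auto simp: prefix_def)
    then show ?thesis using yp_xp[OF assms(2)[OF m] m0] by (auto simp: mult.assoc)
  qed
  have "(\<Sum>\<mu>\<in>M. sc (k \<mu>) * yp w \<mu>) * xp w \<mu>0 - sc (k \<mu>0) * p v
      = (\<Sum>\<mu>\<in>M - {\<mu>0}. sc (k \<mu>) * yp w \<mu> * xp w \<mu>0)"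
    unfolding sum.remove[OF assms(1,3)] by (simp add: distrib_right sum_distrib_right eq[OF assms(3)])
  also have "\<dots> \<in> aspan (closed_mon v)"
  proof (rule aspan_sum)
    fix \<mu> assume m: "\<mu> \<in> M - {\<mu>0}"
    show "sc (k \<mu>) * yp w \<mu> * xp w \<mu>0 \<in> aspan (closed_mon v)"
    proof (cases "prefix \<mu>0 \<mu>")
      case True
      then obtain \<zeta> where z: "\<mu> = \<mu>0 @ \<zeta>" unfolding prefix_def by blast
      with m assms(2)[of \<mu>] have "path v \<zeta> v" "\<zeta> \<noteq> []" by (auto simp: path_append_iff[OF m0])
      then show ?thesis using m z by (simp add: eq aspan.base closed_monI)
    qed (use m in \<open>simp add: eq aspan.zero\<close>)
  qed
  finally show ?A .
  have "sc c * yp w \<mu> * xp w \<mu>0 * yp w \<mu>0 = (if prefix \<mu>0 \<mu> then sc c * yp w \<mu> else 0)"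
    if m: "\<mu> \<in> M" for \<mu> c
  proof (cases "prefix \<mu>0 \<mu>")
    case True
    then obtain \<zeta> where z: "\<mu> = \<mu>0 @ \<zeta>" unfolding prefix_def by blast
    with m assms(2)[of \<mu>] have "path v \<zeta> v" by (auto simp: path_append_iff[OF m0])
    then have "yp w \<mu> = yp v \<zeta> * yp w \<mu>0" using yp_append[OF m0] z by simp
    moreover have "drop (length \<mu>0) \<mu> = \<zeta>" using z by simp
    ultimately show ?thesis unfolding eq[OF m] using True by (simp add: mult.assoc)
  qed (use m in \<open>simp add: eq\<close>)
  then have "(\<Sum>\<mu>\<in>M. sc (k \<mu>) * yp w \<mu>) - (\<Sum>\<mu>\<in>M. sc (k \<mu>) * yp w \<mu>) * xp w \<mu>0 * yp w \<mu>0
      = (\<Sum>\<mu>\<in>M. sc (k \<mu>) * yp w \<mu> - (if prefix \<mu>0 \<mu> then sc (k \<mu>) * yp w \<mu> else 0))"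
    by (simp add: sum_distrib_right sum_subtractf)
  also have "\<dots> = (\<Sum>\<mu>\<in>{\<mu> \<in> M. \<not> prefix \<mu>0 \<mu>}. sc (k \<mu>) * yp w \<mu>)"
    by (rule sum.mono_neutral_cong_right) (auto simp: assms(1))
  finally show ?B .
qed

text \<open>The trivial path is counted among the real paths and excluded from the ghosts, so that
  the scalar term occurs only once.\<close>

definition path_mon :: "'v \<Rightarrow> 'v \<Rightarrow> 'r set" where
  "path_mon v w = {sc c * xp v \<mu> | c \<mu>. \<mu> \<in> {\<mu>. path v \<mu> w}} \<union>
    {sc c * yp w \<nu> | c \<nu>. \<nu> \<in> {\<nu>. path w \<nu> v \<and> \<nu> \<noteq> []}}"

lemma shortest_path:
  assumes "M \<noteq> {}" obtains \<mu>0 where "\<mu>0 \<in> M" "\<And>\<mu>. \<mu> \<in> M \<Longrightarrow> length \<mu>0 \<le> length (\<mu> :: 'e list)"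
  using assms ex_has_least_nat[of "\<lambda>\<mu>. \<mu> \<in> M" _ length] by blast

text \<open>The part of the sum extending a shortest path \<open>\<mu>0\<close> factors through the
  corner at \<open>w\<close>, where the nonzero coefficient of \<open>\<mu>0\<close> triggers
  \<open>W_criterion\<close>. The rest is again in \<open>A\<close> and has fewer terms.\<close>

lemma xp_comb_cornered:
  assumes A: "rideal A" and w: "w \<in> V" "w \<notin> vs A"
  shows "finite M \<Longrightarrow> (\<And>\<mu>. \<mu> \<in> M \<Longrightarrow> path v \<mu> w \<and> k \<mu> \<noteq> 0) \<Longrightarrow> (\<Sum>\<mu>\<in>M. sc (k \<mu>) * xp v \<mu>) \<in> A \<Longrightarrow>
    (\<Sum>\<mu>\<in>M. sc (k \<mu>) * xp v \<mu>) \<in> aspan (cornered A)"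
proof (induction "card M" arbitrary: M rule: less_induct)
  case less
  let ?z = "\<Sum>\<mu>\<in>M. sc (k \<mu>) * xp v \<mu>"
  show ?case
  proof (cases "M = {}")
    case False
    then obtain \<mu>0 where \<mu>0: "\<mu>0 \<in> M" "\<And>\<mu>. \<mu> \<in> M \<Longrightarrow> length \<mu>0 \<le> length \<mu>" by (rule shortest_path) blast
    let ?M = "{\<mu> \<in> M. \<not> prefix \<mu>0 \<mu>}" and ?g = "yp v \<mu>0 * ?z"
    have pm: "path v \<mu> w" if "\<mu> \<in> M" for \<mu> using less.prems(2) that by blast
    note m0 = pm[OF \<mu>0(1)]
    have g: "?g \<in> A" using ridealD(4)[OF A less.prems(3) yp_in_R[OF m0]] .
    have W: "w \<in> W A"
      using W_criterion[OF A g _ w xp_comb_mult(1)[OF less.prems(1) pm \<mu>0]] less.prems(2)[OF \<mu>0(1)] by blast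
    have "sc c * xp v \<mu> * p w = sc c * xp v \<mu>" if "\<mu> \<in> M" for c \<mu>
      using xp_p[OF pm[OF that]] by (simp add: mult.assoc)
    then have "?g * p w = ?g" by (simp add: mult.assoc sum_distrib_right)
    moreover have "p w * ?g = ?g" using p_yp[OF m0] by (simp flip: mult.assoc)
    ultimately have 1: "xp v \<mu>0 * ?g \<in> cornered A" using corneredI_left[OF A xp_in_R[OF m0] g W] by blast
    have 2: "?z - xp v \<mu>0 * ?g = (\<Sum>\<mu>\<in>?M. sc (k \<mu>) * xp v \<mu>)"
      by (rule xp_comb_mult(2)[OF less.prems(1) pm \<mu>0])
    have 3: "?z - xp v \<mu>0 * ?g \<in> A"
      using add_closedD(2)[OF ridealD(2)[OF A] less.prems(3)] ridealD(4)[OF A g xp_in_R[OF m0]] by blast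
    have "card ?M < card M" using less.prems(1) \<mu>0(1) by (intro psubset_card_mono) auto
    from less.hyps[OF this] less.prems(1,2) 3 2 have "?z - xp v \<mu>0 * ?g \<in> aspan (cornered A)" by simp
    then have "(?z - xp v \<mu>0 * ?g) + xp v \<mu>0 * ?g \<in> aspan (cornered A)"
      by (rule aspan.add) (rule aspan.base[OF 1])
    then show ?thesis by simp
  qed (simp add: aspan.zero)
qed

lemma yp_comb_cornered:
  assumes A: "rideal A" and v: "v \<in> V" "v \<notin> vs A"
  shows "finite M \<Longrightarrow> (\<And>\<mu>. \<mu> \<in> M \<Longrightarrow> path w \<mu> v \<and> k \<mu> \<noteq> 0) \<Longrightarrow> (\<Sum>\<mu>\<in>M. sc (k \<mu>) * yp w \<mu>) \<in> A \<Longrightarrow>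
    (\<Sum>\<mu>\<in>M. sc (k \<mu>) * yp w \<mu>) \<in> aspan (cornered A)"
proof (induction "card M" arbitrary: M rule: less_induct)
  case less
  let ?z = "\<Sum>\<mu>\<in>M. sc (k \<mu>) * yp w \<mu>"
  show ?case
  proof (cases "M = {}")
    case False
    then obtain \<mu>0 where \<mu>0: "\<mu>0 \<in> M" "\<And>\<mu>. \<mu> \<in> M \<Longrightarrow> length \<mu>0 \<le> length \<mu>" by (rule shortest_path) blast
    let ?M = "{\<mu> \<in> M. \<not> prefix \<mu>0 \<mu>}" and ?g = "?z * xp w \<mu>0"
    have pm: "path w \<mu> v" if "\<mu> \<in> M" for \<mu> using less.prems(2) that by blast
    note m0 = pm[OF \<mu>0(1)]
    have g: "?g \<in> A" using ridealD(3)[OF A less.prems(3) xp_in_R[OF m0]] .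
    have W: "v \<in> W A"
      using W_criterion[OF A g _ v yp_comb_mult(1)[OF less.prems(1) pm \<mu>0]] less.prems(2)[OF \<mu>0(1)] by blast
    have "p v * (sc c * yp w \<mu>) = sc c * yp w \<mu>" if "\<mu> \<in> M" for c \<mu>
    proof -
      have "p v * (sc c * yp w \<mu>) = sc c * (p v * yp w \<mu>)"
        by (simp only: mult.assoc[symmetric] sc_p[OF v(1)])
      then show ?thesis by (simp only: p_yp[OF pm[OF that]])
    qed
    then have "p v * ?z = ?z" by (simp add: sum_distrib_left)
    then have "p v * ?g = ?g" by (simp flip: mult.assoc)
    moreover have "?g * p v = ?g" using xp_p[OF m0] by (simp add: mult.assoc)
    ultimately have 1: "?g * yp w \<mu>0 \<in> cornered A" using corneredI_right[OF A yp_in_R[OF m0] g W] by blast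
    have 2: "?z - ?g * yp w \<mu>0 = (\<Sum>\<mu>\<in>?M. sc (k \<mu>) * yp w \<mu>)"
      by (rule yp_comb_mult(2)[OF less.prems(1) pm \<mu>0])
    have 3: "?z - ?g * yp w \<mu>0 \<in> A"
      using add_closedD(2)[OF ridealD(2)[OF A] less.prems(3)] ridealD(3)[OF A g yp_in_R[OF m0]] by blast
    have "card ?M < card M" using less.prems(1) \<mu>0(1) by (intro psubset_card_mono) auto
    from less.hyps[OF this] less.prems(1,2) 3 2 have "?z - ?g * yp w \<mu>0 \<in> aspan (cornered A)" by simp
    then have "(?z - ?g * yp w \<mu>0) + ?g * yp w \<mu>0 \<in> aspan (cornered A)"
      by (rule aspan.add) (rule aspan.base[OF 1])
    then show ?thesis by simp
  qed (simp add: aspan.zero)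
qed

lemma path_mon_cornered:
  assumes A: "rideal A" and z: "z \<in> A" "z \<in> aspan (path_mon v w)" and vw: "v \<in> V" "w \<in> V"
  shows "z \<in> aspan (Sp (vs A) \<union> cornered A)"
proof -
  obtain b c where b: "b \<in> aspan {sc c * xp v \<mu> | c \<mu>. \<mu> \<in> {\<mu>. path v \<mu> w}}"
    and c: "c \<in> aspan {sc c * yp w \<nu> | c \<nu>. \<nu> \<in> {\<nu>. path w \<nu> v \<and> \<nu> \<noteq> []}}" and bc: "z = b + c"
    using z(2) unfolding path_mon_def by (rule aspan_Un)
  from finite_combination[OF b] obtain M k where M: "finite M" "M \<subseteq> {\<mu>. path v \<mu> w}"
    "\<forall>\<mu>\<in>M. k \<mu> \<noteq> 0" "b = (\<Sum>\<mu>\<in>M. sc (k \<mu>) * xp v \<mu>)" by blast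
  from finite_combination[OF c] obtain N l where N: "finite N" "N \<subseteq> {\<nu>. path w \<nu> v \<and> \<nu> \<noteq> []}"
    "\<forall>\<mu>\<in>N. l \<mu> \<noteq> 0" "c = (\<Sum>\<mu>\<in>N. sc (l \<mu>) * yp w \<mu>)" by blast
  have pb: "p v * b = b" "b * p w = b"
  proof -
    have "p v * (sc c * xp v \<mu>) = sc c * xp v \<mu>" "sc c * xp v \<mu> * p w = sc c * xp v \<mu>" if "\<mu> \<in> M" for \<mu> c
    proof -
      have m: "path v \<mu> w" using that M(2) by blast
      have "p v * (sc c * xp v \<mu>) = sc c * (p v * xp v \<mu>)"
        by (simp only: mult.assoc[symmetric] sc_p[OF vw(1)])
      then show "p v * (sc c * xp v \<mu>) = sc c * xp v \<mu>" by (simp only: p_xp[OF m])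
      show "sc c * xp v \<mu> * p w = sc c * xp v \<mu>" by (simp only: mult.assoc xp_p[OF m])
    qed
    then show "p v * b = b" "b * p w = b" by (simp_all add: M(4) sum_distrib_left sum_distrib_right)
  qed
  have pc: "p v * c = c" "c * p w = c"
  proof -
    have "p v * (sc c * yp w \<mu>) = sc c * yp w \<mu>" "sc c * yp w \<mu> * p w = sc c * yp w \<mu>" if "\<mu> \<in> N" for \<mu> c
    proof -
      have m: "path w \<mu> v" using that N(2) by blast
      have "p v * (sc c * yp w \<mu>) = sc c * (p v * yp w \<mu>)"
        by (simp only: mult.assoc[symmetric] sc_p[OF vw(1)])
      then show "p v * (sc c * yp w \<mu>) = sc c * yp w \<mu>" by (simp only: p_yp[OF m])
      show "sc c * yp w \<mu> * p w = sc c * yp w \<mu>" by (simp only: mult.assoc yp_p[OF m])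
    qed
    then show "p v * c = c" "c * p w = c" by (simp_all add: N(4) sum_distrib_left sum_distrib_right)
  qed
  have pz: "p v * z = z" "z * p w = z" by (simp_all add: bc pb pc distrib_left distrib_right)
  note SpA = Sp_mult[OF hered_vs[OF A] p_R ridealD(1)[OF A z(1)]]
  have in_G: "aspan (cornered A) \<subseteq> aspan (Sp (vs A) \<union> cornered A)" by (rule aspan_mono) simp
  consider "v \<in> vs A" | "w \<in> vs A" | "v \<notin> vs A" "w \<notin> vs A" by blast
  then show ?thesis
  proof cases
    case 1
    then have "z \<in> Sp (vs A)" using SpA(1)[of v] vw pz by simp
    then show ?thesis by (simp add: aspan.base)
  next
    case 2
    then have "z \<in> Sp (vs A)" using SpA(2)[of w] vw pz by simp
    then show ?thesis by (simp add: aspan.base)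
  next
    case vwH: 3
    show ?thesis
    proof (cases "M = {}")
      case True
      then have "z = (\<Sum>\<mu>\<in>N. sc (l \<mu>) * yp w \<mu>)" using bc M(4) N(4) by simp
      moreover from this have "(\<Sum>\<mu>\<in>N. sc (l \<mu>) * yp w \<mu>) \<in> aspan (cornered A)"
        using z(1) N by (intro yp_comb_cornered[OF A vw(1) vwH(1)]) auto
      ultimately show ?thesis using in_G by auto
    next
      case False
      show ?thesis
      proof (cases "N = {}")
        case True
        then have "z = (\<Sum>\<mu>\<in>M. sc (k \<mu>) * xp v \<mu>)" using bc M(4) N(4) by simp
        moreover from this have "(\<Sum>\<mu>\<in>M. sc (k \<mu>) * xp v \<mu>) \<in> aspan (cornered A)"
          using z(1) M by (intro xp_comb_cornered[OF A vw(2) vwH(2)]) auto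
        ultimately show ?thesis using in_G by auto
      next
        case N_ne: False
        from False obtain \<mu>0 where \<mu>0: "\<mu>0 \<in> M" "\<And>\<mu>. \<mu> \<in> M \<Longrightarrow> length \<mu>0 \<le> length \<mu>" by (rule shortest_path) blast
        have m0: "path v \<mu>0 w" using \<mu>0(1) M(2) by blast
        have g: "yp v \<mu>0 * z \<in> A" using ridealD(4)[OF A z(1) yp_in_R[OF m0]] .
        \<comment> \<open>When both kinds occur, the ghost of \<open>\<mu>0\<close> turns the real
          part into a nonzero scalar term plus closed paths and the ghost part into closed ghosts at
          \<open>w\<close>, so the criterion still applies.\<close>
        have "yp v \<mu>0 * b - sc (k \<mu>0) * p w \<in> aspan (closed_mon w)"
          unfolding M(4) using M(2) by (intro xp_comb_mult(1)[OF M(1) _ \<mu>0]) auto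
        moreover have "yp v \<mu>0 * c \<in> aspan (closed_mon w)"
          unfolding N(4) sum_distrib_left
        proof (rule aspan_sum)
          fix \<nu> assume "\<nu> \<in> N"
          then have n: "path w \<nu> v" "\<nu> \<noteq> []" using N(2) by auto
          have "yp v \<mu>0 * (sc (l \<nu>) * yp w \<nu>) = sc (l \<nu>) * yp w (\<nu> @ \<mu>0)"
            by (simp only: yp_append[OF n(1) m0] mult.assoc[symmetric] sc_yp[OF m0])
          then show "yp v \<mu>0 * (sc (l \<nu>) * yp w \<nu>) \<in> aspan (closed_mon w)"
            using closed_monI(2)[OF path_appendI[OF n(1) m0]] n(2) by (simp add: aspan.base)
        qed
        ultimately have "(yp v \<mu>0 * b - sc (k \<mu>0) * p w) + yp v \<mu>0 * c \<in> aspan (closed_mon w)" by (rule aspan.add)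
        then have "yp v \<mu>0 * z - sc (k \<mu>0) * p w \<in> aspan (closed_mon w)"
          by (simp add: bc distrib_left algebra_simps)
        then have W: "w \<in> W A" using W_criterion[OF A g _ vw(2) vwH(2)] M(3) \<mu>0(1) by blast
        \<comment> \<open>A path from \<open>w\<close> to \<open>v\<close> moves \<open>z\<close>
          into the corner at \<open>w\<close>; multiplying by its ghost recovers
          \<open>z\<close>.\<close>
        from N_ne obtain \<nu> where n: "path w \<nu> v" using N(2) by blast
        have "xp w \<nu> * z \<in> A" using ridealD(4)[OF A z(1) xp_in_R[OF n]] .
        moreover have "p w * (xp w \<nu> * z) = xp w \<nu> * z" using p_xp[OF n] by (simp flip: mult.assoc)
        moreover have "xp w \<nu> * z * p w = xp w \<nu> * z" using pz by (simp add: mult.assoc)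
        ultimately have "yp w \<nu> * (xp w \<nu> * z) \<in> cornered A"
          using corneredI_left[OF A yp_in_R[OF n] _ W] by blast
        moreover have "yp w \<nu> * (xp w \<nu> * z) = z" using pz(1) yp_xp_same[OF n] by (simp flip: mult.assoc)
        ultimately show ?thesis by (auto intro: aspan.base)
      qed
    qed
  qed
qed

lemma ghosts_p:
  assumes "g \<in> aspan (ghosts u)" "v \<in> V" shows "g * p v \<in> aspan (path_mon u v)"
proof (rule aspan_image[OF assms(1), of "\<lambda>g. g * p v"])
  fix a assume "a \<in> ghosts u"
  then obtain c w \<epsilon> where a: "path w \<epsilon> u" "a = sc c * yp w \<epsilon>" unfolding ghosts_def by blast
  show "a * p v \<in> aspan (path_mon u v)"
  proof (cases "v = w")
    case True
    have "sc c * yp v \<epsilon> \<in> path_mon u v"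
    proof (cases "\<epsilon> = []")
      case True
      then have "path u [] v" "sc c * yp v \<epsilon> = sc c * xp u []" using a \<open>v = w\<close> by auto
      then show ?thesis unfolding path_mon_def by blast
    next
      case False
      then show ?thesis using a \<open>v = w\<close> unfolding path_mon_def by blast
    qed
    then show ?thesis using a True yp_p[OF a(1)] by (simp add: mult.assoc aspan.base)
  next
    case False
    then show ?thesis using a yp_p_neq[OF a(1) assms(2)] by (simp add: mult.assoc aspan.zero)
  qed
qed (simp_all add: distrib_right)

lemma Sp_cornered_mult:
  assumes A: "rideal A" and z: "z \<in> aspan (Sp (vs A) \<union> cornered A)" and c: "c \<in> R"
  shows "c * z \<in> aspan (Sp (vs A) \<union> cornered A)"
proof (rule aspan_image[OF z, of "\<lambda>z. c * z"])
  fix a assume "a \<in> Sp (vs A) \<union> cornered A"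
  then show "c * a \<in> aspan (Sp (vs A) \<union> cornered A)"
  proof
    assume "a \<in> Sp (vs A)"
    then show ?thesis using Sp_mult(2)[OF hered_vs[OF A] _ c] by (simp add: aspan.base)
  next
    assume "a \<in> cornered A"
    then obtain a1 b d w where a: "a = a1 * b * d" "a1 \<in> R" "d \<in> R" "b \<in> A" "w \<in> W A" "p w * b = b" "b * p w = b"
      unfolding cornered_def by blast
    then have "c * a1 * b * d \<in> cornered A" using R_mult[OF c a(2)] by (intro corneredI)
    then show ?thesis by (simp add: a(1) mult.assoc aspan.base)
  qed
qed (simp_all add: distrib_left)

text \<open>Multiplication by the ghost of a long path leaves only ghosts, and a vertex on the right
  then puts the element into the shape treated by \<open>path_mon_cornered\<close>.\<close>

lemma ideal_decomposition:
  assumes A: "rideal A" and a: "a \<in> A"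
  shows "a \<in> aspan (Sp (vs A) \<union> cornered A)" (is "a \<in> ?S")
proof -
  have aR: "a \<in> R" by (rule ridealD(1)[OF A a])
  from left_ghost[OF hered_V aR] obtain n where
    n: "\<And>v \<pi> u. \<pi> \<in> front n v \<Longrightarrow> path v \<pi> u \<Longrightarrow> yp v \<pi> * a \<in> aspan (ghosts u)" by blast
  show ?thesis
  proof (rule aspan_least[OF decompose_left[OF aR, of n]])
    show "{xp v \<pi> * (yp v \<pi> * a) | v \<pi>. v \<in> V \<and> \<pi> \<in> front n v} \<subseteq> ?S"
    proof safe
      fix v \<pi> assume v: "v \<in> V" "\<pi> \<in> front n v"
      then obtain u where u: "path v \<pi> u" using front_path by blast
      let ?g = "yp v \<pi> * a"
      have gA: "?g \<in> A" by (rule ridealD(4)[OF A a yp_in_R[OF u]])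
      have "?g \<in> ?S"
      \<comment> \<open>The front of length 0 is the empty path alone, so this splits
        \<open>?g\<close> into the pieces \<open>?g * p v'\<close>.\<close>
      proof (rule aspan_least[OF decompose_right[OF ridealD(1)[OF A gA], of 0]])
        show "{?g * xp v' \<beta> * yp v' \<beta> | v' \<beta>. v' \<in> V \<and> \<beta> \<in> front 0 v'} \<subseteq> ?S"
        proof safe
          fix v' \<beta> assume v': "v' \<in> V" "\<beta> \<in> front 0 v'"
          have "?g * p v' \<in> ?S"
            using path_mon_cornered[OF A ridealD(3)[OF A gA p_in_R[OF v'(1)]] ghosts_p[OF n[OF v(2) u] v'(1)]]
              path_V[OF u] v'(1) by blast
          moreover have "?g * xp v' \<beta> * yp v' \<beta> = ?g * p v'" using v' by (simp add: mult.assoc pp)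
          ultimately show "?g * xp v' \<beta> * yp v' \<beta> \<in> ?S" by simp
        qed
      qed (auto intro: aspan.zero aspan.add)
      then show "xp v \<pi> * (yp v \<pi> * a) \<in> ?S" by (rule Sp_cornered_mult[OF A _ xp_in_R[OF u]])
    qed
  qed (auto intro: aspan.zero aspan.add)
qed

section \<open>Walks without forks and the cycles they contain\<close>

definition det :: "'v set \<Rightarrow> 'v \<Rightarrow> bool" where
  "det H w \<longleftrightarrow> (\<forall>\<pi> u. path w \<pi> u \<longrightarrow> u \<notin> H \<longrightarrow> (\<exists>!e. e \<in> D \<and> s e = u \<and> r e \<notin> H))"

lemma det_path: "det H w \<Longrightarrow> path w \<pi> u \<Longrightarrow> det H u"
  unfolding det_def using path_appendI by blast

lemma det_unique:
  assumes "det H w" "w \<in> V" "w \<notin> H" "e \<in> D" "s e = w" "r e \<notin> H" "f \<in> D" "s f = w" "r f \<notin> H"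
  shows "e = f"
proof -
  have "path w [] w" using assms(2) by simp
  then have "\<exists>!e. e \<in> D \<and> s e = w \<and> r e \<notin> H" using assms(1,3) unfolding det_def by blast
  then show ?thesis using assms by blast
qed

text \<open>A path ending outside a hereditary \<open>H\<close> stays outside throughout, so each of
  its edges is the unique one allowed there.\<close>

lemma det_prefix:
  assumes H: "hered H"
  shows "det H w \<Longrightarrow> path w \<pi> u \<Longrightarrow> u \<notin> H \<Longrightarrow> path w \<beta> t \<Longrightarrow> t \<notin> H \<Longrightarrow> length \<pi> \<le> length \<beta> \<Longrightarrow> prefix \<pi> \<beta>"
proof (induction \<pi> arbitrary: w \<beta>)
  case (Cons e \<pi>)
  then obtain f \<beta>' where b: "\<beta> = f # \<beta>'" by (cases \<beta>) auto
  have e: "e \<in> D" "s e = w" "path (r e) \<pi> u" using Cons.prems(2) by simp_all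
  have f: "f \<in> D" "s f = w" "path (r f) \<beta>' t" using Cons.prems(4) b by simp_all
  have "e = f"
    by (rule det_unique[OF Cons.prems(1)])
      (use e f path_V(1)[OF Cons.prems(2)] not_hered[OF H] Cons.prems in blast)+
  moreover have "prefix \<pi> \<beta>'"
  proof (rule Cons.IH)
    have "path w [e] (r e)" using e r_V by simp
    then show "det H (r e)" by (rule det_path[OF Cons.prems(1)])
    show "path (r e) \<beta>' t" using f \<open>e = f\<close> by simp
  qed (use e Cons.prems b in auto)
  ultimately show ?case using b by simp
qed simp

text \<open>In CK2 at each vertex passed, every summand except that of the edge taken leads into
  \<open>H\<close>. Thus modulo \<open>Sp H\<close> a path is inverted by its ghost on both
  sides.\<close>

lemma det_range_projection:
  assumes H: "hered H"
  shows "det H w \<Longrightarrow> path w \<pi> u \<Longrightarrow> u \<notin> H \<Longrightarrow> xp w \<pi> * yp w \<pi> - p w \<in> Sp H"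
proof (induction \<pi> arbitrary: w)
  case Nil
  then show ?case by (auto simp: pp aspan.zero)
next
  case (Cons e \<pi>)
  note SpD = add_closedD[OF add_closed_Sp[of H]]
  have e: "e \<in> D" "s e = w" "path (r e) \<pi> u" using Cons.prems(2) by simp_all
  have "path w [e] (r e)" using e r_V by simp
  then have "det H (r e)" by (rule det_path[OF Cons.prems(1)])
  from Cons.IH[OF this e(3) Cons.prems(3)]
  have 1: "x e * (xp (r e) \<pi> * yp (r e) \<pi> - p (r e)) * y e \<in> Sp H"
    using Sp_mult[OF H] x_R[OF e(1)] y_R[OF e(1)] by blast
  have re: "r e \<notin> H" and w: "w \<notin> H" "w \<in> V"
    using not_hered[OF H] e(3) Cons.prems(2,3) path_V by blast+
  let ?S = "{f. f \<in> D \<and> s f = s e}"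
  have "p w = x e * y e + (\<Sum>f\<in>?S - {e}. x f * y f)"
    using ck2[OF e(1)] sum.remove[of ?S e "\<lambda>f. x f * y f"] finite_D e by auto
  moreover have "(\<Sum>f\<in>?S - {e}. x f * y f) \<in> Sp H"
  proof (rule add_closed_sum[OF add_closed_Sp])
    fix f assume f: "f \<in> ?S - {e}"
    then have "r f \<in> H" using det_unique[OF Cons.prems(1) w(2,1) e(1,2) re] e(2) by blast
    then have "p (r f) \<in> Sp H" using f r_V by (intro p_R) auto
    then have "x f * p (r f) * y f \<in> Sp H" using Sp_mult[OF H] x_R y_R f by blast
    then show "x f * y f \<in> Sp H" using x_p f by simp
  qed
  ultimately have 2: "x e * y e - p w \<in> Sp H" using SpD(3) by simp
  have "xp w (e # \<pi>) * yp w (e # \<pi>) - p w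
      = x e * (xp (r e) \<pi> * yp (r e) \<pi> - p (r e)) * y e + (x e * y e - p w)"
    using x_p[OF e(1)] by (simp add: right_diff_distrib left_diff_distrib mult.assoc[symmetric])
  then show ?case by (rule ssubst) (rule SpD(4)[OF 1 2])
qed

lemma W_det: "w \<in> W A \<Longrightarrow> det (vs A) w"
  unfolding W_def det_def by blast

text \<open>By \<open>det_prefix\<close> a shortest closed path is a prefix of every other nonempty
  closed path; cancel it and repeat.\<close>

lemma W_cycle:
  assumes A: "rideal A" and w: "w \<in> W A"
  obtains c where "c \<noteq> []" "path w c w" "\<And>\<pi>. path w \<pi> w \<Longrightarrow> \<exists>i. \<pi> = rep i c"
proof -
  have "{c. c \<noteq> [] \<and> path w c w} \<noteq> {}" using w unfolding W_def by blast
  then obtain c where c: "c \<in> {c. c \<noteq> [] \<and> path w c w}"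
    and min: "\<And>\<mu>. \<mu> \<in> {c. c \<noteq> [] \<and> path w c w} \<Longrightarrow> length c \<le> length \<mu>"
    by (rule shortest_path) blast
  have pc: "path w c w" using c by simp
  have "\<exists>i. \<pi> = rep i c" if "path w \<pi> w" for \<pi>
    using that
  proof (induction "length \<pi>" arbitrary: \<pi> rule: less_induct)
    case less
    show ?case
    proof (cases "\<pi> = []")
      case True
      then show ?thesis by (intro exI[of _ 0]) simp
    next
      case False
      with min less.prems have "length c \<le> length \<pi>" by simp
      then have "prefix c \<pi>"
        using det_prefix[OF hered_vs[OF A] W_det[OF w] pc W_D(2)[OF w] less.prems W_D(2)[OF w]] by blast
      then obtain \<beta> where b: "\<pi> = c @ \<beta>" unfolding prefix_def by blast
      with less.prems have "path w \<beta> w" by (simp add: path_append_iff[OF pc])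
      moreover have "length \<beta> < length \<pi>" using b c by simp
      ultimately obtain i where "\<beta> = rep i c" using less.hyps by blast
      then show ?thesis using b by (intro exI[of _ "Suc i"]) simp
    qed
  qed
  with c show ?thesis using that by blast
qed

text \<open>The factor \<open>p w\<close> takes care of \<open>i = 0\<close>, where the power is the
  unit of the ambient ring.\<close>

lemma xp_replicate: "path w c w \<Longrightarrow> xp w (rep i c) = xp w c ^ i * p w"
  by (induction i) (simp_all add: xp_append[OF _ path_replicate] mult.assoc)

lemma yp_replicate: "path w c w \<Longrightarrow> yp w (rep i c) = p w * yp w c ^ i"
  by (induction i) (simp_all add: yp_append[OF _ path_replicate] mult.assoc power_commutes)

section \<open>The Laurent structure of corners modulo an ideal\<close>

lemma R_idealizer: "rideal J \<Longrightarrow> a \<in> R \<Longrightarrow> a \<in> idealizer J"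
  by (rule idealizerI) (auto dest: ridealD)

text \<open>Scalars are not elements of \<open>R\<close> in general, but ideals of \<open>R\<close>
  absorb them, so they too have residues modulo \<open>J\<close>.\<close>

lemma sc_idealizer: "rideal J \<Longrightarrow> sc c \<in> idealizer J"
  by (rule idealizerI) (metis sc_R sc_ideal ridealD(1))

lemma pow_idealizer: "rideal J \<Longrightarrow> a \<in> idealizer J \<Longrightarrow> a ^ n \<in> idealizer J"
  by (induction n) (simp_all add: idealizer_one idealizer_mult)

lemma qmap_pow:
  assumes "rideal J" "a \<in> idealizer J" "b \<in> idealizer J"
  shows "qmap J (a ^ n * b) = qmap J a ^ n * qmap J b"
proof (induction n)
  case (Suc n)
  have "qmap J (a ^ Suc n * b) = qmap J (a * (a ^ n * b))" by (simp add: mult.assoc)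
  also have "\<dots> = qmap J a * qmap J (a ^ n * b)"
    by (rule qmap_hom(4)[OF ridealD(2)[OF assms(1)] assms(2)])
      (use assms in \<open>simp add: idealizer_mult pow_idealizer\<close>)
  finally show ?case using Suc by (simp add: mult.assoc)
qed simp

lemma qmap_pow':
  assumes "rideal J" "a \<in> idealizer J" "b \<in> idealizer J"
  shows "qmap J (b * a ^ n) = qmap J b * qmap J a ^ n"
proof (induction n)
  case (Suc n)
  have "qmap J (b * a ^ Suc n) = qmap J ((b * a ^ n) * a)" by (simp only: power_Suc2 mult.assoc)
  also have "\<dots> = qmap J (b * a ^ n) * qmap J a"
    by (rule qmap_hom(4)[OF ridealD(2)[OF assms(1)] _ assms(2)])
      (use assms in \<open>simp add: idealizer_mult pow_idealizer\<close>)
  finally show ?case using Suc by (simp only: power_Suc2 mult.assoc)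
qed simp

text \<open>
  A vertex on a cycle without exit has the corner \<open>K[C, C']\<close> modulo \<open>J\<close>, where \<open>C\<close> is the cycle
  and \<open>C'\<close> its ghost.
\<close>

lemma W_laurent:
  assumes A: "rideal A" and w: "w \<in> W A" and J: "rideal J" "Sp (vs A) \<subseteq> J"
  obtains C C' where "C \<in> R" "C' \<in> R"
    "laurent_corner (\<lambda>c. qmap J (sc c)) (qmap J (p w)) (qmap J C) (qmap J C')"
    "\<And>a. a \<in> R \<Longrightarrow> p w * a = a \<Longrightarrow> a * p w = a \<Longrightarrow>
      qmap J a \<in> laurent_corner.laurent (\<lambda>c. qmap J (sc c)) (qmap J (p w)) (qmap J C)"
proof -
  let ?H = "vs A" and ?q = "qmap J"
  note H = hered_vs[OF A]
  note Jc = ridealD(2)[OF J(1)]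
  note wV = W_D(1)[OF w] and wH = W_D(2)[OF w]
  obtain c where c: "c \<noteq> []" "path w c w" "\<And>\<pi>. path w \<pi> w \<Longrightarrow> \<exists>i. \<pi> = rep i c"
    using W_cycle[OF A w] by blast
  define C where "C = xp w c"
  define C' where "C' = yp w c"
  have R: "C \<in> R" "C' \<in> R" "p w \<in> R"
    unfolding C_def C'_def by (rule xp_in_R[OF c(2)], rule yp_in_R[OF c(2)], rule p_in_R[OF wV])
  note Ri = R_idealizer[OF J(1)]
  note ki = sc_idealizer[OF J(1)]
  have qm: "?q (a * b) = ?q a * ?q b" if "a \<in> idealizer J" "b \<in> idealizer J" for a b
    using qmap_hom(4)[OF Jc that] .
  have qeq: "?q a = ?q b \<longleftrightarrow> a - b \<in> J" if "a \<in> idealizer J" "b \<in> idealizer J" for a b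
    using qmap_eq_iff[OF Jc that] .
  have kcomm: "?q (sc d) * ?q a = ?q a * ?q (sc d)" if "a \<in> R" for a d
    using sc_R[OF that, of d] qm[OF ki Ri[OF that]] qm[OF Ri[OF that] ki] by metis
  have "C * C' - p w \<in> J"
    using det_range_projection[OF H W_det[OF w] c(2) wH] J(2) unfolding C_def C'_def by blast
  then have CC': "?q C * ?q C' = ?q (p w)"
    using qeq[OF Ri[OF R_mult[OF R(1,2)]] Ri[OF R(3)]] qm[OF Ri[OF R(1)] Ri[OF R(2)]] by simp
  interpret L: laurent_corner "\<lambda>c. ?q (sc c)" "?q (p w)" "?q C" "?q C'"
  proof
    show "?q (sc (a + b)) = ?q (sc a) + ?q (sc b)" for a b
      by (simp only: sc_add qmap_hom(1)[OF Jc ki ki])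
    show "?q (sc (a * b)) = ?q (sc a) * ?q (sc b)" for a b
      by (simp only: sc_mult qm[OF ki ki])
    show "?q (sc 1) * ?q (p w) = ?q (p w)"
      using qm[OF ki Ri[OF R(3)], of 1] sc_1[OF wV] by simp
    show "?q (p w) * ?q (p w) = ?q (p w)"
      using qm[OF Ri[OF R(3)] Ri[OF R(3)]] pp[OF wV wV] by simp
    show "?q C * ?q (p w) = ?q C" "?q (p w) * ?q C = ?q C"
      using qm[OF Ri[OF R(1)] Ri[OF R(3)]] qm[OF Ri[OF R(3)] Ri[OF R(1)]] xp_p[OF c(2)] p_xp[OF c(2)]
      by (simp_all add: C_def)
    show "?q C' * ?q (p w) = ?q C'" "?q (p w) * ?q C' = ?q C'"
      using qm[OF Ri[OF R(2)] Ri[OF R(3)]] qm[OF Ri[OF R(3)] Ri[OF R(2)]] yp_p[OF c(2)] p_yp[OF c(2)]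
      by (simp_all add: C'_def)
    show "?q C' * ?q C = ?q (p w)"
      using qm[OF Ri[OF R(2)] Ri[OF R(1)]] yp_xp_same[OF c(2)] by (simp add: C_def C'_def)
  qed (use kcomm R CC' in auto)
  \<comment> \<open>A threshold in place of a single exponent gives the summands of a sum a common
    denominator.\<close>
  have ev: "\<exists>m0. \<forall>m\<ge>m0. \<exists>f. ?q C ^ m * ?q (p w * a * p w) = L.ev f" if "a \<in> R" for a
    using that
  proof induction
    case zero
    then show ?case using L.ev_0 by (auto simp: qmap_0)
  next
    case (add a b)
    then obtain M N where M: "\<forall>m\<ge>M. \<exists>f. ?q C ^ m * ?q (p w * a * p w) = L.ev f"
      and N: "\<forall>m\<ge>N. \<exists>f. ?q C ^ m * ?q (p w * b * p w) = L.ev f" by blast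
    have R': "p w * a * p w \<in> R" "p w * b * p w \<in> R" using add.hyps R R_mult by blast+
    show ?case
    proof (intro exI[of _ "max M N"] allI impI)
      fix m assume m: "max M N \<le> m"
      then obtain f g where "?q C ^ m * ?q (p w * a * p w) = L.ev f" "?q C ^ m * ?q (p w * b * p w) = L.ev g"
        using M N by fastforce
      moreover have "?q (p w * (a + b) * p w) = ?q (p w * a * p w) + ?q (p w * b * p w)"
        using qmap_hom(1)[OF Jc Ri[OF R'(1)] Ri[OF R'(2)]] by (simp add: distrib_left distrib_right)
      ultimately show "\<exists>f. ?q C ^ m * ?q (p w * (a + b) * p w) = L.ev f"
        by (intro exI[of _ "f + g"]) (simp add: distrib_left L.ev_add)
    qed
  next
    case (base a)
    then obtain d v \<pi> v' \<beta> u where a: "u \<in> V" "path v \<pi> u" "path v' \<beta> u" "a = sc d * (xp v \<pi> * yp v' \<beta>)"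
      by (rule monE)
    have zero: ?case if "?q (p w * a * p w) = 0"
      using that L.ev_0 by (auto intro!: exI[of _ 0])
    have eq: "p w * a * p w = sc d * ((p w * xp v \<pi>) * (yp v' \<beta> * p w))"
      by (simp only: a(4) mult.assoc[symmetric] sc_p[OF wV])
    show ?case
    proof (cases "v = w \<and> v' = w \<and> u \<notin> ?H")
      case False
      have "p w * a * p w \<in> J"
      proof (cases "v = w \<and> v' = w")
        case True
        with False have "u \<in> ?H" by blast
        then have "a \<in> Sp ?H" using monI[OF _ a(2,3)] a(4) by (simp add: aspan.base)
        then have "p w * a * p w \<in> Sp ?H" using Sp_mult[OF H] R(3) by blast
        then show ?thesis using J(2) by blast
      next
        case False
        then have "p w * a * p w = 0"
          unfolding eq using p_xp_neq[OF a(2) wV] yp_p_neq[OF a(3) wV] by auto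
        then show ?thesis using add_closedD(1)[OF Jc] by simp
      qed
      then have "?q (p w * a * p w) = 0" using qmap_hom(5)[OF Jc] R R_mult base.hyps Ri aspan.base
        by metis
      then show ?thesis by (rule zero)
    next
      case True
      then have vw: "v = w" "v' = w" "u \<notin> ?H" by auto
      \<comment> \<open>\<open>length \<pi>\<close> turns around the nonempty \<open>c\<close> are
        at least as long as \<open>\<pi>\<close>, which is therefore a prefix. The remainder
        \<open>\<zeta>\<close> leads from \<open>u\<close> back to \<open>w\<close> and closes
        \<open>\<pi>\<close> and \<open>\<beta>\<close> alike.\<close>
      let ?c = "rep (length \<pi>) c"
      have pc: "path w ?c w" by (rule path_replicate[OF c(2)])
      have "prefix \<pi> ?c"
        using det_prefix[OF H W_det[OF w] _ vw(3) pc wH] a(2) vw(1) length_rep[OF c(1)] by blast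
      then obtain \<zeta> where "?c = \<pi> @ \<zeta>" unfolding prefix_def by blast
      with pc have z: "path u \<zeta> w" using path_append_iff[OF a(2)] vw(1) by simp
      obtain i where i: "\<pi> @ \<zeta> = rep i c" using c(3) path_appendI[OF _ z] a(2) vw(1) by blast
      obtain j where j: "\<beta> @ \<zeta> = rep j c" using c(3) path_appendI[OF _ z] a(3) vw(2) by blast
      have a': "path w \<pi> u" "path w \<beta> u" using a vw by simp_all
      \<comment> \<open>Inserting \<open>\<zeta>\<close> and its ghost between \<open>\<pi>\<close>
        and the ghost of \<open>\<beta>\<close> changes nothing modulo \<open>J\<close> and makes
        both factors powers of the cycle and of its ghost.\<close>
      have "xp u \<zeta> * yp u \<zeta> - p u \<in> J"
        using det_range_projection[OF H det_path[OF W_det[OF w] a'(1)] z wH] J(2) by blast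
      then have "sc d * (xp w \<pi> * (xp u \<zeta> * yp u \<zeta> - p u) * yp w \<beta>) \<in> J"
        using ridealD(3,4)[OF J(1)] xp_in_R[OF a'(1)] yp_in_R[OF a'(2)] sc_ideal[OF J(1)] by blast
      also have "sc d * (xp w \<pi> * (xp u \<zeta> * yp u \<zeta> - p u) * yp w \<beta>)
          = sc d * (xp w (\<pi> @ \<zeta>) * yp w (\<beta> @ \<zeta>)) - sc d * (xp w \<pi> * yp w \<beta>)"
        by (simp add: right_diff_distrib left_diff_distrib xp_append[OF a'(1) z] yp_append[OF a'(2) z]
            xp_p[OF a'(1)] mult.assoc[symmetric])
      finally have 1: "sc d * (xp w (\<pi> @ \<zeta>) * yp w (\<beta> @ \<zeta>)) - sc d * (xp w \<pi> * yp w \<beta>) \<in> J" .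
      have R': "xp w (\<pi> @ \<zeta>) \<in> R" "yp w (\<beta> @ \<zeta>) \<in> R" "xp w \<pi> \<in> R" "yp w \<beta> \<in> R"
        using xp_in_R yp_in_R path_appendI[OF a'(1) z] path_appendI[OF a'(2) z] a' by blast+
      have "p w * a * p w = sc d * (xp w \<pi> * yp w \<beta>)"
        unfolding eq using vw p_xp[OF a'(1)] yp_p[OF a'(2)] by simp
      then have "?q (p w * a * p w) = ?q (sc d * (xp w (\<pi> @ \<zeta>) * yp w (\<beta> @ \<zeta>)))"
        using qeq[OF Ri[OF sc_Sp[OF R_mult[OF R'(1,2)]]] Ri[OF sc_Sp[OF R_mult[OF R'(3,4)]]]] 1 by metis
      also have "\<dots> = ?q (sc d) * (?q (xp w (\<pi> @ \<zeta>)) * ?q (yp w (\<beta> @ \<zeta>)))"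
        using qm[OF ki Ri[OF R_mult[OF R'(1,2)]]] qm[OF Ri[OF R'(1)] Ri[OF R'(2)]] by simp
      also have "\<dots> = ?q (sc d) * (?q C ^ i * ?q (p w) * (?q (p w) * ?q C' ^ j))"
        unfolding i j xp_replicate[OF c(2)] yp_replicate[OF c(2)] C_def[symmetric] C'_def[symmetric]
        by (simp only: qmap_pow[OF J(1) Ri[OF R(1)] Ri[OF R(3)]] qmap_pow'[OF J(1) Ri[OF R(2)] Ri[OF R(3)]])
      also have "\<dots> = ?q (sc d) * (?q C ^ i * (?q (p w) * ?q (p w)) * ?q C' ^ j)"
        by (simp only: mult.assoc)
      also have "\<dots> = ?q (sc d) * (?q C ^ i * ?q (p w) * ?q C' ^ j)"
        by (simp only: L.ww)
      finally have "?q (p w * a * p w) = ?q (sc d) * (?q C ^ i * ?q (p w) * ?q C' ^ j)" .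
      then show ?thesis using L.C_pow_ev_monom by metis
    qed
  qed
  have "?q a \<in> L.laurent" if a: "a \<in> R" "p w * a = a" "a * p w = a" for a
  proof -
    from ev[OF a(1)] obtain m f where "?q C ^ m * ?q (p w * a * p w) = L.ev f" by blast
    then have "?q C ^ m * ?q a = L.ev f" using a by simp
    moreover have "?q a * ?q (p w) = ?q a" "?q (p w) * ?q a = ?q a"
      using qm[OF Ri[OF a(1)] Ri[OF R(3)]] qm[OF Ri[OF R(3)] Ri[OF a(1)]] a by simp_all
    ultimately show ?thesis unfolding L.laurent_def by blast
  qed
  with R(1,2) L.laurent_corner_axioms show ?thesis by (rule that)
qed

text \<open>The gcd \<open>f * P + g * Z\<close> and the lcm \<open>P * b\<close> from
  \<open>laurent_bezout\<close>, pulled back to congruences in \<open>R\<close>. \<open>J\<close>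
  may be larger than \<open>Sp (vs A)\<close> because it will have to contain the vertices of two
  ideals.\<close>

lemma W_corner_bezout:
  assumes A: "rideal A" and w: "w \<in> W A" and J: "rideal J" "Sp (vs A) \<subseteq> J"
    and P: "P \<in> R" "p w * P = P" "P * p w = P" and Z: "Z \<in> R" "p w * Z = Z" "Z * p w = Z"
  obtains f g a b where "f \<in> R" "g \<in> R" "a \<in> R" "b \<in> R"
    "P * Z - Z * P \<in> J" "P * b - Z * a \<in> J" "P * Z - (f * P + g * Z) * (P * b) \<in> J"
proof -
  note Jc = ridealD(2)[OF J(1)] and Ri = R_idealizer[OF J(1)] and pR = p_in_R[OF W_D(1)[OF w]]
  note qm = qmap_hom(4)[OF Jc Ri Ri]
  obtain C C' where CR: "C \<in> R" "C' \<in> R"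
    and L: "laurent_corner (\<lambda>c. qmap J (sc c)) (qmap J (p w)) (qmap J C) (qmap J C')"
    and lau: "\<And>a. a \<in> R \<Longrightarrow> p w * a = a \<Longrightarrow> a * p w = a \<Longrightarrow>
      qmap J a \<in> laurent_corner.laurent (\<lambda>c. qmap J (sc c)) (qmap J (p w)) (qmap J C)"
    using W_laurent[OF A w J] by metis
  interpret L: laurent_corner "\<lambda>c. qmap J (sc c)" "qmap J (p w)" "qmap J C" "qmap J C'" by (rule L)
  obtain s' t' a' b' where Q: "s' \<in> qmap J ` R" "t' \<in> qmap J ` R" "a' \<in> qmap J ` R" "b' \<in> qmap J ` R"
    and e: "qmap J P * b' = qmap J Z * a'"
      "qmap J P * qmap J Z = (s' * qmap J P + t' * qmap J Z) * (qmap J P * b')"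
  proof (rule L.laurent_bezout[OF lau[OF P] lau[OF Z], of "qmap J ` R"])
    show "0 \<in> qmap J ` R" using qmap_0 aspan.zero by (metis image_eqI)
    show "qmap J (sc d) * qmap J (p w) \<in> qmap J ` R" for d
      using qmap_hom(4)[OF Jc sc_idealizer[OF J(1)] Ri[OF pR], of d] sc_Sp[OF pR, of d] by (metis image_eqI)
    show "qmap J C \<in> qmap J ` R" "qmap J C' \<in> qmap J ` R" using CR by blast+
    show "b + d \<in> qmap J ` R" "b * d \<in> qmap J ` R" if bd: "b \<in> qmap J ` R" "d \<in> qmap J ` R" for b d
    proof -
      from bd obtain b' d' where "b' \<in> R" "d' \<in> R" "b = qmap J b'" "d = qmap J d'" by blast
      then have "b + d = qmap J (b' + d')" "b' + d' \<in> R" "b * d = qmap J (b' * d')" "b' * d' \<in> R"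
        by (simp_all add: qmap_hom(1)[OF Jc Ri Ri] aspan.add qm R_mult)
      then show "b + d \<in> qmap J ` R" "b * d \<in> qmap J ` R" by blast+
    qed
  qed
  then obtain s t a b where st: "s \<in> R" "t \<in> R" "a \<in> R" "b \<in> R"
    "s' = qmap J s" "t' = qmap J t" "a' = qmap J a" "b' = qmap J b" by blast
  let ?d = "s * P + t * Z"
  have dR: "?d \<in> R" by (intro aspan.add R_mult st P(1) Z(1))
  note Pb = R_mult[OF P(1) st(4)]
  show thesis
  proof (rule that[OF st(1-4)])
    show "P * Z - Z * P \<in> J"
      using L.laurent_comm[OF lau[OF P] lau[OF Z]] qm[OF P(1) Z(1)] qm[OF Z(1) P(1)]
        qmap_eq_iff[OF Jc Ri[OF R_mult[OF P(1) Z(1)]] Ri[OF R_mult[OF Z(1) P(1)]]] by simp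
    show "P * b - Z * a \<in> J"
      using e(1) st qm[OF P(1) st(4)] qm[OF Z(1) st(3)]
        qmap_eq_iff[OF Jc Ri[OF Pb] Ri[OF R_mult[OF Z(1) st(3)]]] by simp
    have "qmap J (P * Z) = qmap J (?d * (P * b))"
      using e(2) by (simp only: st qm[OF P(1) Z(1)] qm[OF dR Pb] qm[OF P(1) st(4)]
          qmap_hom(1)[OF Jc Ri[OF R_mult[OF st(1) P(1)]] Ri[OF R_mult[OF st(2) Z(1)]]]
          qm[OF st(1) P(1)] qm[OF st(2) Z(1)])
    then show "P * Z - ?d * (P * b) \<in> J"
      using qmap_eq_iff[OF Jc Ri[OF R_mult[OF P(1) Z(1)]] Ri[OF R_mult[OF dR Pb]]] by simp
  qed
qed

text \<open>If paths from \<open>w\<close> and \<open>u\<close> meet outside both vertex sets, then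
  the first times the ghost of the second links the corners: both are inverted by their ghosts
  modulo \<open>J\<close>. Otherwise every monomial from \<open>w\<close> to \<open>u\<close> passes
  through a vertex of \<open>A\<close> or \<open>B\<close>.\<close>

lemma W_linked:
  assumes A: "rideal A" and B: "rideal B" and w: "w \<in> W A" and u: "u \<in> W B"
    and t: "t \<in> R"
  shows "p w * t * p u \<in> Sp (vs A \<union> vs B) \<or> (\<exists>g\<in>R. \<exists>g'\<in>R. p w * g = g \<and> g' * p w = g' \<and>
    g * g' - p w \<in> Sp (vs A \<union> vs B) \<and> g' * g - p u \<in> Sp (vs A \<union> vs B))"
proof (cases "\<exists>v \<pi> \<beta>. path w \<pi> v \<and> path u \<beta> v \<and> v \<notin> vs A \<union> vs B")
  case True
  then obtain v \<pi> \<beta> where a: "path w \<pi> v" "path u \<beta> v" "v \<notin> vs A" "v \<notin> vs B" by blast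
  let ?g = "xp w \<pi> * yp u \<beta>" and ?g' = "xp u \<beta> * yp w \<pi>"
  have "?g * ?g' = xp w \<pi> * (yp u \<beta> * xp u \<beta>) * yp w \<pi>" by (simp only: mult.assoc)
  also have "\<dots> = xp w \<pi> * yp w \<pi>" by (simp only: yp_xp_same[OF a(2)] xp_p[OF a(1)])
  finally have 1: "?g * ?g' - p w \<in> Sp (vs A \<union> vs B)"
    using det_range_projection[OF hered_vs[OF A] W_det[OF w] a(1,3)] Sp_mono[of "vs A" "vs A \<union> vs B"] by auto
  have "?g' * ?g = xp u \<beta> * (yp w \<pi> * xp w \<pi>) * yp u \<beta>" by (simp only: mult.assoc)
  also have "\<dots> = xp u \<beta> * yp u \<beta>" by (simp only: yp_xp_same[OF a(1)] xp_p[OF a(2)])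
  finally have 2: "?g' * ?g - p u \<in> Sp (vs A \<union> vs B)"
    using det_range_projection[OF hered_vs[OF B] W_det[OF u] a(2,4)] Sp_mono[of "vs B" "vs A \<union> vs B"] by auto
  have "?g \<in> R" "?g' \<in> R" using R_mult xp_in_R[OF a(1)] yp_in_R[OF a(1)] xp_in_R[OF a(2)] yp_in_R[OF a(2)] by blast+
  moreover have "p w * ?g = ?g" using p_xp[OF a(1)] by (simp flip: mult.assoc)
  moreover have "?g' * p w = ?g'" using yp_p[OF a(1)] by (simp add: mult.assoc)
  ultimately show ?thesis using 1 2 by blast
next
  case False
  note wV = W_D(1)[OF w] and uV = W_D(1)[OF u]
  note H = hered_Un[OF hered_vs[OF A] hered_vs[OF B]]
  have "p w * t * p u \<in> Sp (vs A \<union> vs B)"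
  proof (rule aspan_image[OF t, of "\<lambda>t. p w * t * p u"])
    fix a assume "a \<in> mon V"
    then obtain d v \<pi> v' \<beta> z where a: "z \<in> V" "path v \<pi> z" "path v' \<beta> z" "a = sc d * (xp v \<pi> * yp v' \<beta>)"
      by (rule monE)
    show "p w * a * p u \<in> Sp (vs A \<union> vs B)"
    proof (cases "v = w \<and> v' = u")
      case True
      with False a have "z \<in> vs A \<union> vs B" by blast
      then have "a \<in> Sp (vs A \<union> vs B)" using monI[OF _ a(2,3)] a(4) by (simp add: aspan.base)
      then show ?thesis using Sp_mult[OF H] p_in_R[OF wV] p_in_R[OF uV] by blast
    next
      case False
      have "p w * a * p u = sc d * ((p w * xp v \<pi>) * (yp v' \<beta> * p u))"
        by (simp only: a(4) mult.assoc[symmetric] sc_p[OF wV])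
      also have "\<dots> = 0" using False p_xp_neq[OF a(2) wV] yp_p_neq[OF a(3) uV] by auto
      finally show ?thesis by (simp add: aspan.zero)
    qed
  qed (simp_all add: distrib_left distrib_right)
  then show ?thesis by blast
qed

text \<open>The factors decompose into corners at possibly different vertices. A link moves the
  second corner to that of the first, up to \<open>J\<close>; what remains is a product
  \<open>P * Z\<close> inside one corner, and the link contributes the factor
  \<open>g\<close>.\<close>

lemma mult_mem_criterion:
  assumes A: "rideal A" and B: "rideal B" and T: "rideal T" "T \<subseteq> A \<inter> B"
    and JT: "\<And>z. z \<in> Sp (vs A \<union> vs B) \<Longrightarrow> z \<in> A \<Longrightarrow> z \<in> B \<Longrightarrow> z \<in> T"
    and corner: "\<And>w P Z g. w \<in> W A \<Longrightarrow> P \<in> A \<Longrightarrow> Z \<in> B \<Longrightarrow> g \<in> R \<Longrightarrow>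
      p w * P = P \<Longrightarrow> P * p w = P \<Longrightarrow> p w * Z = Z \<Longrightarrow> Z * p w = Z \<Longrightarrow>
      \<exists>\<tau>\<in>T. P * Z * g - \<tau> \<in> Sp (vs A \<union> vs B)"
    and a: "a \<in> A" and b: "b \<in> B"
  shows "a * b \<in> T"
proof -
  let ?J = "Sp (vs A \<union> vs B)"
  note JI = rideal_Sp[OF hered_Un[OF hered_vs[OF A] hered_vs[OF B]]]
  note Tc = ridealD(2)[OF T(1)]
  have AB: "c * d \<in> A" "c * d \<in> B" if "c \<in> A" "d \<in> B" for c d
    using ridealD(3)[OF A that(1) ridealD(1)[OF B that(2)]] ridealD(4)[OF B that(2) ridealD(1)[OF A that(1)]] .
  have JA: "Sp (vs A) \<subseteq> ?J" "Sp (vs B) \<subseteq> ?J" by (rule Sp_mono, simp)+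
  \<comment> \<open>Since \<open>T\<close> lies in \<open>A \<inter> B\<close>, so does the error
    \<open>z - \<tau>\<close>; being in \<open>J\<close>, it is covered by
    \<open>JT\<close>.\<close>
  have modJ: "z \<in> T" if "z \<in> A" "z \<in> B" "\<tau> \<in> T" "z - \<tau> \<in> ?J" for z \<tau>
  proof -
    have "z - \<tau> \<in> T"
    proof (rule JT[OF that(4)])
      have "\<tau> \<in> A" "\<tau> \<in> B" using that(3) T(2) by blast+
      then show "z - \<tau> \<in> A" "z - \<tau> \<in> B"
        using add_closedD(2)[OF ridealD(2)[OF A] that(1)] add_closedD(2)[OF ridealD(2)[OF B] that(2)] by blast+
    qed
    from add_closedD(4)[OF Tc this that(3)] show ?thesis by simp
  qed
  have cc: "y * t * z \<in> T" if y: "y \<in> A" "w \<in> W A" "p w * y = y" "y * p w = y"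
    and z: "z \<in> B" "u \<in> W B" "p u * z = z" "z * p u = z" and t: "t \<in> R" for y w z u t
  proof -
    have yt: "y * t \<in> A" and tz: "t * z \<in> B" using ridealD(3)[OF A y(1) t] ridealD(4)[OF B z(1) t] .
    have ytz: "y * t * z \<in> A" "y * t * z \<in> B" using AB[OF yt z(1)] by blast+
    have eq: "y * t * z = y * (p w * t * p u) * z"
    proof -
      have "y * (p w * t * p u) * z = (y * p w) * t * (p u * z)" by (simp only: mult.assoc)
      then show ?thesis by (simp only: y z)
    qed
    show ?thesis
    proof (cases "p w * t * p u \<in> ?J")
      case True
      have "y * t * z \<in> ?J"
        unfolding eq by (rule ridealD(3)[OF JI ridealD(4)[OF JI True ridealD(1)[OF A y(1)]] ridealD(1)[OF B z(1)]])
      with ytz show ?thesis by (intro JT)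
    next
      case False
      with W_linked[OF A B y(2) z(2) t] obtain g g' where g: "g \<in> R" "g' \<in> R" "p w * g = g" "g' * p w = g'"
        "g * g' - p w \<in> ?J" "g' * g - p u \<in> ?J" by blast
      \<comment> \<open>Since \<open>g' * g\<close> is \<open>p u\<close> modulo \<open>J\<close>,
        the product \<open>?P * ?Z * g\<close>, that is
        \<open>y * t * (g' * g) * z * (g' * g)\<close>, agrees with \<open>y * t * z\<close> modulo
        \<open>J\<close>.\<close>
      let ?P = "y * t * g'" and ?Z = "g * z * g'"
      have "?P \<in> A" "?Z \<in> B" using ridealD(3)[OF A yt g(2)] ridealD(3)[OF B ridealD(4)[OF B z(1) g(1)] g(2)] .
      moreover have "p w * ?P = ?P" "p w * ?Z = ?Z" using y(3) g(3) by (simp_all flip: mult.assoc)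
      moreover have "?P * p w = ?P" "?Z * p w = ?Z" using g(4) by (simp_all add: mult.assoc)
      ultimately obtain \<tau> where \<tau>: "\<tau> \<in> T" "?P * ?Z * g - \<tau> \<in> ?J" using corner[OF y(2)] g(1) by blast
      have "y * t * (g' * g - p u) * z \<in> ?J" "y * t * (g' * g) * (z * (g' * g - p u)) \<in> ?J"
        by (intro ridealD(3)[OF JI] ridealD(4)[OF JI] R_mult g ridealD(1)[OF A yt] ridealD(1)[OF B z(1)])+
      then have 1: "y * t * (g' * g - p u) * z + y * t * (g' * g) * (z * (g' * g - p u)) \<in> ?J"
        by (rule add_closedD(4)[OF ridealD(2)[OF JI]])
      have "y * t * (g' * g - p u) * z = y * t * (g' * g) * z - y * t * (p u * z)"
        by (simp only: right_diff_distrib left_diff_distrib mult.assoc)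
      moreover have "y * t * (g' * g) * (z * (g' * g - p u)) = ?P * ?Z * g - y * t * (g' * g) * (z * p u)"
        by (simp only: right_diff_distrib left_diff_distrib mult.assoc)
      ultimately have "y * t * (g' * g - p u) * z + y * t * (g' * g) * (z * (g' * g - p u)) = ?P * ?Z * g - y * t * z"
        by (simp only: z(3,4) mult.assoc) simp
      with 1 have 2: "?P * ?Z * g - y * t * z \<in> ?J" by simp
      have "y * t * z - \<tau> = (?P * ?Z * g - \<tau>) - (?P * ?Z * g - y * t * z)" by simp
      also have "\<dots> \<in> ?J" by (rule add_closedD(2)[OF ridealD(2)[OF JI] \<tau>(2) 2])
      finally show ?thesis using modJ[OF ytz \<tau>(1)] by blast
    qed
  qed
  show ?thesis
  proof (rule aspan_mult[OF ideal_decomposition[OF A a] ideal_decomposition[OF B b], of T, THEN aspan_least_closed[OF _ Tc]])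
    fix c d assume c: "c \<in> Sp (vs A) \<union> cornered A" and d: "d \<in> Sp (vs B) \<union> cornered B"
    have "cornered A \<subseteq> A" "cornered B \<subseteq> B"
      unfolding cornered_def by (blast intro: ridealD(3)[OF A] ridealD(4)[OF A], blast intro: ridealD(3)[OF B] ridealD(4)[OF B])
    then have cA: "c \<in> A" "d \<in> B" using c d Sp_vs[OF A] Sp_vs[OF B] by blast+
    note cd = AB[OF cA]
    consider "c \<in> Sp (vs A)" | "d \<in> Sp (vs B)" | "c \<in> cornered A" "d \<in> cornered B" using c d by blast
    then have "c * d \<in> T"
    proof cases
      case 1
      then have "c * d \<in> ?J" using JA ridealD(3)[OF JI] ridealD(1)[OF B cA(2)] by blast
      with cd show ?thesis by (intro JT)
    next
      case 2
      then have "c * d \<in> ?J" using JA ridealD(4)[OF JI] ridealD(1)[OF A cA(1)] by blast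
      with cd show ?thesis by (intro JT)
    next
      case 3
      then obtain c1 y c2 w d1 z d2 u where
        c': "c = c1 * y * c2" "c1 \<in> R" "c2 \<in> R" "y \<in> A" "w \<in> W A" "p w * y = y" "y * p w = y" and
        d': "d = d1 * z * d2" "d1 \<in> R" "d2 \<in> R" "z \<in> B" "u \<in> W B" "p u * z = z" "z * p u = z"
        unfolding cornered_def by blast
      have "y * (c2 * d1) * z \<in> T" (is "?t \<in> T")
        using cc[OF c'(4,5,6,7) d'(4,5,6,7)] R_mult c'(3) d'(2) by blast
      then have "c1 * ?t * d2 \<in> T" by (rule ridealD(3)[OF T(1) ridealD(4)[OF T(1) _ c'(2)] d'(3)])
      then show ?thesis by (simp add: c'(1) d'(1) mult.assoc)
    qed
    then show "c * d \<in> aspan T" by (rule aspan.base)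
  qed simp
qed

section \<open>The two inclusions for ideals of \<open>R\<close>\<close>

lemma aprod_subset:
  assumes "rideal A" "rideal B" shows "aprod A B \<subseteq> A" "aprod A B \<subseteq> B"
proof -
  show "aprod A B \<subseteq> A"
    unfolding aprod_def
    by (rule subsetI, erule aspan_least_closed[OF _ ridealD(2)[OF assms(1)]])
      (auto intro: ridealD(3)[OF assms(1)] dest: ridealD(1)[OF assms(2)])
  show "aprod A B \<subseteq> B"
    unfolding aprod_def
    by (rule subsetI, erule aspan_least_closed[OF _ ridealD(2)[OF assms(2)]])
      (auto intro: ridealD(4)[OF assms(2)] dest: ridealD(1)[OF assms(1)])
qed

lemma aprod_commute:
  assumes A: "rideal A" and B: "rideal B" and ab: "a \<in> A" "b \<in> B"
  shows "a * b \<in> aprod B A"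
proof (rule mult_mem_criterion[OF A B rideal_aprod[OF B A] _ _ _ ab])
  let ?J = "Sp (vs A \<union> vs B)"
  note JI = rideal_Sp[OF hered_Un[OF hered_vs[OF A] hered_vs[OF B]]]
  show "aprod B A \<subseteq> A \<inter> B" using aprod_subset[OF B A] by blast
  show "z \<in> aprod B A" if "z \<in> ?J" "z \<in> A" "z \<in> B" for z
    using Sp_inter_aprod[OF B A _ that(3,2)] that(1) by (simp add: Un_commute)
  fix w P Z g
  assume w: "w \<in> W A" and P: "P \<in> A" and Z: "Z \<in> B" and g: "g \<in> R"
    and c: "p w * P = P" "P * p w = P" "p w * Z = Z" "Z * p w = Z"
  have R: "P \<in> R" "Z \<in> R" using ridealD(1)[OF A P] ridealD(1)[OF B Z] .
  have "Sp (vs A) \<subseteq> ?J" by (rule Sp_mono) simp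
  then have "P * Z - Z * P \<in> ?J"
    by (rule W_corner_bezout[OF A w JI _ R(1) c(1,2) R(2) c(3,4)])
  then have "(P * Z - Z * P) * g \<in> ?J" by (rule ridealD(3)[OF JI _ g])
  then have "P * Z * g - Z * (P * g) \<in> ?J" by (simp only: left_diff_distrib mult.assoc)
  with aprodI[OF Z ridealD(3)[OF A P g]] show "\<exists>\<tau>\<in>aprod B A. P * Z * g - \<tau> \<in> ?J" by blast
qed

lemma rideal_Int: "rideal A \<Longrightarrow> rideal B \<Longrightarrow> rideal (A \<inter> B)"
  unfolding rideal_def add_closed_def by blast

lemma rideal_sum:
  assumes A: "rideal A" and B: "rideal B"
  shows "rideal {a + b | a b. a \<in> A \<and> b \<in> B}" (is "rideal ?S")
proof -
  note Ac = add_closedD[OF ridealD(2)[OF A]] and Bc = add_closedD[OF ridealD(2)[OF B]]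
  have "0 + 0 \<in> ?S" using Ac(1) Bc(1) by blast
  moreover have "c - d \<in> ?S" if "c \<in> ?S" "d \<in> ?S" for c d
  proof -
    from that obtain a b a' b' where "a \<in> A" "b \<in> B" "a' \<in> A" "b' \<in> B" "c = a + b" "d = a' + b'" by blast
    then have "c - d = (a - a') + (b - b')" "a - a' \<in> A" "b - b' \<in> B" by (auto intro: Ac Bc)
    then show ?thesis by blast
  qed
  ultimately have "add_closed ?S" unfolding add_closed_def by simp
  moreover have "?S \<subseteq> R" using ridealD(1)[OF A] ridealD(1)[OF B] by (auto intro: aspan.add)
  moreover have "c * d \<in> ?S" "d * c \<in> ?S" if c: "c \<in> ?S" and d: "d \<in> R" for c d
  proof -
    from c obtain a b where ab: "a \<in> A" "b \<in> B" "c = a + b" by blast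
    have "c * d = a * d + b * d" "d * c = d * a + d * b" by (simp_all add: ab(3) distrib_left distrib_right)
    with ridealD(3,4)[OF A ab(1) d] ridealD(3,4)[OF B ab(2) d] show "c * d \<in> ?S" "d * c \<in> ?S" by blast+
  qed
  ultimately show ?thesis unfolding rideal_def by blast
qed

lemma aprod_sum_inter:
  assumes A: "rideal A" and B: "rideal B" and ab: "a \<in> A" "b \<in> B"
  shows "a * b \<in> aprod {a + b | a b. a \<in> A \<and> b \<in> B} (A \<inter> B)" (is "_ \<in> aprod ?S _")
proof (rule mult_mem_criterion[OF A B rideal_aprod[OF rideal_sum[OF A B] rideal_Int[OF A B]] _ _ _ ab])
  let ?J = "Sp (vs A \<union> vs B)"
  note JI = rideal_Sp[OF hered_Un[OF hered_vs[OF A] hered_vs[OF B]]]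
  note Jc = ridealD(2)[OF JI]
  note SI = rideal_sum[OF A B] and II = rideal_Int[OF A B]
  show "aprod ?S (A \<inter> B) \<subseteq> A \<inter> B" using aprod_subset(2)[OF SI II] .
  have "a + 0 \<in> ?S" if "a \<in> A" for a using that add_closedD(1)[OF ridealD(2)[OF B]] by blast
  moreover have "0 + b \<in> ?S" if "b \<in> B" for b using that add_closedD(1)[OF ridealD(2)[OF A]] by blast
  ultimately have ABS: "A \<union> B \<subseteq> ?S" by auto
  show "z \<in> aprod ?S (A \<inter> B)" if "z \<in> ?J" "z \<in> A" "z \<in> B" for z
    using ABS by (intro Sp_inter_aprod_sum[OF A B that rideal_aprod[OF SI II]] aprodI) auto
  fix w P Z g
  assume w: "w \<in> W A" and P: "P \<in> A" and Z: "Z \<in> B" and g: "g \<in> R"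
    and c: "p w * P = P" "P * p w = P" "p w * Z = Z" "Z * p w = Z"
  have R: "P \<in> R" "Z \<in> R" using ridealD(1)[OF A P] ridealD(1)[OF B Z] .
  have "Sp (vs A) \<subseteq> ?J" by (rule Sp_mono) simp
  then obtain s t a1 b1 where st: "s \<in> R" "t \<in> R" "a1 \<in> R" "b1 \<in> R" and "P * b1 - Z * a1 \<in> ?J"
    and 1: "P * Z - (s * P + t * Z) * (P * b1) \<in> ?J"
    by (rule W_corner_bezout[OF A w JI _ R(1) c(1,2) R(2) c(3,4)])
  have Pb: "P * b1 \<in> A" "P * b1 \<in> R" and Za: "Z * a1 \<in> B" "Z * a1 \<in> R"
    using ridealD(3)[OF A P st(4)] ridealD(3)[OF B Z st(3)] R_mult R st by blast+
  have "P * b1 - Z * a1 \<in> ?J" by fact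
  \<comment> \<open>The common multiple is in \<open>A\<close> and, only up to \<open>J\<close>, in
    \<open>B\<close>. As \<open>J\<close> is the sum of the vertex parts of \<open>A\<close> and
    \<open>B\<close>, the error splits as \<open>j1 + j2\<close>, and moving \<open>j1\<close> to
    the other side yields an exact element of \<open>A \<inter> B\<close>.\<close>
  also have "mon (vs A \<union> vs B) = mon (vs A) \<union> mon (vs B)" unfolding mon_def by blast
  finally obtain j1 j2 where j: "j1 \<in> Sp (vs A)" "j2 \<in> Sp (vs B)" "P * b1 - Z * a1 = j1 + j2"
    by (rule aspan_Un)
  define m where "m = P * b1 - j1"
  have m': "m = Z * a1 + j2" using j(3) by (simp add: m_def algebra_simps)
  have "m \<in> A" unfolding m_def
    using add_closedD(2)[OF ridealD(2)[OF A] Pb(1)] j(1) Sp_vs[OF A] by blast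
  moreover have "m \<in> B" unfolding m'
    using add_closedD(4)[OF ridealD(2)[OF B] Za(1)] j(2) Sp_vs[OF B] by blast
  ultimately have mI: "m \<in> A \<inter> B" by blast
  let ?d = "s * P + t * Z"
  have dS: "?d \<in> ?S" using ridealD(4)[OF A P st(1)] ridealD(4)[OF B Z st(2)] by blast
  have dR: "?d \<in> R" by (rule ridealD(1)[OF SI dS])
  have "j1 \<in> ?J" using j(1) Sp_mono[of "vs A" "vs A \<union> vs B"] by blast
  then have 2: "?d * j1 \<in> ?J" by (rule ridealD(4)[OF JI _ dR])
  have "P * Z - ?d * m = (P * Z - ?d * (P * b1)) + ?d * j1"
    by (simp only: m_def right_diff_distrib) simp
  also have "\<dots> \<in> ?J" by (rule add_closedD(4)[OF Jc 1 2])
  finally have "(P * Z - ?d * m) * g \<in> ?J" by (rule ridealD(3)[OF JI _ g])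
  then have "P * Z * g - ?d * (m * g) \<in> ?J" by (simp only: left_diff_distrib mult.assoc)
  with aprodI[OF dS ridealD(3)[OF II mI g]] show "\<exists>\<tau>\<in>aprod ?S (A \<inter> B). P * Z * g - \<tau> \<in> ?J" by blast
qed

end

subsection \<open>Splitting vertices\<close>

text \<open>
  A finite part of a Leavitt path algebra, where CK2 need not hold. The \<open>doubled\<close> family has two vertices
  for each \<open>v\<close>: the part of \<open>v\<close> emitted by the chosen edges, and its complement, a sink.
\<close>

locale cohn_family =
  fixes V :: "'v set" and D :: "'e set" and t h :: "'e \<Rightarrow> 'v"
    and sc :: "'k::field \<Rightarrow> 'r::ring_1" and P :: "'v \<Rightarrow> 'r" and X Y :: "'e \<Rightarrow> 'r"
  assumes finite_V: "finite V" and finite_D: "finite D"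
    and t_V: "e \<in> D \<Longrightarrow> t e \<in> V" and h_V: "e \<in> D \<Longrightarrow> h e \<in> V"
    and sc_add: "sc (a + b) = sc a + sc b"
    and sc_mult: "sc (a * b) = sc a * sc b"
    and sc_1: "v \<in> V \<Longrightarrow> sc 1 * P v = P v"
    and sc_P: "v \<in> V \<Longrightarrow> sc a * P v = P v * sc a"
    and sc_X: "e \<in> D \<Longrightarrow> sc a * X e = X e * sc a"
    and sc_Y: "e \<in> D \<Longrightarrow> sc a * Y e = Y e * sc a"
    and PP: "v \<in> V \<Longrightarrow> w \<in> V \<Longrightarrow> P v * P w = (if v = w then P v else 0)"
    and P_X: "e \<in> D \<Longrightarrow> P (t e) * X e = X e" and X_P: "e \<in> D \<Longrightarrow> X e * P (h e) = X e"
    and P_Y: "e \<in> D \<Longrightarrow> P (h e) * Y e = Y e" and Y_P: "e \<in> D \<Longrightarrow> Y e * P (t e) = Y e"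
    and CK1: "e \<in> D \<Longrightarrow> f \<in> D \<Longrightarrow> Y e * X f = (if e = f then P (h e) else 0)"
begin

definition emitted :: "'v \<Rightarrow> 'r" where
  "emitted v = (\<Sum>e | e \<in> D \<and> t e = v. X e * Y e)"

text \<open>The flag \<open>True\<close> marks the complement. Either half can be zero: the emitted
  one if no chosen edge leaves \<open>v\<close>, the complement if CK2 already holds at
  \<open>v\<close>. This is why \<open>leavitt_family\<close> admits vanishing vertices.\<close>

definition proj :: "'v \<times> bool \<Rightarrow> 'r" where
  "proj = (\<lambda>(v, i). if i then P v - emitted v else emitted v)"

text \<open>An edge is divided according to the half of its range in which it ends. Both pieces
  start in the emitted half of the source, which leaves the complements as sinks.\<close>

definition xe :: "'e \<times> bool \<Rightarrow> 'r" where "xe = (\<lambda>(e, i). X e * proj (h e, i))"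
definition ye :: "'e \<times> bool \<Rightarrow> 'r" where "ye = (\<lambda>(e, i). proj (h e, i) * Y e)"

lemma proj_simps: "proj (v, False) = emitted v" "proj (v, True) = P v - emitted v"
  by (simp_all add: proj_def)

lemma finite_emit: "finite {e. e \<in> D \<and> t e = v}"
  by (rule finite_subset[OF _ finite_D]) blast

lemma P_X': "v \<in> V \<Longrightarrow> e \<in> D \<Longrightarrow> P v * X e = (if v = t e then X e else 0)"
proof -
  assume v: "v \<in> V" and e: "e \<in> D"
  have "P v * X e = (P v * P (t e)) * X e" by (simp only: mult.assoc P_X[OF e])
  then show ?thesis using PP[OF v t_V[OF e]] P_X[OF e] by simp
qed

lemma Y_P': "v \<in> V \<Longrightarrow> e \<in> D \<Longrightarrow> Y e * P v = (if v = t e then Y e else 0)"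
proof -
  assume v: "v \<in> V" and e: "e \<in> D"
  have "Y e * P v = Y e * (P (t e) * P v)" by (simp only: mult.assoc[symmetric] Y_P[OF e])
  then show ?thesis using PP[OF t_V[OF e] v] Y_P[OF e] by auto
qed

lemma emitted_X: "e \<in> D \<Longrightarrow> emitted v * X e = (if v = t e then X e else 0)"
proof -
  assume e: "e \<in> D"
  have "emitted v * X e = (\<Sum>f | f \<in> D \<and> t f = v. X f * (Y f * X e))"
    by (simp only: emitted_def sum_distrib_right mult.assoc)
  also have "\<dots> = (\<Sum>f | f \<in> D \<and> t f = v. if f = e then X e else 0)"
    by (rule sum.cong) (use e in \<open>auto simp: CK1 X_P\<close>)
  also have "\<dots> = (if v = t e then X e else 0)"
    using e by (simp add: finite_emit sum.delta)
  finally show ?thesis .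
qed

lemma Y_emitted: "e \<in> D \<Longrightarrow> Y e * emitted v = (if v = t e then Y e else 0)"
proof -
  assume e: "e \<in> D"
  have "Y e * emitted v = (\<Sum>f | f \<in> D \<and> t f = v. (Y e * X f) * Y f)"
    by (simp only: emitted_def sum_distrib_left mult.assoc)
  also have "\<dots> = (\<Sum>f | f \<in> D \<and> t f = v. if e = f then Y e else 0)"
    by (rule sum.cong) (use e in \<open>auto simp: CK1 P_Y\<close>)
  also have "\<dots> = (if v = t e then Y e else 0)"
    using e by (simp add: finite_emit sum.delta')
  finally show ?thesis .
qed

lemma emitted_emitted: "emitted v * emitted w = (if v = w then emitted v else 0)"
proof -
  have "emitted v * emitted w = (\<Sum>f | f \<in> D \<and> t f = w. (emitted v * X f) * Y f)"
    by (simp only: emitted_def[of w] sum_distrib_left mult.assoc)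
  also have "\<dots> = (\<Sum>f | f \<in> D \<and> t f = w. if v = w then X f * Y f else 0)"
    by (rule sum.cong) (auto simp: emitted_X)
  finally show ?thesis by (simp add: emitted_def)
qed

lemma P_emitted: "v \<in> V \<Longrightarrow> P v * emitted w = (if v = w then emitted v else 0)"
proof -
  assume v: "v \<in> V"
  have "P v * emitted w = (\<Sum>f | f \<in> D \<and> t f = w. (P v * X f) * Y f)"
    by (simp only: emitted_def[of w] sum_distrib_left mult.assoc)
  also have "\<dots> = (\<Sum>f | f \<in> D \<and> t f = w. if v = w then X f * Y f else 0)"
    by (rule sum.cong) (auto simp: P_X' v)
  finally show ?thesis by (simp add: emitted_def)
qed

lemma emitted_P: "v \<in> V \<Longrightarrow> emitted w * P v = (if v = w then emitted v else 0)"
proof -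
  assume v: "v \<in> V"
  have "emitted w * P v = (\<Sum>f | f \<in> D \<and> t f = w. X f * (Y f * P v))"
    by (simp only: emitted_def[of w] sum_distrib_right mult.assoc)
  also have "\<dots> = (\<Sum>f | f \<in> D \<and> t f = w. if v = w then X f * Y f else 0)"
    by (rule sum.cong) (auto simp: Y_P' v)
  finally show ?thesis by (simp add: emitted_def)
qed

lemma proj_proj:
  assumes "v \<in> V" "w \<in> V"
  shows "proj (v, i) * proj (w, j) = (if v = w \<and> i = j then proj (v, i) else 0)"
  using assms
  by (cases i; cases j)
    (auto simp: proj_simps PP emitted_emitted P_emitted emitted_P left_diff_distrib right_diff_distrib)

lemma P_proj: "v \<in> V \<Longrightarrow> P v * proj (v, i) = proj (v, i)"
  by (cases i) (auto simp: proj_simps PP P_emitted right_diff_distrib)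

lemma sc_emitted: "sc c * emitted v = emitted v * sc c"
  unfolding emitted_def sum_distrib_left sum_distrib_right
proof (rule sum.cong[OF refl])
  fix e assume "e \<in> {e. e \<in> D \<and> t e = v}"
  then have e: "e \<in> D" by simp
  have "sc c * (X e * Y e) = X e * (sc c * Y e)" by (simp only: mult.assoc[symmetric] sc_X[OF e])
  then show "sc c * (X e * Y e) = X e * Y e * sc c" by (simp only: sc_Y[OF e] mult.assoc)
qed

lemma sc_proj: "v \<in> V \<Longrightarrow> sc c * proj (v, i) = proj (v, i) * sc c"
  by (cases i) (simp_all add: proj_simps sc_emitted sc_P left_diff_distrib right_diff_distrib)

lemma sc_1_proj: "v \<in> V \<Longrightarrow> sc 1 * proj (v, i) = proj (v, i)"
proof -
  assume v: "v \<in> V"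
  have "sc 1 * proj (v, i) = sc 1 * P v * proj (v, i)" by (simp only: mult.assoc P_proj[OF v])
  then show ?thesis by (simp only: sc_1[OF v] P_proj[OF v])
qed

text \<open>The two halves of a range vertex add up to that vertex, so the pieces of each edge
  recombine.\<close>

lemma doubled_ck2: "(\<Sum>f | f \<in> D \<times> UNIV \<and> (case f of (f, i) \<Rightarrow> (t f, False)) = (v, False). xe f * ye f) = emitted v"
proof -
  have eq: "{f. f \<in> D \<times> UNIV \<and> (case f of (f, i) \<Rightarrow> (t f, False)) = (v, False)} = {f. f \<in> D \<and> t f = v} \<times> UNIV"
    by auto
  have "(\<Sum>f | f \<in> D \<times> UNIV \<and> (case f of (f, i) \<Rightarrow> (t f, False)) = (v, False). xe f * ye f)
      = (\<Sum>f | f \<in> D \<and> t f = v. \<Sum>i\<in>UNIV. xe (f, i) * ye (f, i))"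
    unfolding eq sum.cartesian_product by (rule sum.cong) auto
  also have "\<dots> = emitted v"
    unfolding emitted_def
  proof (rule sum.cong[OF refl])
    fix f assume "f \<in> {f. f \<in> D \<and> t f = v}"
    then have f: "f \<in> D" by simp
    have "xe (f, i) * ye (f, i) = X f * proj (h f, i) * Y f" for i
    proof -
      have "xe (f, i) * ye (f, i) = X f * (proj (h f, i) * proj (h f, i)) * Y f"
        by (simp add: xe_def ye_def mult.assoc)
      then show ?thesis by (simp add: proj_proj h_V f)
    qed
    then have "(\<Sum>i\<in>UNIV. xe (f, i) * ye (f, i)) = X f * P (h f) * Y f"
      by (simp add: UNIV_bool proj_simps left_diff_distrib right_diff_distrib)
    then show "(\<Sum>i\<in>UNIV. xe (f, i) * ye (f, i)) = X f * Y f" by (simp add: X_P f)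
  qed
  finally show ?thesis .
qed

sublocale doubled: leavitt_family "V \<times> UNIV" "D \<times> UNIV" "\<lambda>(e, i). (t e, False)" "\<lambda>(e, i). (h e, i)"
  sc proj xe ye
proof (unfold_locales, goal_cases)
  case 1 show ?case by (simp add: finite_V)
next
  case 2 show ?case by (simp add: finite_D)
next
  case 3 then show ?case by (auto simp: t_V)
next
  case 4 then show ?case by (auto simp: h_V)
next
  case 5 show ?case by (rule sc_add)
next
  case 6 show ?case by (rule sc_mult)
next
  case 7 then show ?case by (auto simp: sc_1_proj)
next
  case 8 then show ?case by (auto simp: sc_proj)
next
  case (9 e a)
  then obtain f i where e: "e = (f, i)" "f \<in> D" by auto
  have "sc a * xe e = X f * (sc a * proj (h f, i))" by (simp add: xe_def e sc_X flip: mult.assoc)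
  also have "\<dots> = xe e * sc a" by (simp add: xe_def e sc_proj h_V mult.assoc)
  finally show ?case .
next
  case (10 e a)
  then obtain f i where e: "e = (f, i)" "f \<in> D" by auto
  have "sc a * ye e = proj (h f, i) * (sc a * Y f)" by (simp add: ye_def e sc_proj h_V flip: mult.assoc)
  also have "\<dots> = ye e * sc a" by (simp add: ye_def e sc_Y mult.assoc)
  finally show ?case .
next
  case 11 then show ?case by (auto simp: proj_proj split: if_split_asm)
next
  case 12 then show ?case by (auto simp: xe_def proj_simps emitted_X simp flip: mult.assoc)
next
  case 13 then show ?case by (auto simp: xe_def proj_proj h_V mult.assoc)
next
  case 14 then show ?case by (auto simp: ye_def proj_proj h_V simp flip: mult.assoc)
next
  case 15 then show ?case by (auto simp: ye_def proj_simps Y_emitted mult.assoc)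
next
  case (16 e f)
  then obtain e' i f' j where e: "e = (e', i)" "e' \<in> D" "f = (f', j)" "f' \<in> D" by auto
  have "ye e * xe f = proj (h e', i) * (Y e' * X f') * proj (h f', j)"
    by (simp add: e ye_def xe_def mult.assoc)
  then show ?case by (auto simp: e CK1 mult.assoc P_proj proj_proj h_V)
next
  case (17 e)
  then obtain e' i where e: "e = (e', i)" by (cases e)
  show ?case using doubled_ck2[of "t e'"] by (simp add: e proj_simps)
qed

lemma in_doubled_R:
  "v \<in> V \<Longrightarrow> P v \<in> doubled.R" "e \<in> D \<Longrightarrow> X e \<in> doubled.R" "e \<in> D \<Longrightarrow> Y e \<in> doubled.R"
proof -
  show "P v \<in> doubled.R" if "v \<in> V"
  proof -
    have "P v = proj (v, False) + proj (v, True)" by (simp add: proj_simps)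
    then show ?thesis using that by (auto intro!: aspan.add doubled.p_in_R)
  qed
  show "X e \<in> doubled.R" if e: "e \<in> D"
  proof -
    have "xe (e, False) + xe (e, True) = X e * P (h e)"
      by (simp add: xe_def proj_simps right_diff_distrib)
    then have "X e = xe (e, False) + xe (e, True)" using X_P[OF e] by simp
    then show ?thesis using e by (auto intro!: aspan.add doubled.x_R)
  qed
  show "Y e \<in> doubled.R" if e: "e \<in> D"
  proof -
    have "ye (e, False) + ye (e, True) = P (h e) * Y e"
      by (simp add: ye_def proj_simps left_diff_distrib)
    then have "Y e = ye (e, False) + ye (e, True)" using P_Y[OF e] by simp
    then show ?thesis using e by (auto intro!: aspan.add doubled.y_R)
  qed
qed

text \<open>Converse to \<open>in_doubled_R\<close>: doubling adds nothing to the subring, as the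
  new generators are built from the old ones.\<close>

lemma doubled_R_least:
  assumes "0 \<in> T" "\<And>a b. a \<in> T \<Longrightarrow> b \<in> T \<Longrightarrow> a + b \<in> T" "\<And>a b. a \<in> T \<Longrightarrow> b \<in> T \<Longrightarrow> a - b \<in> T"
    "\<And>a b. a \<in> T \<Longrightarrow> b \<in> T \<Longrightarrow> a * b \<in> T"
    "\<And>c a. a \<in> T \<Longrightarrow> sc c * a \<in> T" "\<And>v. v \<in> V \<Longrightarrow> P v \<in> T"
    "\<And>e. e \<in> D \<Longrightarrow> X e \<in> T" "\<And>e. e \<in> D \<Longrightarrow> Y e \<in> T"
  shows "doubled.R \<subseteq> T"
proof -
  have sumT: "sum f I \<in> T" if "\<And>i. i \<in> I \<Longrightarrow> f i \<in> T" for f and I :: "'e set"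
    using that by (induction I rule: infinite_finite_induct) (auto simp: assms)
  have "emitted v \<in> T" for v unfolding emitted_def by (rule sumT) (auto intro: assms)
  then have p: "proj (v, i) \<in> T" if "v \<in> V" for v i using that by (cases i) (auto simp: proj_simps intro: assms)
  show ?thesis
  proof (rule doubled.R_least)
    show "proj v \<in> T" if "v \<in> V \<times> UNIV" for v using that p by auto
    show "xe e \<in> T" if "e \<in> D \<times> UNIV" for e
      using that by (auto simp: xe_def intro: assms(4)[OF assms(7) p[OF h_V]])
    show "ye e \<in> T" if "e \<in> D \<times> UNIV" for e
      using that by (auto simp: ye_def intro: assms(4)[OF p[OF h_V] assms(8)])
  qed (use assms in auto)
qed

end

subsection \<open>Quotients of free algebras\<close>

lemma poly_mapping_sum_single:
  fixes f :: "'a \<Rightarrow>\<^sub>0 'b::comm_monoid_add"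
  shows "f = (\<Sum>w\<in>Poly_Mapping.keys f. Poly_Mapping.single w (Poly_Mapping.lookup f w))"
proof (rule poly_mapping_eqI)
  fix k
  have "(\<Sum>w\<in>Poly_Mapping.keys f. Poly_Mapping.lookup f w when w = k) = Poly_Mapping.lookup f k"
    by (simp add: when_def sum.delta' in_keys_iff)
  then show "Poly_Mapping.lookup f k =
      Poly_Mapping.lookup (\<Sum>w\<in>Poly_Mapping.keys f. Poly_Mapping.single w (Poly_Mapping.lookup f w)) k"
    by (simp add: lookup_sum lookup_single)
qed

lemma single_0_commute:
  fixes f :: "'a::monoid_add \<Rightarrow>\<^sub>0 'k::comm_ring_1"
  shows "Poly_Mapping.single 0 c * f = f * Poly_Mapping.single 0 c"
proof -
  have "Poly_Mapping.single 0 c * (\<Sum>w\<in>S. Poly_Mapping.single w (g w))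
      = (\<Sum>w\<in>S. Poly_Mapping.single w (g w)) * Poly_Mapping.single 0 c" for S and g :: "'a \<Rightarrow> 'k"
    by (simp add: sum_distrib_left sum_distrib_right mult_single mult.commute)
  then show ?thesis using poly_mapping_sum_single[of f] by metis
qed

lemma free_algebra_simps [simp]:
  "x \<otimes>\<^bsub>free_algebra X\<^esub> y = x * y" "x \<oplus>\<^bsub>free_algebra X\<^esub> y = x + y"
  "\<zero>\<^bsub>free_algebra X\<^esub> = 0" "c \<odot>\<^bsub>free_algebra X\<^esub> x = Poly_Mapping.single 0 c * x"
  by (simp_all add: free_algebra_def)

abbreviation FC :: "'g set \<Rightarrow> ('g word \<Rightarrow>\<^sub>0 'k::field) set" where
  "FC X \<equiv> carrier (free_algebra X)"

lemma FC_iff: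
  "p \<in> FC X \<longleftrightarrow> (\<forall>w\<in>Poly_Mapping.keys p. letters w \<noteq> [] \<and> set (letters w) \<subseteq> X)"
  by (simp add: free_algebra_def)

lemma FC_closed:
  fixes p q :: "'g word \<Rightarrow>\<^sub>0 'k::field"
  shows "0 \<in> (FC X :: ('g word \<Rightarrow>\<^sub>0 'k) set)"
    "p \<in> FC X \<Longrightarrow> q \<in> FC X \<Longrightarrow> p + q \<in> FC X"
    "p \<in> FC X \<Longrightarrow> - p \<in> FC X"
    "p \<in> FC X \<Longrightarrow> q \<in> FC X \<Longrightarrow> p - q \<in> FC X"
    "p \<in> FC X \<Longrightarrow> q \<in> FC X \<Longrightarrow> p * q \<in> FC X"
    "p \<in> FC X \<Longrightarrow> Poly_Mapping.single 0 c * p \<in> FC X"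
    "g \<in> X \<Longrightarrow> letter g \<in> (FC X :: ('g word \<Rightarrow>\<^sub>0 'k) set)"
proof -
  show "0 \<in> (FC X :: ('g word \<Rightarrow>\<^sub>0 'k) set)" by (simp add: FC_iff)
  show p: "p + q \<in> FC X"
    if "p \<in> FC X" "q \<in> FC X" for p q :: "'g word \<Rightarrow>\<^sub>0 'k"
    using that Poly_Mapping.keys_add[of p q] unfolding FC_iff by blast
  show m: "- p \<in> FC X"
    if "p \<in> FC X" for p :: "'g word \<Rightarrow>\<^sub>0 'k"
    using that by (simp add: FC_iff in_keys_iff)
  show "p - q \<in> FC X"
    if "p \<in> FC X" "q \<in> FC X" for p q :: "'g word \<Rightarrow>\<^sub>0 'k"
    using p[OF that(1) m[OF that(2)]] by simp
  show "p * q \<in> FC X"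
    if pq: "p \<in> FC X" "q \<in> FC X" for p q :: "'g word \<Rightarrow>\<^sub>0 'k"
    unfolding FC_iff
  proof
    fix w assume "w \<in> Poly_Mapping.keys (p * q)"
    with keys_mult[of p q] obtain a b where "w = a + b" "a \<in> Poly_Mapping.keys p" "b \<in> Poly_Mapping.keys q" by blast
    then show "letters w \<noteq> [] \<and> set (letters w) \<subseteq> X" using pq by (auto simp: FC_iff plus_word_def)
  qed
  show "Poly_Mapping.single 0 c * p \<in> FC X"
    if pc: "p \<in> FC X" for p :: "'g word \<Rightarrow>\<^sub>0 'k"
    unfolding FC_iff
  proof
    fix w assume "w \<in> Poly_Mapping.keys (Poly_Mapping.single 0 c * p)"
    with keys_mult[of "Poly_Mapping.single 0 c" p] have "w \<in> Poly_Mapping.keys p" by (auto split: if_splits)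
    then show "letters w \<noteq> [] \<and> set (letters w) \<subseteq> X" using pc by (simp add: FC_iff)
  qed
  show "letter g \<in> (FC X :: ('g word \<Rightarrow>\<^sub>0 'k) set)" if "g \<in> X"
    using that by (simp add: FC_iff letter_def)
qed

lemma m_inv_free_algebra:
  assumes "x \<in> FC X"
  shows "inv\<^bsub>add_monoid (free_algebra X)\<^esub> x = - x"
  unfolding m_inv_def
proof (rule the_equality)
  let ?G = "add_monoid (free_algebra X)"
  show "- x \<in> carrier ?G \<and> x \<otimes>\<^bsub>?G\<^esub> - x = \<one>\<^bsub>?G\<^esub> \<and> - x \<otimes>\<^bsub>?G\<^esub> x = \<one>\<^bsub>?G\<^esub>"
    using FC_closed(3)[OF assms] by simp
qed (auto simp: eq_neg_iff_add_eq_0)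

lemma additive_subgroup_free_algebra:
  "additive_subgroup I (free_algebra X) \<longleftrightarrow> add_closed I \<and> I \<subseteq> FC X"
proof
  let ?G = "add_monoid (free_algebra X)"
  assume "additive_subgroup I (free_algebra X)"
  then have sg: "subgroup I ?G" by (simp add: additive_subgroup_def)
  have sub: "I \<subseteq> FC X" using subgroup.subset[OF sg] by simp
  have "- x \<in> I" if "x \<in> I" for x
    using subgroup.m_inv_closed[OF sg that] by (simp only: m_inv_free_algebra[OF subsetD[OF sub that]])
  moreover have "x + y \<in> I" if "x \<in> I" "y \<in> I" for x y
    using subgroup.m_closed[OF sg that] by simp
  moreover have "0 \<in> I" using subgroup.one_closed[OF sg] by simp
  ultimately have "add_closed I" unfolding add_closed_def by (metis diff_conv_add_uminus)
  with sub show "add_closed I \<and> I \<subseteq> FC X" by blast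
next
  assume "add_closed I \<and> I \<subseteq> FC X"
  then have I: "add_closed I" "I \<subseteq> FC X" by auto
  show "additive_subgroup I (free_algebra X)"
    unfolding additive_subgroup_def
  proof (rule subgroup.intro)
    fix x assume "x \<in> I"
    then show "inv\<^bsub>add_monoid (free_algebra X)\<^esub> x \<in> I"
      using I m_inv_free_algebra[of x X] add_closedD(3)[OF I(1)] by auto
  qed (use I add_closedD[OF I(1)] in auto)
qed

lemma algebra_ideal_free_algebra:
  "algebra_ideal (free_algebra X) I \<longleftrightarrow> add_closed I \<and> I \<subseteq> FC X \<and>
    (\<forall>a\<in>I. \<forall>x\<in>FC X. x * a \<in> I \<and> a * x \<in> I) \<and>
    (\<forall>c. \<forall>a\<in>I. Poly_Mapping.single 0 c * a \<in> I)"
  unfolding algebra_ideal_def two_sided_ideal_def additive_subgroup_free_algebra by simp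

lemma algebra_ideal_gen:
  assumes "S \<subseteq> FC X"
  shows "algebra_ideal (free_algebra X) (gen_algebra_ideal (free_algebra X) S)"
proof -
  have "algebra_ideal (free_algebra X) (FC X)"
    unfolding algebra_ideal_free_algebra
    by (auto simp: add_closed_def FC_closed)
  with assms have sub: "gen_algebra_ideal (free_algebra X) S \<subseteq> FC X"
    unfolding gen_algebra_ideal_def by blast
  moreover have "add_closed (gen_algebra_ideal (free_algebra X) S)"
    unfolding gen_algebra_ideal_def algebra_ideal_free_algebra add_closed_def by blast
  ultimately show ?thesis
    unfolding algebra_ideal_free_algebra[of X "gen_algebra_ideal (free_algebra X) S"]
    by (auto simp: gen_algebra_ideal_def algebra_ideal_free_algebra)
qed

lemma gen_algebra_ideal_superset: "S \<subseteq> gen_algebra_ideal M S"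
  unfolding gen_algebra_ideal_def by blast

locale free_quotient =
  fixes X :: "'g set" and N :: "('g word \<Rightarrow>\<^sub>0 'k::field) set"
  assumes ideal_N: "algebra_ideal (free_algebra X) N"
begin

abbreviation CF :: "('g word \<Rightarrow>\<^sub>0 'k) set" where "CF \<equiv> FC X"

definition cs :: "('g word \<Rightarrow>\<^sub>0 'k) \<Rightarrow> ('g word \<Rightarrow>\<^sub>0 'k) set" where
  "cs p = (\<lambda>n. n + p) ` N"

abbreviation Q :: "('k, ('g word \<Rightarrow>\<^sub>0 'k) set) module" where
  "Q \<equiv> quot_algebra (free_algebra X) N"

lemma N_closed: "add_closed N" "N \<subseteq> CF"
  using ideal_N unfolding algebra_ideal_free_algebra by blast+

lemma N_mult: "n \<in> N \<Longrightarrow> p \<in> CF \<Longrightarrow> p * n \<in> N" "n \<in> N \<Longrightarrow> p \<in> CF \<Longrightarrow> n * p \<in> N"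
  "n \<in> N \<Longrightarrow> Poly_Mapping.single 0 c * n \<in> N"
  using ideal_N unfolding algebra_ideal_free_algebra by blast+

lemma CF_idealizer: "p \<in> CF \<Longrightarrow> p \<in> idealizer N"
  by (rule idealizerI) (simp add: N_mult)

lemma scalar_idealizer: "Poly_Mapping.single 0 c \<in> idealizer N"
  by (rule idealizerI) (simp add: N_mult flip: single_0_commute)

lemma coset_eq: "N +>\<^bsub>free_algebra X\<^esub> p = cs p"
  by (auto simp: a_r_coset_def r_coset_def cs_def)

lemma cs_eq_iff: "cs p = cs q \<longleftrightarrow> p - q \<in> N"
proof
  assume "cs p = cs q"
  moreover have "0 + p \<in> cs p" unfolding cs_def using add_closedD(1)[OF N_closed(1)] by blast
  ultimately obtain n where "n \<in> N" "p = n + q" unfolding cs_def by auto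
  then show "p - q \<in> N" by simp
next
  assume d: "p - q \<in> N"
  have "n + p \<in> cs q" if "n \<in> N" for n
  proof -
    have "n + p = (n + (p - q)) + q" by simp
    with add_closedD(4)[OF N_closed(1) that d] show ?thesis unfolding cs_def by blast
  qed
  moreover have "n + q \<in> cs p" if "n \<in> N" for n
  proof -
    have "n + q = (n - (p - q)) + p" by simp
    with add_closedD(2)[OF N_closed(1) that d] show ?thesis unfolding cs_def by blast
  qed
  ultimately show "cs p = cs q" unfolding cs_def by blast
qed

lemma Q_carrier: "carrier Q = cs ` CF"
  by (auto simp: quot_algebra_def ring.defs module.defs FactRing_def A_RCOSETS_def RCOSETS_def
      r_coset_def cs_def)

lemma Q_zero: "\<zero>\<^bsub>Q\<^esub> = cs 0"
  by (simp add: quot_algebra_def ring.defs module.defs FactRing_def cs_def)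

lemma Q_add: "cs p \<oplus>\<^bsub>Q\<^esub> cs q = cs (p + q)"
proof -
  have "cs p \<oplus>\<^bsub>Q\<^esub> cs q = {a + b | a b. a \<in> cs p \<and> b \<in> cs q}"
    by (auto simp: quot_algebra_def ring.defs module.defs FactRing_def set_add_def set_mult_def)
  also have "\<dots> = cs (p + q)"
  proof safe
    fix a b assume "a \<in> cs p" "b \<in> cs q"
    then obtain m n where mn: "m \<in> N" "n \<in> N" "a = m + p" "b = n + q" unfolding cs_def by blast
    then have "a + b = (m + n) + (p + q)" by simp
    with add_closedD(4)[OF N_closed(1) mn(1,2)] show "a + b \<in> cs (p + q)" unfolding cs_def by blast
  next
    fix a assume "a \<in> cs (p + q)"
    then obtain n where "n \<in> N" "a = n + (p + q)" unfolding cs_def by blast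
    then have "a = (n + p) + (0 + q)" "n + p \<in> cs p" "0 + q \<in> cs q"
      using add_closedD(1)[OF N_closed(1)] unfolding cs_def by auto
    then show "\<exists>c d. a = c + d \<and> c \<in> cs p \<and> d \<in> cs q" by blast
  qed
  finally show ?thesis .
qed

text \<open>Representatives must lie in \<open>CF\<close>, because \<open>N\<close> is an ideal of
  the free algebra on \<open>X\<close> and not of the ring of all finitely supported functions on
  words.\<close>

lemma Q_mult: "p \<in> CF \<Longrightarrow> q \<in> CF \<Longrightarrow> cs p \<otimes>\<^bsub>Q\<^esub> cs q = cs (p * q)"
proof -
  assume pq: "p \<in> CF" "q \<in> CF"
  have "cs p \<otimes>\<^bsub>Q\<^esub> cs q = (\<Union>a\<in>cs p. \<Union>b\<in>cs q. cs (a * b))"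
    by (simp add: quot_algebra_def ring.defs module.defs FactRing_def rcoset_mult_def coset_eq)
  also have "cs (a * b) = cs (p * q)" if "a \<in> cs p" "b \<in> cs q" for a b
  proof -
    from that obtain m n where mn: "m \<in> N" "n \<in> N" "a = m + p" "b = n + q" unfolding cs_def by blast
    have "a * b - p * q = m * (n + q) + p * n" by (simp add: mn(3,4) algebra_simps)
    also have "\<dots> \<in> N"
      using mn(1,2) pq N_closed(2) by (intro add_closedD(4)[OF N_closed(1)] N_mult FC_closed) auto
    finally show ?thesis by (simp add: cs_eq_iff)
  qed
  moreover have "cs p \<noteq> {}" "cs q \<noteq> {}" using add_closedD(1)[OF N_closed(1)] by (auto simp: cs_def)
  ultimately show ?thesis by auto
qed

lemma Q_ideal:
  assumes A: "two_sided_ideal Q A"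
  shows "a \<in> A \<Longrightarrow> \<exists>p\<in>CF. a = cs p" "cs 0 \<in> A" "cs p \<in> A \<Longrightarrow> cs q \<in> A \<Longrightarrow> cs (p + q) \<in> A"
    "p \<in> CF \<Longrightarrow> cs p \<in> A \<Longrightarrow> cs (- p) \<in> A"
    "p \<in> CF \<Longrightarrow> q \<in> CF \<Longrightarrow> cs p \<in> A \<Longrightarrow> cs (p * q) \<in> A"
    "p \<in> CF \<Longrightarrow> q \<in> CF \<Longrightarrow> cs p \<in> A \<Longrightarrow> cs (q * p) \<in> A"
proof -
  let ?G = "add_monoid Q"
  have sg: "subgroup A ?G" using A by (simp add: two_sided_ideal_def additive_subgroup_def)
  show "\<exists>p\<in>CF. a = cs p" if "a \<in> A" using subgroup.subset[OF sg] that Q_carrier by auto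
  show "cs 0 \<in> A" using subgroup.one_closed[OF sg] by (simp add: Q_zero)
  show "cs (p + q) \<in> A" if "cs p \<in> A" "cs q \<in> A" for p q
    using subgroup.m_closed[OF sg that] by (simp add: Q_add)
  show "cs (- p) \<in> A" if p: "p \<in> CF" "cs p \<in> A" for p
  proof -
    have "inv\<^bsub>?G\<^esub> (cs p) = cs (- p)"
      unfolding m_inv_def
    proof (rule the_equality)
      show "cs (- p) \<in> carrier ?G \<and> cs p \<otimes>\<^bsub>?G\<^esub> cs (- p) = \<one>\<^bsub>?G\<^esub> \<and> cs (- p) \<otimes>\<^bsub>?G\<^esub> cs p = \<one>\<^bsub>?G\<^esub>"
        using FC_closed(3)[OF p(1)] by (simp add: Q_carrier Q_add Q_zero)
      fix b assume "b \<in> carrier ?G \<and> cs p \<otimes>\<^bsub>?G\<^esub> b = \<one>\<^bsub>?G\<^esub> \<and> b \<otimes>\<^bsub>?G\<^esub> cs p = \<one>\<^bsub>?G\<^esub>"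
      then obtain q where "b = cs q" "cs (q + p) = cs 0" by (auto simp: Q_carrier Q_add Q_zero)
      then show "b = cs (- p)" by (simp add: cs_eq_iff)
    qed
    then show ?thesis using subgroup.m_inv_closed[OF sg p(2)] by simp
  qed
  show "cs (p * q) \<in> A" "cs (q * p) \<in> A" if pq: "p \<in> CF" "q \<in> CF" "cs p \<in> A" for p q
  proof -
    have "cs q \<in> carrier Q" using pq(2) by (simp add: Q_carrier)
    with A pq(3) have "cs p \<otimes>\<^bsub>Q\<^esub> cs q \<in> A" "cs q \<otimes>\<^bsub>Q\<^esub> cs p \<in> A" unfolding two_sided_ideal_def by blast+
    then show "cs (p * q) \<in> A" "cs (q * p) \<in> A" using pq by (simp_all add: Q_mult)
  qed
qed

section \<open>Transfer between cosets and the type-class ring\<close>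

abbreviation qm :: "('g word \<Rightarrow>\<^sub>0 'k) \<Rightarrow> ('g word \<Rightarrow>\<^sub>0 'k) uq" where "qm \<equiv> qmap N"

text \<open>The quotient occurs in two models, as cosets \<open>cs p\<close> and as elements
  \<open>qm p\<close>, which identify the same \<open>p\<close> in \<open>CF\<close>. Ideals are
  carried from the first to the second by \<open>lift\<close>.\<close>

definition lift :: "('g word \<Rightarrow>\<^sub>0 'k) set set \<Rightarrow> ('g word \<Rightarrow>\<^sub>0 'k) uq set" where
  "lift A = qm ` {p \<in> CF. cs p \<in> A}"

lemma qm_hom:
  assumes "p \<in> CF" "q \<in> CF"
  shows "qm (p + q) = qm p + qm q" "qm (p - q) = qm p - qm q" "qm (p * q) = qm p * qm q"
  using qmap_hom(1,2,4)[OF N_closed(1) CF_idealizer CF_idealizer] assms by blast+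

lemma qm_scalar: "p \<in> CF \<Longrightarrow> qm (Poly_Mapping.single 0 c * p) = qm (Poly_Mapping.single 0 c) * qm p"
  using qmap_hom(4)[OF N_closed(1) scalar_idealizer CF_idealizer] by blast

lemma qm_eq_iff: "p \<in> CF \<Longrightarrow> q \<in> CF \<Longrightarrow> qm p = qm q \<longleftrightarrow> cs p = cs q"
  using qmap_eq_iff[OF N_closed(1) CF_idealizer CF_idealizer] by (simp add: cs_eq_iff)

lemma lift_iff: "p \<in> CF \<Longrightarrow> qm p \<in> lift A \<longleftrightarrow> cs p \<in> A"
  unfolding lift_def by (auto simp: qm_eq_iff)

text \<open>Products computed in a finite part, with ideals \<open>A'\<close> and \<open>B'\<close>
  that are only subsets of the lifted ones, give products in the whole algebra.\<close>

lemma lift_ideal_prod: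
  assumes "z \<in> aprod A' B'" "A' \<subseteq> lift A" "B' \<subseteq> lift B" "cs 0 \<in> A" "cs 0 \<in> B"
  shows "\<exists>p\<in>CF. z = qm p \<and> cs p \<in> ideal_prod Q A B"
  using assms(1) unfolding aprod_def
proof induction
  case zero
  \<comment> \<open>Elements of \<open>ideal_prod\<close> are built from products and sums, so zero
    is obtained as a product of zeros.\<close>
  have "cs 0 \<otimes>\<^bsub>Q\<^esub> cs 0 \<in> ideal_prod Q A B" using assms(4,5) by (rule ideal_prod.prod)
  then show ?case using Q_mult[of 0 0] FC_closed(1) by (intro bexI[of _ 0]) (auto simp: qmap_0)
next
  case (base z)
  then obtain p q where pq: "p \<in> CF" "q \<in> CF" "cs p \<in> A" "cs q \<in> B" "z = qm p * qm q"
    using assms(2,3) unfolding lift_def by blast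
  with ideal_prod.prod[OF pq(3,4), of Q] show ?case
    by (intro bexI[of _ "p * q"]) (auto simp: Q_mult qm_hom FC_closed)
next
  case (add z z')
  then obtain p q where "p \<in> CF" "q \<in> CF" "z = qm p" "z' = qm q"
    "cs p \<in> ideal_prod Q A B" "cs q \<in> ideal_prod Q A B" by blast
  with ideal_prod.sum[of "cs p" Q A B "cs q"] show ?case
    by (intro bexI[of _ "p + q"]) (auto simp: Q_add qm_hom FC_closed)
qed

lemma lift_closed:
  assumes A: "two_sided_ideal Q A"
  shows "0 \<in> lift A" "a \<in> lift A \<Longrightarrow> b \<in> lift A \<Longrightarrow> a - b \<in> lift A"
    "a \<in> lift A \<Longrightarrow> b \<in> qm ` CF \<Longrightarrow> a * b \<in> lift A" "a \<in> lift A \<Longrightarrow> b \<in> qm ` CF \<Longrightarrow> b * a \<in> lift A"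
proof -
  note I = Q_ideal[OF A]
  show "0 \<in> lift A" using lift_iff[OF FC_closed(1), of A] I(2) by (simp add: qmap_0)
  show "a - b \<in> lift A" if "a \<in> lift A" "b \<in> lift A" for a b
  proof -
    from that obtain p q where pq: "p \<in> CF" "q \<in> CF" "cs p \<in> A" "cs q \<in> A" "a = qm p" "b = qm q"
      unfolding lift_def by blast
    have "cs (p - q) \<in> A" using I(3)[OF pq(3) I(4)[OF pq(2,4)]] by simp
    then have "qm (p - q) \<in> lift A" using lift_iff[OF FC_closed(4)[OF pq(1,2)]] by simp
    then show ?thesis using qm_hom(2)[OF pq(1,2)] pq(5,6) by simp
  qed
  show "a * b \<in> lift A" "b * a \<in> lift A" if "a \<in> lift A" "b \<in> qm ` CF" for a b
  proof -
    from that obtain p q where pq: "p \<in> CF" "q \<in> CF" "cs p \<in> A" "a = qm p" "b = qm q"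
      unfolding lift_def by blast
    have "qm (p * q) \<in> lift A"
      using lift_iff[OF FC_closed(5)[OF pq(1,2)]] I(5)[OF pq(1,2,3)] by simp
    then show "a * b \<in> lift A" using qm_hom(3)[OF pq(1,2)] pq(4,5) by simp
    have "qm (q * p) \<in> lift A"
      using lift_iff[OF FC_closed(5)[OF pq(2,1)]] I(6)[OF pq(1,2,3)] by simp
    then show "b * a \<in> lift A" using qm_hom(3)[OF pq(2,1)] pq(4,5) by simp
  qed
qed

end

subsection \<open>Leavitt path algebras\<close>

lemma if_mem: "a \<in> S \<Longrightarrow> b \<in> S \<Longrightarrow> (if c then a else b) \<in> S"
  by simp

lemma leavitt_relations_subset:
  fixes E :: "('v, 'e) pre_digraph"
  assumes "wf_digraph E"
  shows "(leavitt_relations E :: (('v, 'e) generator word \<Rightarrow>\<^sub>0 'k::field) set)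
    \<subseteq> carrier (free_algebra (leavitt_generators E))"
proof -
  let ?C = "carrier (free_algebra (leavitt_generators E) :: ('k, ('v, 'e) generator word \<Rightarrow>\<^sub>0 'k) module)"
  note closed_mon = FC_closed[where X = "leavitt_generators E" and 'k = 'k]
  have v: "vtx v \<in> ?C" if "v \<in> verts E" for v using that by (intro closed_mon) (simp add: leavitt_generators_def)
  have e: "edg e \<in> ?C" "gst e \<in> ?C" if "e \<in> arcs E" for e
    using that by (intro closed_mon(7), simp add: leavitt_generators_def)+
  have ht: "head E e \<in> verts E" "tail E e \<in> verts E" if "e \<in> arcs E" for e
    using assms that by (auto simp: wf_digraph_def)
  have s: "sum f I \<in> ?C" if "\<And>i. i \<in> I \<Longrightarrow> f i \<in> ?C" for f and I :: "'e set"
    using that by (induction I rule: infinite_finite_induct) (auto intro: closed_mon)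
  have ck2: "vtx v - (\<Sum>e\<in>out_arcs E v. edg e * gst e) \<in> ?C" if "regular_vertex E v" for v
    using that by (intro closed_mon(4) v s closed_mon(5) e) (auto simp: regular_vertex_def)
  show ?thesis
    unfolding leavitt_relations_def
  proof (intro Un_least subsetI; elim CollectE exE conjE; hypsubst)
    show "vtx u * vtx w - (if u = w then vtx u else 0) \<in> ?C" if "u \<in> verts E" "w \<in> verts E" for u w
      by (intro closed_mon(4,5,1) if_mem v that)
    show "gst e * edg f - (if e = f then vtx (head E e) else 0) \<in> ?C" if "e \<in> arcs E" "f \<in> arcs E" for e f
      by (intro closed_mon(4,5,1) if_mem v e ht that)
  qed (simp_all only: closed_mon(4,5) v e ht ck2)
qed

text \<open>The parameter \<open>K\<close> pins down the coefficient field, which does not occur in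
  the type of \<open>E\<close>.\<close>

locale leavitt_quotient =
  fixes E :: "('v, 'e) pre_digraph" and K :: "'k::field itself"
  assumes wf: "wf_digraph E"

sublocale leavitt_quotient \<subseteq> free_quotient "leavitt_generators E"
  "gen_algebra_ideal (free_algebra (leavitt_generators E)) (leavitt_relations E)
    :: (('v, 'e) generator word \<Rightarrow>\<^sub>0 'k) set"
  by unfold_locales (rule algebra_ideal_gen[OF leavitt_relations_subset[OF wf]])

context leavitt_quotient
begin

abbreviation P where "P v \<equiv> qm (vtx v)"
abbreviation X where "X e \<equiv> qm (edg e)"
abbreviation Y where "Y e \<equiv> qm (gst e)"
abbreviation sc where "sc c \<equiv> qm (Poly_Mapping.single 0 c)"

lemma letter_CF:
  "v \<in> verts E \<Longrightarrow> vtx v \<in> CF" "e \<in> arcs E \<Longrightarrow> edg e \<in> CF" "e \<in> arcs E \<Longrightarrow> gst e \<in> CF"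
  by (rule FC_closed(7), simp add: leavitt_generators_def)+

lemma relation_mult:
  assumes "p * q - t \<in> leavitt_relations E" "p \<in> CF" "q \<in> CF" "t \<in> CF"
  shows "qm p * qm q = qm t"
proof -
  have "p * q - t \<in> gen_algebra_ideal (free_algebra (leavitt_generators E)) (leavitt_relations E)"
    by (rule subsetD[OF gen_algebra_ideal_superset assms(1)])
  then show ?thesis
    unfolding qm_hom(3)[OF assms(2,3), symmetric]
      qm_eq_iff[OF FC_closed(5)[OF assms(2,3)] assms(4)] cs_eq_iff .
qed

lemma sc_comm: "p \<in> CF \<Longrightarrow> sc c * qm p = qm p * sc c"
  unfolding qm_scalar[symmetric] qmap_hom(4)[OF N_closed(1) CF_idealizer scalar_idealizer, symmetric]
    single_0_commute ..

text \<open>CK2 is not claimed, since \<open>D\<close> may contain only some of the edges leaving a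
  vertex.\<close>

lemma cohn_family_leavitt:
  assumes "finite V" "finite D" "V \<subseteq> verts E" "D \<subseteq> arcs E" "tail E ` D \<subseteq> V" "head E ` D \<subseteq> V"
  shows "cohn_family V D (tail E) (head E) sc P X Y"
proof (unfold_locales, goal_cases)
  case 1 show ?case by fact
next
  case 2 show ?case by fact
next
  case 3 then show ?case using assms by blast
next
  case 4 then show ?case using assms by blast
next
  case (5 a b)
  show ?case using qmap_hom(1)[OF N_closed(1) scalar_idealizer scalar_idealizer] by (simp add: single_add)
next
  case (6 a b)
  have "Poly_Mapping.single 0 (a * b) = Poly_Mapping.single (0 :: ('v, 'e) generator word) a * Poly_Mapping.single 0 b"
    by (simp add: mult_single)
  then show ?case using qmap_hom(4)[OF N_closed(1) scalar_idealizer scalar_idealizer, of a b] by simp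
next
  case (7 v)
  then have "vtx v \<in> CF" using letter_CF assms by blast
  then show ?case using qm_scalar[of "vtx v" 1] by simp
next
  case (8 v)
  then have "vtx v \<in> CF" using letter_CF assms by blast
  then show ?case by (rule sc_comm)
next
  case (9 e)
  then have "edg e \<in> CF" using letter_CF assms by blast
  then show ?case by (rule sc_comm)
next
  case (10 e)
  then have "gst e \<in> CF" using letter_CF assms by blast
  then show ?case by (rule sc_comm)
next
  case (11 v w)
  then have v: "v \<in> verts E" "w \<in> verts E" using assms by auto
  have "vtx v * vtx w - (if v = w then vtx v else 0) \<in> leavitt_relations E"
    using v unfolding leavitt_relations_def by blast
  moreover have "(if v = w then vtx v else 0) \<in> CF"
    by (intro if_mem letter_CF(1) v FC_closed(1))
  ultimately have "P v * P w = qm (if v = w then vtx v else 0)"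
    by (rule relation_mult[OF _ letter_CF(1)[OF v(1)] letter_CF(1)[OF v(2)]])
  then show ?case by (simp add: qmap_0)
next
  case (12 e)
  then have e: "e \<in> arcs E" "tail E e \<in> verts E" using assms by auto
  show ?case
  proof (rule relation_mult)
    show "vtx (tail E e) * edg e - edg e \<in> leavitt_relations E"
      using e unfolding leavitt_relations_def by blast
  qed (intro letter_CF e)+
next
  case (13 e)
  then have e: "e \<in> arcs E" "head E e \<in> verts E" using assms by auto
  show ?case
  proof (rule relation_mult)
    show "edg e * vtx (head E e) - edg e \<in> leavitt_relations E"
      using e unfolding leavitt_relations_def by blast
  qed (intro letter_CF e)+
next
  case (14 e)
  then have e: "e \<in> arcs E" "head E e \<in> verts E" using assms by auto
  show ?case
  proof (rule relation_mult)
    show "vtx (head E e) * gst e - gst e \<in> leavitt_relations E"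
      using e unfolding leavitt_relations_def by blast
  qed (intro letter_CF e)+
next
  case (15 e)
  then have e: "e \<in> arcs E" "tail E e \<in> verts E" using assms by auto
  show ?case
  proof (rule relation_mult)
    show "gst e * vtx (tail E e) - gst e \<in> leavitt_relations E"
      using e unfolding leavitt_relations_def by blast
  qed (intro letter_CF e)+
next
  case (16 e f)
  then have e: "e \<in> arcs E" "f \<in> arcs E" "head E e \<in> verts E" using assms by auto
  have "gst e * edg f - (if e = f then vtx (head E e) else 0) \<in> leavitt_relations E"
    using e unfolding leavitt_relations_def by blast
  moreover have "(if e = f then vtx (head E e) else 0) \<in> CF"
    by (intro if_mem letter_CF(1) e FC_closed(1))
  ultimately have "Y e * X f = qm (if e = f then vtx (head E e) else 0)"
    by (rule relation_mult[OF _ letter_CF(3)[OF e(1)] letter_CF(2)[OF e(2)]])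
  then show ?case by (simp add: qmap_0)
qed

section \<open>Reduction to finite subgraphs\<close>

definition word_letters :: "(('v, 'e) generator word \<Rightarrow>\<^sub>0 'k) \<Rightarrow> ('v, 'e) generator set" where
  "word_letters p = (\<Union>w\<in>Poly_Mapping.keys p. set (letters w))"

text \<open>\<open>T\<close> need not contain a unit, so the induction stops at one-letter
  words.\<close>

lemma qm_single:
  assumes "gs \<noteq> []" "set gs \<subseteq> leavitt_generators E"
    "0 \<in> T" "\<And>a b. a \<in> T \<Longrightarrow> b \<in> T \<Longrightarrow> a * b \<in> T" "\<And>c a. a \<in> T \<Longrightarrow> sc c * a \<in> T"
    "\<And>g. g \<in> set gs \<Longrightarrow> qm (letter g) \<in> T"
  shows "qm (Poly_Mapping.single (Word gs) c) \<in> T"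
  using assms(1,2,6)
proof (induction gs arbitrary: c)
  case (Cons g gs)
  have g: "letter g \<in> CF" "qm (letter g) \<in> T" using Cons.prems by (auto intro: FC_closed(7))
  show ?case
  proof (cases "gs = []")
    case True
    have "Poly_Mapping.single (Word [g]) c = Poly_Mapping.single 0 c * letter g"
      by (simp add: letter_def mult_single)
    with qm_scalar[OF g(1), of c] assms(5)[OF g(2)] True show ?thesis by simp
  next
    case False
    have "Poly_Mapping.single (Word (g # gs)) c = letter g * Poly_Mapping.single (Word gs) c"
      by (simp add: letter_def mult_single plus_word_def)
    moreover have "Poly_Mapping.single (Word gs) c \<in> CF"
      using False Cons.prems(2) by (auto simp: FC_iff)
    ultimately show ?thesis using qm_hom(3)[OF g(1)] assms(4)[OF g(2)] Cons False by simp
  qed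
qed simp

lemma qm_mem:
  assumes p: "p \<in> CF"
    and T: "0 \<in> T" "\<And>a b. a \<in> T \<Longrightarrow> b \<in> T \<Longrightarrow> a + b \<in> T" "\<And>a b. a \<in> T \<Longrightarrow> b \<in> T \<Longrightarrow> a * b \<in> T"
      "\<And>c a. a \<in> T \<Longrightarrow> sc c * a \<in> T" "\<And>g. g \<in> word_letters p \<Longrightarrow> qm (letter g) \<in> T"
  shows "qm p \<in> T"
proof -
  have "(\<Sum>w\<in>S. Poly_Mapping.single w (f w)) \<in> CF \<and> qm (\<Sum>w\<in>S. Poly_Mapping.single w (f w)) \<in> T"
    if "finite S" "S \<subseteq> Poly_Mapping.keys p" for S f
    using that
  proof induction
    case empty
    then show ?case by (simp add: T(1) qmap_0 FC_closed)
  next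
    case (insert w S)
    then have w: "letters w \<noteq> []" "set (letters w) \<subseteq> leavitt_generators E" "set (letters w) \<subseteq> word_letters p"
      using p by (auto simp: FC_iff word_letters_def)
    have "qm (Poly_Mapping.single w (f w)) \<in> T"
      using qm_single[OF w(1,2) T(1,3,4)] T(5) w(3) by auto
    moreover have "Poly_Mapping.single w (f w) \<in> CF" using w(1,2) by (simp add: FC_iff)
    ultimately show ?case using insert T(2) by (simp add: qm_hom FC_closed)
  qed
  from this[of "Poly_Mapping.keys p" "Poly_Mapping.lookup p"] show ?thesis
    using poly_mapping_sum_single[of p] by simp
qed

lemma finite_subfamily:
  assumes p: "p \<in> CF" and q: "q \<in> CF"
  obtains V D where "cohn_family V D (tail E) (head E) sc P X Y" "V \<subseteq> verts E" "D \<subseteq> arcs E"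
    "word_letters p \<union> word_letters q \<subseteq> Vertex ` V \<union> Edge ` D \<union> Ghost ` D"
proof -
  let ?G = "word_letters p \<union> word_letters q"
  have G: "?G \<subseteq> leavitt_generators E" using p q by (auto simp: word_letters_def FC_iff)
  have finG: "finite ?G" by (simp add: word_letters_def)
  define D where "D = Edge -` ?G \<union> Ghost -` ?G"
  define V where "V = Vertex -` ?G \<union> tail E ` D \<union> head E ` D"
  have fin: "finite D" "finite V" using finG by (simp_all add: D_def V_def finite_vimageI inj_on_def)
  have DE: "D \<subseteq> arcs E" using G by (auto simp: D_def leavitt_generators_def)
  have VE: "V \<subseteq> verts E"
    using G DE wf by (auto simp: V_def leavitt_generators_def wf_digraph_def)
  have "g \<in> Vertex ` V \<union> Edge ` D \<union> Ghost ` D" if "g \<in> ?G" for g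
    using that by (cases g) (auto simp: V_def D_def)
  then have "?G \<subseteq> Vertex ` V \<union> Edge ` D \<union> Ghost ` D" by blast
  moreover have "cohn_family V D (tail E) (head E) sc P X Y"
    by (rule cohn_family_leavitt[OF fin(2,1) VE DE]) (auto simp: V_def)
  ultimately show ?thesis using VE DE that by blast
qed

text \<open>A statement about one product involves only two elements, so one finite subfamily
  suffices. Membership in a product of ideals persists in the larger ring, which makes the passage
  to the directed union immediate.\<close>

lemma product_mem:
  assumes A: "two_sided_ideal Q A" and B: "two_sided_ideal Q B"
    and p: "p \<in> CF" "cs p \<in> A" and q: "q \<in> CF" "cs q \<in> B"
  shows "cs (p * q) \<in> ideal_prod Q B A" "cs (p * q) \<in> ideal_prod Q (A <+>\<^bsub>Q\<^esub> B) (A \<inter> B)"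
proof -
  obtain V D where c: "cohn_family V D (tail E) (head E) sc P X Y" and VD: "V \<subseteq> verts E" "D \<subseteq> arcs E"
    and G: "word_letters p \<union> word_letters q \<subseteq> Vertex ` V \<union> Edge ` D \<union> Ghost ` D"
    by (rule finite_subfamily[OF p(1) q(1)])
  interpret c: cohn_family V D "tail E" "head E" sc P X Y by (rule c)
  have mem: "qm (letter g) \<in> c.doubled.R" if "g \<in> word_letters p \<union> word_letters q" for g
    using subsetD[OF G that] c.in_doubled_R by blast
  have R: "qm p \<in> c.doubled.R" "qm q \<in> c.doubled.R"
    by (rule qm_mem[OF p(1) aspan.zero aspan.add c.doubled.R_mult c.doubled.sc_Sp mem]; simp)
      (rule qm_mem[OF q(1) aspan.zero aspan.add c.doubled.R_mult c.doubled.sc_Sp mem]; simp)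
  have RC: "c.doubled.R \<subseteq> qm ` CF"
  proof (rule c.doubled_R_least)
    show "0 \<in> qm ` CF" using FC_closed(1) qmap_0 by (metis image_eqI)
    show "a + b \<in> qm ` CF" "a - b \<in> qm ` CF" "a * b \<in> qm ` CF" if ab: "a \<in> qm ` CF" "b \<in> qm ` CF" for a b
    proof -
      from ab obtain u v where "u \<in> CF" "v \<in> CF" "a = qm u" "b = qm v" by blast
      then have "a + b = qm (u + v)" "a - b = qm (u - v)" "a * b = qm (u * v)"
        "u + v \<in> CF" "u - v \<in> CF" "u * v \<in> CF"
        by (simp_all only: qm_hom FC_closed)
      then show "a + b \<in> qm ` CF" "a - b \<in> qm ` CF" "a * b \<in> qm ` CF"
        by (simp_all only: imageI)
    qed
    show "sc d * a \<in> qm ` CF" if "a \<in> qm ` CF" for d a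
    proof -
      from that obtain u where "u \<in> CF" "a = qm u" by blast
      then have "sc d * a = qm (Poly_Mapping.single 0 d * u)" "Poly_Mapping.single 0 d * u \<in> CF"
        by (simp_all only: qm_scalar FC_closed)
      then show ?thesis by (simp only: imageI)
    qed
    show "P v \<in> qm ` CF" if "v \<in> V" for v by (intro imageI letter_CF subsetD[OF VD(1)] that)
    show "X e \<in> qm ` CF" "Y e \<in> qm ` CF" if "e \<in> D" for e
      by (intro imageI letter_CF subsetD[OF VD(2)] that)+
  qed
  have ideal: "c.doubled.rideal (lift I \<inter> c.doubled.R)" if I: "two_sided_ideal Q I" for I
    unfolding c.doubled.rideal_def
  proof (intro conjI ballI)
    show "add_closed (lift I \<inter> c.doubled.R)"
      unfolding add_closed_def
      by (simp add: lift_closed(1,2)[OF I] add_closedD(1,2)[OF c.doubled.add_closed_Sp])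
    show "lift I \<inter> c.doubled.R \<subseteq> c.doubled.R" by blast
    fix a b assume "a \<in> lift I \<inter> c.doubled.R" and b: "b \<in> c.doubled.R"
    then have a: "a \<in> lift I" "a \<in> c.doubled.R" by simp_all
    from b RC have b': "b \<in> qm ` CF" by (rule rev_subsetD)
    show "a * b \<in> lift I \<inter> c.doubled.R"
      by (intro IntI lift_closed(3)[OF I a(1) b'] c.doubled.R_mult[OF a(2) b])
    show "b * a \<in> lift I \<inter> c.doubled.R"
      by (intro IntI lift_closed(4)[OF I a(1) b'] c.doubled.R_mult[OF b a(2)])
  qed
  let ?A = "lift A \<inter> c.doubled.R" and ?B = "lift B \<inter> c.doubled.R"
  have pA: "qm p \<in> ?A" and qB: "qm q \<in> ?B"
    using R p q by (simp_all only: Int_iff lift_iff simp_thms)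
  have pq: "p * q \<in> CF" "qm (p * q) = qm p * qm q"
    by (rule FC_closed(5)[OF p(1) q(1)], rule qm_hom(3)[OF p(1) q(1)])
  have descend: "cs (p * q) \<in> ideal_prod Q S T"
    if "qm p * qm q \<in> aprod S' T'" "S' \<subseteq> lift S" "T' \<subseteq> lift T" "cs 0 \<in> S" "cs 0 \<in> T" for S T S' T'
  proof -
    from lift_ideal_prod[OF that] obtain z where z: "z \<in> CF" "qm p * qm q = qm z" "cs z \<in> ideal_prod Q S T" by blast
    have "cs (p * q) = cs z" using qm_eq_iff[OF pq(1) z(1)] unfolding pq(2) z(2) by blast
    with z(3) show ?thesis by (simp only:)
  qed
  note z = Q_ideal(2)[OF A] Q_ideal(2)[OF B]
  show "cs (p * q) \<in> ideal_prod Q B A"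
    using c.doubled.aprod_commute[OF ideal[OF A] ideal[OF B] pA qB]
    by (rule descend) (simp_all only: Int_lower1 z)
  have sum: "cs (a + b) \<in> A <+>\<^bsub>Q\<^esub> B" if "cs a \<in> A" "cs b \<in> B" for a b
    using that Q_add[of a b] by (auto simp: set_add_def set_mult_def)
  show "cs (p * q) \<in> ideal_prod Q (A <+>\<^bsub>Q\<^esub> B) (A \<inter> B)"
  proof (rule descend[OF c.doubled.aprod_sum_inter[OF ideal[OF A] ideal[OF B] pA qB]])
    show "{a + b | a b. a \<in> ?A \<and> b \<in> ?B} \<subseteq> lift (A <+>\<^bsub>Q\<^esub> B)"
    proof safe
      fix a b assume "a \<in> lift A" "b \<in> lift B"
      then obtain u v where "u \<in> CF" "v \<in> CF" "cs u \<in> A" "cs v \<in> B" "a = qm u" "b = qm v" unfolding lift_def by blast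
      then have "a + b = qm (u + v)" "u + v \<in> CF" "cs (u + v) \<in> A <+>\<^bsub>Q\<^esub> B"
        by (simp_all only: qm_hom FC_closed sum)
      then show "a + b \<in> lift (A <+>\<^bsub>Q\<^esub> B)" by (simp only: lift_iff)
    qed
    show "?A \<inter> ?B \<subseteq> lift (A \<inter> B)"
    proof
      fix a assume "a \<in> ?A \<inter> ?B"
      then have l: "a \<in> lift A" "a \<in> lift B" by simp_all
      from l(1) obtain u where u: "u \<in> CF" "a = qm u" "cs u \<in> A" unfolding lift_def by blast
      with l(2) have "cs u \<in> B" by (simp only: lift_iff)
      with u show "a \<in> lift (A \<inter> B)" by (simp only: lift_iff Int_iff simp_thms)
    qed
    show "cs 0 \<in> A <+>\<^bsub>Q\<^esub> B" using sum[of 0 0] z by simp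
    show "cs 0 \<in> A \<inter> B" using z by simp
  qed
qed

section \<open>The identity in the Leavitt path algebra\<close>

lemma ideal_prod_subset:
  assumes "\<And>i j. i \<in> I \<Longrightarrow> j \<in> J \<Longrightarrow> i \<otimes>\<^bsub>M\<^esub> j \<in> ideal_prod M I' J'"
  shows "ideal_prod M I J \<subseteq> ideal_prod M I' J'"
proof
  fix a assume "a \<in> ideal_prod M I J"
  then show "a \<in> ideal_prod M I' J'" by induction (auto intro: assms ideal_prod.sum)
qed

lemma arithmetical_identity:
  assumes A: "two_sided_ideal Q A" and B: "two_sided_ideal Q B"
  shows "ideal_prod Q (A <+>\<^bsub>Q\<^esub> B) (A \<inter> B) = ideal_prod Q A B"
proof
  show "ideal_prod Q A B \<subseteq> ideal_prod Q (A <+>\<^bsub>Q\<^esub> B) (A \<inter> B)"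
  proof (rule ideal_prod_subset)
    fix a b assume ab: "a \<in> A" "b \<in> B"
    then obtain p q where pq: "p \<in> CF" "a = cs p" "q \<in> CF" "b = cs q"
      using Q_ideal(1)[OF A] Q_ideal(1)[OF B] by blast
    show "a \<otimes>\<^bsub>Q\<^esub> b \<in> ideal_prod Q (A <+>\<^bsub>Q\<^esub> B) (A \<inter> B)"
      using product_mem(2)[OF A B pq(1) _ pq(3)] ab unfolding pq(2,4) Q_mult[OF pq(1,3)] by blast
  qed
  show "ideal_prod Q (A <+>\<^bsub>Q\<^esub> B) (A \<inter> B) \<subseteq> ideal_prod Q A B"
  proof (rule ideal_prod_subset)
    fix c d assume c: "c \<in> A <+>\<^bsub>Q\<^esub> B" and d: "d \<in> A \<inter> B"
    from c obtain a b where ab: "a \<in> A" "b \<in> B" "c = a \<oplus>\<^bsub>Q\<^esub> b"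
      by (auto simp: set_add_def set_mult_def)
    from ab(1,2) d obtain p q u where pqu: "p \<in> CF" "a = cs p" "q \<in> CF" "b = cs q" "u \<in> CF" "d = cs u"
      using Q_ideal(1)[OF A] Q_ideal(1)[OF B] by blast
    have "cs (p * u) \<in> ideal_prod Q A B"
      using ideal_prod.prod[of a A d B Q] ab(1) d unfolding pqu(2,6) Q_mult[OF pqu(1,5)] by blast
    moreover have "cs (q * u) \<in> ideal_prod Q A B"
      using product_mem(1)[OF B A pqu(3) _ pqu(5)] ab(2) d unfolding pqu(4,6) by blast
    ultimately have "cs (p * u + q * u) \<in> ideal_prod Q A B"
      unfolding Q_add[symmetric] by (rule ideal_prod.sum)
    then show "c \<otimes>\<^bsub>Q\<^esub> d \<in> ideal_prod Q A B"
      unfolding ab(3) pqu(2,4,6) Q_add Q_mult[OF FC_closed(2)[OF pqu(1,3)] pqu(5)] distrib_right .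
  qed
qed

end

theorem theorem7:
  fixes E :: "('v, 'e) pre_digraph"
    and L :: "('k::field, (('v, 'e) generator word \<Rightarrow>\<^sub>0 'k) set) module"
  assumes "countable_digraph E"
    and "L = leavitt_path_algebra E"
    and "two_sided_ideal L A"
    and "two_sided_ideal L B"
  shows "ideal_prod L (A <+>\<^bsub>L\<^esub> B) (A \<inter> B) = ideal_prod L A B"
proof -
  interpret leavitt_quotient E "TYPE('k)"
    using assms(1) by (simp add: leavitt_quotient_def countable_digraph_def)
  have L: "L = Q" unfolding assms(2) leavitt_path_algebra_def Let_def ..
  show ?thesis using assms(3,4) unfolding L by (rule arithmetical_identity)
qed

end
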